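(* Let $T>\pi$ and let $\mathcal{G}_{\mathrm{Burg}}$ and $\mu$ be as in the context. There exists a constant $C>0$ such that for any $\epsilon\in(0,\tfrac12]$ there exists a shift-DeepONet $\mathcal{N}^{\mathrm{sDON}}_\epsilon$ (with ReLU component networks) with $m=3$ sensor points and $p\le C$ trunk/branch functions such that \[ \mathbb{E}_{\bar u\sim\mu}\big[\|\mathcal{G}_{\mathrm{Burg}}(\bar u)-\mathcal{N}^{\mathrm{sDON}}_\epsilon(\bar u)\|_{L^1(\mathbb{T})}\big]\le\epsilon, \] and $\mathrm{width}(\mathcal{N}^{\mathrm{sDON}}_\epsilon)\le C$, $\mathrm{depth}(\mathcal{N}^{\mathrm{sDON}}_\epsilon)\le C\log(\epsilon^{-1})^2$, $\mathrm{size}(\mathcal{N}^{\mathrm{sDON}}_\epsilon)\le C\log(\epsilon^{-1})^2$.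
   Context: $\mathbb{T}=\mathbb{R}/2\pi\mathbb{Z}$. $\mu$ is the law of the random function $\bar u(x)=-\sin(x-\xi)$ with $\xi\sim\mathrm{Unif}[0,2\pi]$. $\mathcal{G}_{\mathrm{Burg}}(\bar u)=u(\cdot,T)$ where $u$ is the entropy solution of the inviscid Burgers' equation $\partial_tu+\partial_x(u^2/2)=0$ on $\mathbb{T}$ with $u(\cdot,0)=\bar u$. A shift-DeepONet with sensor points $x_1,\dots,x_m$ and $p$ basis functions is $\mathcal{N}^{\mathrm{sDON}}(\bar u)(y)=\sum_{k=1}^p\beta_k(\mathcal{E}(\bar u))\,\tau_k\big(\mathcal{A}_k(\mathcal{E}(\bar u))\,y+\gamma_k(\mathcal{E}(\bar u))\big)$, with $\mathcal{E}(\bar u)=(\bar u(x_1),\dots,\bar u(x_m))$ and neural networks $\boldsymbol\beta:\mathbb{R}^m\to\mathbb{R}^p$ (branch), $\boldsymbol\tau:\mathbb{R}\to\mathbb{R}^p$ (trunk), $\mathcal{A}:\mathbb{R}^m\to\mathbb{R}^p$ (scale), $\boldsymbol\gamma:\mathbb{R}^m\to\mathbb{R}^p$ (shift). Network depth = number of hidden layers, width = maximal hidden layer width. Shift-DeepONet width = sum of the four widths, depth = maximum of the four depths, size $=(m+p)\,\mathrm{width}+\mathrm{width}^2\,\mathrm{depth}$. *)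

theory Defs
  imports "HOL-Analysis.Analysis" "HOL-Probability.Probability"
begin

definition kruzkov_test ::
  "(real \<Rightarrow> real \<Rightarrow> real) \<Rightarrow> (real \<Rightarrow> real \<Rightarrow> real) \<Rightarrow> (real \<Rightarrow> real \<Rightarrow> real) \<Rightarrow> bool" where
  "kruzkov_test phi phix phit \<longleftrightarrow>
     (\<forall>x t. phi x t \<ge> 0) \<and>
     (\<forall>x t. ((\<lambda>s. phi s t) has_real_derivative phix x t) (at x)) \<and>
     (\<forall>x t. ((\<lambda>s. phi x s) has_real_derivative phit x t) (at t)) \<and>
     continuous_on UNIV (\<lambda>(x, t). phix x t) \<and>
     continuous_on UNIV (\<lambda>(x, t). phit x t) \<and>
     (\<exists>R>0. \<forall>x t. (\<bar>x\<bar> \<ge> R \<or> t \<le> 1 / R \<or> t \<ge> R) \<longrightarrow> phi x t = 0)"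

definition entropy_solution :: "(real \<Rightarrow> real) \<Rightarrow> (real \<Rightarrow> real \<Rightarrow> real) \<Rightarrow> bool" where
  "entropy_solution u0 u \<longleftrightarrow>
     (\<forall>x t. t \<ge> 0 \<longrightarrow> u (x + 2 * pi) t = u x t) \<and>
     (\<lambda>(x, t). u x t) \<in> borel_measurable lborel \<and>
     (\<exists>M. \<forall>x t. t \<ge> 0 \<longrightarrow> \<bar>u x t\<bar> \<le> M) \<and>
     (\<forall>t\<ge>0. ((\<lambda>s. \<integral>\<^sup>+ x\<in>{0..2*pi}. ennreal \<bar>u x s - u x t\<bar> \<partial>lborel) \<longlongrightarrow> 0)
                (at t within {0..})) \<and>
     (\<integral>\<^sup>+ x\<in>{0..2*pi}. ennreal \<bar>u x 0 - u0 x\<bar> \<partial>lborel) = 0 \<and>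
     (\<forall>k phi phix phit. kruzkov_test phi phix phit \<longrightarrow>
        (\<integral>(x, t). (\<bar>u x t - k\<bar> * phit x t
                    + sgn (u x t - k) * ((u x t)\<^sup>2 / 2 - k\<^sup>2 / 2) * phix x t) \<partial>lborel) \<ge> 0)"

text \<open>A layer is a weight matrix (list of rows) and a bias vector.\<close>
type_synonym layer = "real list list \<times> real list"

definition affine :: "layer \<Rightarrow> real list \<Rightarrow> real list" where
  "affine L x = map (\<lambda>(row, bi). sum_list (map2 (*) row x) + bi) (zip (fst L) (snd L))"

definition relu_vec :: "real list \<Rightarrow> real list" where
  "relu_vec v = map (\<lambda>a. max 0 a) v"

fun realize :: "layer list \<Rightarrow> real list \<Rightarrow> real list" where
  "realize [] x = x"
| "realize [L] x = affine L x"
| "realize (L # Ls) x = realize Ls (relu_vec (affine L x))"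

definition valid_net :: "nat \<Rightarrow> nat \<Rightarrow> layer list \<Rightarrow> bool" where
  "valid_net nin nout Ls \<longleftrightarrow> Ls \<noteq> [] \<and>
     (\<forall>i<length Ls. length (fst (Ls ! i)) = length (snd (Ls ! i)) \<and>
        (\<forall>row\<in>set (fst (Ls ! i)). length row = (if i = 0 then nin else length (snd (Ls ! (i - 1)))))) \<and>
     length (snd (last Ls)) = nout"

text \<open>depth = number of hidden layers; width = maximal hidden layer width.\<close>
definition net_depth :: "layer list \<Rightarrow> nat" where
  "net_depth Ls = length Ls - 1"

definition net_width :: "layer list \<Rightarrow> nat" where
  "net_width Ls = foldr max (map (\<lambda>L. length (snd L)) (butlast Ls)) 0"

text \<open>Sensor points xs (m = length xs), p basis functions; branch br : R^m -> R^p,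
  trunk tr : R -> R^p, scale sc : R^m -> R^p, shift sh : R^m -> R^p.\<close>
definition is_sdon :: "real list \<Rightarrow> nat \<Rightarrow> layer list \<Rightarrow> layer list \<Rightarrow> layer list \<Rightarrow> layer list \<Rightarrow> bool" where
  "is_sdon xs p br tr sc sh \<longleftrightarrow>
     valid_net (length xs) p br \<and> valid_net 1 p tr \<and> valid_net (length xs) p sc \<and> valid_net (length xs) p sh"

definition sdon_eval ::
  "real list \<Rightarrow> nat \<Rightarrow> layer list \<Rightarrow> layer list \<Rightarrow> layer list \<Rightarrow> layer list \<Rightarrow> (real \<Rightarrow> real) \<Rightarrow> real \<Rightarrow> real" where
  "sdon_eval xs p br tr sc sh u y =
     (let e = map u xs; beta = realize br e; A = realize sc e; gamma = realize sh e
      in \<Sum>k<p. beta ! k * (realize tr [A ! k * y + gamma ! k]) ! k)"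

definition sdon_width :: "layer list \<Rightarrow> layer list \<Rightarrow> layer list \<Rightarrow> layer list \<Rightarrow> nat" where
  "sdon_width br tr sc sh = net_width br + net_width tr + net_width sc + net_width sh"

definition sdon_depth :: "layer list \<Rightarrow> layer list \<Rightarrow> layer list \<Rightarrow> layer list \<Rightarrow> nat" where
  "sdon_depth br tr sc sh = max (max (net_depth br) (net_depth tr)) (max (net_depth sc) (net_depth sh))"

definition sdon_size :: "real list \<Rightarrow> nat \<Rightarrow> layer list \<Rightarrow> layer list \<Rightarrow> layer list \<Rightarrow> layer list \<Rightarrow> nat" where
  "sdon_size xs p br tr sc sh =
     (length xs + p) * sdon_width br tr sc sh + (sdon_width br tr sc sh)\<^sup>2 * sdon_depth br tr sc sh"

end

theory Submission
  imports Defs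
begin

text \<open>Uniqueness. Let \<open>v\<close> be a classical solution on an open set. Testing the Kruzkov inequality of level \<open>k\<close>
  with \<open>\<phi> (x, t) \<rho>\<^sub>e (k - v x t)\<close> and integrating over \<open>k\<close> gives the comparison of \<open>u\<close> with \<open>v\<close> as
  \<open>e \<rightarrow> 0\<close>; only one copy of the variables is needed since \<open>v\<close> is smooth. For data \<open>- sin\<close> the solution
  carried by the characteristics \<open>y - t sin y = x\<close> is smooth on a neighbourhood of one closed period, also for
  \<open>t > 1\<close>, when the two ends take the shock values \<open>-a\<close> and \<open>a\<close>. The two ends are glued by the periodicity of \<open>u\<close>,
  and the entropy flux satisfies \<open>|w + a| (w - a) \<le> |w - a| (w + a)\<close>, so the \<open>L\<^sup>1\<close> distance of \<open>u\<close> and \<open>v\<close>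
  does not increase on \<open>(0, 1)\<close> and on \<open>(1, \<infinity>)\<close>; it is continuous in time, hence zero.

  Approximation. One basis function suffices, with branch and scale equal to 1. The shift network computes
  \<open>-\<xi>\<close> from \<open>sin \<xi>\<close> and \<open>cos \<xi>\<close> by bisection, and the trunk network solves \<open>y - T sin y = z\<close> by
  bisection and returns \<open>- sin y\<close>. Both carry a pair (sine, cosine) which is updated by rotations through the
  constant angles \<open>\<pi> / 2\<^sup>i\<close>, so that no products of variables occur, and every bisection step costs two layers of
  fixed width. The Heaviside test is replaced by a ramp of width \<open>\<eta>\<close>; for a fixed input the result is
  exact once \<open>\<eta>\<close> is small, so dominated convergence removes this error at no cost in the size.\<close>

section \<open>Spline cut-offs and integrability\<close>

text \<open>The error bound is claimed for every entropy solution, so \<open>u\<close> at time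
  \<open>T\<close> has to be identified from the Kruzkov inequalities alone. Two times resist
  testing: admissible test functions vanish near t = 0, and at t = 1 the slope 1 - t cos y of the
  characteristic map vanishes at y = 0 and y = 2 pi, so the characteristics give no classical
  solution around the closed period. Both times are crossed by the L^1 continuity built into
  \<open>entropy_solution\<close>; at t = 1 the feet on either side are compared through y - sin y.
  For T > pi every interior point of the period has its foot in [pi/2, 3 pi/2], where y - T sin y
  has slope at least 1. Its inverse is 1-Lipschitz there, so n halvings leave an error of order 2^-n
  from the shift and from the foot alike. Only within that distance of the shock x = \<xi> may the
  network take the wrong branch; an error of at most 2 on so short an interval is harmless in L^1.
  Hence n of order log (1/\<epsilon>) suffices, and \<epsilon> \<le> 1/2 keeps the logarithm away
  from 0, so that its square dominates it.\<close>

lemma has_real_derivative_pospart_sq: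
  "((\<lambda>x::real. (max 0 x)\<^sup>2) has_real_derivative 2 * max 0 x) (at x)"
proof -
  consider "x < 0" | "x = 0" | "x > 0" by linarith
  then show ?thesis
  proof cases
    case 1
    have "((\<lambda>x::real. 0) has_real_derivative 0) (at x)" by simp
    then have "((\<lambda>x::real. (max 0 x)\<^sup>2) has_real_derivative 0) (at x)"
      by (rule DERIV_cong_ev[THEN iffD1, rotated -1])
         (use 1 in \<open>auto intro!: eventually_mono[OF eventually_nhds_in_open[of "{..<0}" x]]\<close>)
    with 1 show ?thesis by simp
  next
    case 2
    have "(\<lambda>h::real. ((max 0 h)\<^sup>2 - (max 0 (0::real))\<^sup>2) / h) \<midarrow>0\<rightarrow> 0"
    proof (rule LIM_I)
      fix r :: real assume "r > 0"
      have *: "norm (((max 0 h)\<^sup>2 - (max 0 (0::real))\<^sup>2) / h - 0) \<le> norm (h - 0)" for h :: real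
        by (cases "h > 0") (auto simp: power2_eq_square)
      show "\<exists>s>0. \<forall>x::real. x \<noteq> 0 \<and> norm (x - 0) < s \<longrightarrow> norm (((max 0 x)\<^sup>2 - (max 0 (0::real))\<^sup>2) / x - 0) < r"
        using \<open>r > 0\<close> le_less_trans[OF *] by blast
    qed
    then show ?thesis using 2 by (simp add: DERIV_def)
  next
    case 3
    have "((\<lambda>x::real. x\<^sup>2) has_real_derivative 2 * x) (at x)"
      by (auto intro!: derivative_eq_intros)
    then have "((\<lambda>x::real. (max 0 x)\<^sup>2) has_real_derivative 2 * x) (at x)"
      by (rule DERIV_cong_ev[THEN iffD1, rotated -1])
         (use 3 in \<open>auto intro!: eventually_mono[OF eventually_nhds_in_open[of "{0<..}" x]]\<close>)
    with 3 show ?thesis by simp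
  qed
qed

text \<open>\<open>kruzkov_test\<close> asks for C^1 only, so squares of positive parts are regular
  enough for all cut-offs. This one is an even mollifier supported in [-1, 1]; it is not normalised,
  its mass is carried along as a positive factor.\<close>

definition bump :: "real \<Rightarrow> real" where "bump s = (max 0 (1 - s\<^sup>2))\<^sup>2"
definition bump' :: "real \<Rightarrow> real" where "bump' s = - 4 * s * max 0 (1 - s\<^sup>2)"

text \<open>A C^1 step from 0 to 1 on [0, 1], the antiderivative of the tent \<open>hat\<close> of
  height 2.\<close>

definition ramp :: "real \<Rightarrow> real" where
  "ramp x = 2 * (max 0 x)\<^sup>2 - 4 * (max 0 (x - 1/2))\<^sup>2 + 2 * (max 0 (x - 1))\<^sup>2"
definition hat :: "real \<Rightarrow> real" where
  "hat x = 4 * max 0 x - 8 * max 0 (x - 1/2) + 4 * max 0 (x - 1)"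

lemma DERIV_bump: "(bump has_real_derivative bump' s) (at s)"
proof -
  have "((\<lambda>s::real. 1 - s\<^sup>2) has_real_derivative - 2 * s) (at s)"
    by (auto intro!: derivative_eq_intros)
  from DERIV_chain2[OF has_real_derivative_pospart_sq this] show ?thesis
    by (simp add: bump_def[abs_def] bump'_def mult_ac)
qed

lemma DERIV_ramp: "(ramp has_real_derivative hat x) (at x)"
  unfolding ramp_def[abs_def] hat_def
  by (rule derivative_eq_intros DERIV_chain2[OF has_real_derivative_pospart_sq] refl | simp)+

lemma continuous_on_bump [continuous_intros]: "continuous_on S f \<Longrightarrow> continuous_on S (\<lambda>x. bump (f x))"
  unfolding bump_def by (intro continuous_intros)
lemma continuous_on_bump' [continuous_intros]: "continuous_on S f \<Longrightarrow> continuous_on S (\<lambda>x. bump' (f x))"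
  unfolding bump'_def by (intro continuous_intros)
lemma continuous_on_ramp [continuous_intros]: "continuous_on S f \<Longrightarrow> continuous_on S (\<lambda>x. ramp (f x))"
  unfolding ramp_def by (intro continuous_intros)
lemma continuous_on_hat [continuous_intros]: "continuous_on S f \<Longrightarrow> continuous_on S (\<lambda>x. hat (f x))"
  unfolding hat_def by (intro continuous_intros)

lemma borel_measurable_bump [measurable]: "bump \<in> borel_measurable borel"
  by (intro borel_measurable_continuous_onI continuous_intros)
lemma borel_measurable_bump' [measurable]: "bump' \<in> borel_measurable borel"
  by (intro borel_measurable_continuous_onI continuous_intros)
lemma borel_measurable_ramp [measurable]: "ramp \<in> borel_measurable borel"
  by (intro borel_measurable_continuous_onI continuous_intros)
lemma borel_measurable_hat [measurable]: "hat \<in> borel_measurable borel"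
  by (intro borel_measurable_continuous_onI continuous_intros)

lemma bump_nonneg: "bump s \<ge> 0" by (simp add: bump_def)

lemma bump_outside: "\<bar>s\<bar> \<ge> 1 \<Longrightarrow> bump s = 0 \<and> bump' s = 0"
  by (simp add: bump_def bump'_def max_def abs_le_square_iff[of 1 s, simplified])

lemma bump_le: "bump s \<le> 1"
  unfolding bump_def by (rule power_le_one) auto

lemma abs_bump'_le: "\<bar>bump' s\<bar> \<le> 4"
proof (cases "\<bar>s\<bar> \<ge> 1")
  case False
  then have "\<bar>s\<bar> * \<bar>max 0 (1 - s\<^sup>2)\<bar> \<le> 1 * 1"
    by (intro mult_mono) auto
  then show ?thesis by (simp add: bump'_def abs_mult)
qed (simp add: bump_outside)

lemma hat_nonneg: "hat x \<ge> 0" and hat_le: "hat x \<le> 2" and hat_outside: "x \<le> 0 \<or> x \<ge> 1 \<Longrightarrow> hat x = 0"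
  unfolding hat_def by (auto simp: max_def)

lemma ramp_0: "x \<le> 0 \<Longrightarrow> ramp x = 0" by (simp add: ramp_def)
lemma ramp_1: "x \<ge> 1 \<Longrightarrow> ramp x = 1" by (simp add: ramp_def power2_eq_square algebra_simps)
lemma ramp_mono: "x \<le> y \<Longrightarrow> ramp x \<le> ramp y"
  by (rule DERIV_nonneg_imp_nondecreasing[of x y]) (use DERIV_ramp hat_nonneg in blast)+
lemma ramp_bounds: "0 \<le> ramp x" "ramp x \<le> 1"
  using ramp_mono[of "min x 0" x] ramp_0[of "min x 0"] ramp_mono[of x "max x 1"] ramp_1[of "max x 1"] by auto

lemma integrable_compact_support:
  fixes f :: "'a::euclidean_space \<Rightarrow> real"
  assumes "f \<in> borel_measurable borel" "compact K" "\<And>x. x \<in> K \<Longrightarrow> \<bar>f x\<bar> \<le> B" "\<And>x. x \<notin> K \<Longrightarrow> f x = 0"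
  shows "integrable lborel f"
  by (rule integrableI_bounded_set[of K _ _ B])
     (use assms emeasure_compact_finite[of K] in \<open>auto intro: borel_compact\<close>)

lemma integrable_indicator_Icc: "integrable lborel (indicator {a..b::real} :: real \<Rightarrow> real)"
  by (rule integrable_compact_support[of _ "{a..b}" 1]) auto

lemma integrable_bump: "integrable lborel bump"
  by (rule integrable_compact_support[of _ "{-1..1}" 1])
     (auto simp: bump_le bump_nonneg bump_outside)
lemma integrable_bump': "integrable lborel bump'"
  by (rule integrable_compact_support[of _ "{-1..1}" 4])
     (use abs_bump'_le bump_outside in \<open>force simp: abs_if not_le\<close>)+
lemma integrable_hat: "integrable lborel hat"
  by (rule integrable_compact_support[of _ "{0..1}" 2])
     (auto simp: hat_le hat_nonneg hat_outside)

lemma integral_bump_pos: "(LBINT s. bump s) > 0"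
proof -
  have "(LBINT s. 9/16 * indicator {-1/2..1/2::real} s) \<le> (LBINT s. bump s)"
  proof (intro integral_mono integrable_bump integrable_mult_right integrable_indicator_Icc)
    fix s :: real
    show "9/16 * indicator {-1/2..1/2::real} s \<le> bump s"
    proof (cases "s \<in> {-1/2..1/2}")
      case True
      then have "\<bar>s\<bar> \<le> 1/2" by auto
      then have "s\<^sup>2 \<le> (1/2)\<^sup>2" by (metis abs_ge_zero power2_abs power_mono)
      then have "(3/4)\<^sup>2 \<le> (max 0 (1 - s\<^sup>2))\<^sup>2"
        by (intro power_mono) (auto simp: power2_eq_square)
      then show ?thesis using True by (simp add: bump_def power2_eq_square)
    qed (auto simp: bump_nonneg)
  qed
  then show ?thesis by simp
qed

text \<open>\<open>bump'\<close> is odd, so the reflection of s turns the integral into its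
  negative.\<close>

lemma integral_bump': "(LBINT s. bump' s) = 0"
  using lborel_integral_real_affine[of "-1" bump' 0] by (simp add: bump'_def)

lemma integral_hat_pos: "(LBINT s. hat s) > 0"
proof -
  have "indicator {1/4..3/4} s \<le> hat s" for s
    by (auto simp: hat_def indicator_def max_def)
  then have "(LBINT s. indicator {1/4..3/4::real} s) \<le> (LBINT s. hat s)"
    by (intro integral_mono integrable_hat integrable_indicator_Icc)
  then show ?thesis by simp
qed

section \<open>Kruzkov inequalities with a moving level\<close>

text \<open>|w - k| (w + k) / 2 is the Kruzkov flux sgn (w - k) (w^2/2 - k^2/2) with the sign
  absorbed, which makes its continuity in the level visible. The bound allows a level to be frozen
  at a nearby value.\<close>

lemma entropy_flux_lipschitz:
  fixes w k l m :: real
  assumes "\<bar>w\<bar> \<le> m" "\<bar>k\<bar> \<le> m" "\<bar>l\<bar> \<le> m"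
  shows "\<bar>\<bar>w - k\<bar> * (w + k) / 2 - \<bar>w - l\<bar> * (w + l) / 2\<bar> \<le> 2 * m * \<bar>k - l\<bar>"
proof -
  have "\<bar>w - k\<bar> * (w + k) / 2 - \<bar>w - l\<bar> * (w + l) / 2
      = ((\<bar>w - k\<bar> - \<bar>w - l\<bar>) * (w + k) + \<bar>w - l\<bar> * (k - l)) / 2"
    by (simp add: field_simps)
  also have "\<bar>\<dots>\<bar> \<le> (\<bar>k - l\<bar> * (2 * m) + (2 * m) * \<bar>k - l\<bar>) / 2"
    unfolding abs_divide abs_numeral
    by (intro divide_right_mono order_trans[OF abs_triangle_ineq] add_mono)
       (unfold abs_mult abs_abs, (intro mult_mono; use assms in linarith)+, simp)
  finally show ?thesis by (simp add: mult_ac)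
qed

text \<open>The terms with \<open>bump'\<close> carry a factor \<open>1 / e\<close>, but by \<open>v\<^sub>t = - v v\<^sub>x\<close> they multiply
  \<open>b sgn (w - k) ((w - v)\<^sup>2 - (k - v)\<^sup>2) / 2\<close>, which is constant in \<open>k\<close> up to \<open>e\<^sup>2\<close>, and \<open>bump'\<close> has integral 0.\<close>

lemma level_average:
  fixes w v b f ft fx e m :: real
  assumes e: "0 < e" "e \<le> 1" and w: "\<bar>w\<bar> \<le> m" and v: "\<bar>v\<bar> + 1 \<le> m"
  shows "\<bar>(LBINT k. \<bar>w - k\<bar> * (ft * bump ((k - v) / e) + f * bump' ((k - v) / e) * (v * b) / e)
             + sgn (w - k) * (w\<^sup>2 / 2 - k\<^sup>2 / 2) * (fx * bump ((k - v) / e) - f * bump' ((k - v) / e) * b / e))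
          - e * (LBINT s. bump s) * (\<bar>w - v\<bar> * ft + \<bar>w - v\<bar> * (w + v) / 2 * fx)\<bar>
         \<le> 2 * e\<^sup>2 * (\<bar>ft\<bar> + 2 * m * \<bar>fx\<bar> + 4 * \<bar>f\<bar> * \<bar>b\<bar>)"
proof -
  define g where "g k = \<bar>w - k\<bar> * (ft * bump ((k - v) / e) + f * bump' ((k - v) / e) * (v * b) / e)
             + sgn (w - k) * (w\<^sup>2 / 2 - k\<^sup>2 / 2) * (fx * bump ((k - v) / e) - f * bump' ((k - v) / e) * b / e)" for k
  define h where "h s = g (v + e * s)" for s
  define L where "L = \<bar>w - v\<bar> * ft + \<bar>w - v\<bar> * (w + v) / 2 * fx"
  \<comment> \<open>If |w - v| > e, the sign of w - k is the same for all k within e of v, and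
    \<open>c0\<close> is the value at k = v of the factor of \<open>bump'\<close>. Otherwise both
    squares are at most e^2, and 0 is close enough.\<close>
  define c0 where "c0 = (if \<bar>w - v\<bar> \<le> e then 0 else - sgn (w - v) * (w - v)\<^sup>2 / 2)"
  define C where "C = \<bar>ft\<bar> + 2 * m * \<bar>fx\<bar> + 4 * \<bar>f\<bar> * \<bar>b\<bar>"
  have C0: "C \<ge> 0" using v by (auto simp: C_def)
  have g_meas [measurable]: "g \<in> borel_measurable borel"
    unfolding g_def by measurable
  have h_meas [measurable]: "h \<in> borel_measurable borel"
    unfolding h_def by measurable
  have sg: "sgn (w - k) * (w\<^sup>2 / 2 - k\<^sup>2 / 2) = \<bar>w - k\<bar> * (w + k) / 2" for k :: real
    by (simp add: abs_sgn power2_eq_square algebra_simps)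
  have h_eq: "h s = bump s * (\<bar>w - (v + e * s)\<bar> * ft + \<bar>w - (v + e * s)\<bar> * (w + (v + e * s)) / 2 * fx)
      + f * b / e * bump' s * (\<bar>w - (v + e * s)\<bar> * (v - (w + (v + e * s)) / 2))" for s
    using e unfolding h_def g_def sg by (simp add: field_simps)
  have key: "\<bar>h s - (L * bump s + f * b / e * c0 * bump' s)\<bar> \<le> e * C * indicator {-1..1} s" for s
  proof (cases "\<bar>s\<bar> < 1")
    case False
    then show ?thesis using bump_outside[of s] by (auto simp: h_eq indicator_def C0 e(1) less_imp_le)
  next
    case True
    define k where "k = v + e * s"
    have kv: "\<bar>k - v\<bar> \<le> e"
      using True e by (simp add: k_def abs_mult mult_left_le)
    have k: "\<bar>k\<bar> \<le> m" using kv v e by linarith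
    have d1: "\<bar>\<bar>w - k\<bar> - \<bar>w - v\<bar>\<bar> \<le> e" using kv by linarith
    have d2: "\<bar>\<bar>w - k\<bar> * (w + k) / 2 - \<bar>w - v\<bar> * (w + v) / 2\<bar> \<le> 2 * m * e"
      by (rule order_trans[OF entropy_flux_lipschitz[of w m] mult_left_mono[OF kv]]) (use w k v in simp_all)
    have d3: "\<bar>\<bar>w - k\<bar> * (v - (w + k) / 2) - c0\<bar> \<le> e\<^sup>2"
    proof -
      have id: "\<bar>w - k\<bar> * (v - (w + k) / 2) = - sgn (w - k) * ((w - v)\<^sup>2 - (k - v)\<^sup>2) / 2"
        by (simp add: abs_sgn power2_eq_square field_simps)
      have ke: "(k - v)\<^sup>2 \<le> e\<^sup>2"
        using kv e by (simp add: abs_le_square_iff[symmetric])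
      show ?thesis
      proof (cases "\<bar>w - v\<bar> \<le> e")
        case True
        then have we: "(w - v)\<^sup>2 \<le> e\<^sup>2"
          using e by (simp add: abs_le_square_iff[symmetric])
        have "\<bar>- sgn (w - k) * ((w - v)\<^sup>2 - (k - v)\<^sup>2) / 2\<bar> \<le> 1 * \<bar>(w - v)\<^sup>2 - (k - v)\<^sup>2\<bar> / 2"
          by (auto simp: abs_mult sgn_if)
        also have "\<dots> \<le> e\<^sup>2"
        proof -
          have "\<bar>A - B\<bar> / 2 \<le> E" if "0 \<le> A" "0 \<le> B" "A \<le> E" "B \<le> E" for A B E :: real
            using that by (auto simp: abs_if)
          from this[OF _ _ we ke] show ?thesis by simp
        qed
        finally show ?thesis using True by (simp add: id c0_def)
      next
        case False
        then have "sgn (w - k) = sgn (w - v)" using kv by (auto simp: sgn_if)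
        then have "\<bar>w - k\<bar> * (v - (w + k) / 2) - c0 = sgn (w - v) * (k - v)\<^sup>2 / 2"
          using False unfolding id by (simp add: c0_def right_diff_distrib diff_divide_distrib)
        also have "\<bar>\<dots>\<bar> \<le> e\<^sup>2"
          using order_trans[OF ke, of "e\<^sup>2 * 2"] by (auto simp: sgn_if)
        finally show ?thesis .
      qed
    qed
    have "h s - (L * bump s + f * b / e * c0 * bump' s)
        = bump s * ((\<bar>w - k\<bar> - \<bar>w - v\<bar>) * ft + (\<bar>w - k\<bar> * (w + k) / 2 - \<bar>w - v\<bar> * (w + v) / 2) * fx)
          + f * b / e * bump' s * (\<bar>w - k\<bar> * (v - (w + k) / 2) - c0)" (is "_ = ?A * (?B + ?C) + ?D")
      unfolding h_eq L_def k_def by (simp add: algebra_simps)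
    also have "\<bar>\<dots>\<bar> \<le> \<bar>?A\<bar> * (\<bar>?B\<bar> + \<bar>?C\<bar>) + \<bar>?D\<bar>"
      by (rule order_trans[OF abs_triangle_ineq])
         (unfold abs_mult[of ?A], intro add_mono mult_left_mono abs_triangle_ineq, auto)
    also have "\<dots> \<le> 1 * (e * \<bar>ft\<bar> + 2 * m * e * \<bar>fx\<bar>) + \<bar>f\<bar> * \<bar>b\<bar> / e * 4 * e\<^sup>2"
    proof (intro add_mono mult_mono)
      show "\<bar>?B\<bar> \<le> e * \<bar>ft\<bar>" unfolding abs_mult by (intro mult_right_mono d1) auto
      show "\<bar>?C\<bar> \<le> 2 * m * e * \<bar>fx\<bar>" unfolding abs_mult[of _ fx] by (intro mult_right_mono d2) auto
      show "\<bar>?D\<bar> \<le> \<bar>f\<bar> * \<bar>b\<bar> / e * 4 * e\<^sup>2"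
        unfolding abs_mult[of "_ * bump' s"] abs_mult[of _ "bump' s"]
        by (intro mult_mono d3) (use e abs_bump'_le in \<open>auto simp: abs_mult\<close>)
    qed (use bump_nonneg bump_le in auto)
    also have "\<dots> = e * C" using e by (simp add: C_def field_simps power2_eq_square)
    finally show ?thesis using True by (simp add: indicator_def abs_less_iff)
  qed
  have int_h: "integrable lborel h"
  proof (rule integrable_compact_support[of _ "{-1..1}"])
    fix s
    have "\<bar>h s\<bar> \<le> \<bar>h s - (L * bump s + f * b / e * c0 * bump' s)\<bar> + \<bar>L\<bar> * \<bar>bump s\<bar> + \<bar>f * b / e * c0\<bar> * \<bar>bump' s\<bar>"
    proof -
      have "\<bar>x\<bar> \<le> \<bar>x - (p + q)\<bar> + \<bar>p\<bar> + \<bar>q\<bar>" for x p q :: real by linarith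
      then show ?thesis unfolding abs_mult[symmetric] .
    qed
    also have "\<dots> \<le> e * C + \<bar>L\<bar> * 1 + \<bar>f * b / e * c0\<bar> * 4"
      using order_trans[OF key[of s], of "e * C"] bump_nonneg[of s] bump_le[of s] abs_bump'_le[of s] C0 e
      by (intro add_mono mult_left_mono) (auto simp: indicator_def)
    finally show "\<bar>h s\<bar> \<le> e * C + \<bar>L\<bar> * 1 + \<bar>f * b / e * c0\<bar> * 4" .
  next
    fix s :: real assume "s \<notin> {-1..1}"
    then have "1 \<le> \<bar>s\<bar>" by auto
    then show "h s = 0" using bump_outside[of s] by (simp add: h_eq)
  qed auto
  have int_l: "integrable lborel (\<lambda>s. L * bump s + f * b / e * c0 * bump' s)"
    by (intro Bochner_Integration.integrable_add integrable_mult_right integrable_bump integrable_bump')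
  have "\<bar>(LBINT s. h s) - L * (LBINT s. bump s)\<bar>
      = \<bar>\<integral>s. h s - (L * bump s + f * b / e * c0 * bump' s) \<partial>lborel\<bar>"
    using int_h int_l integrable_bump integrable_bump'
    by (simp add: Bochner_Integration.integral_diff Bochner_Integration.integral_add integral_bump')
  also have "\<dots> \<le> (LBINT s. \<bar>h s - (L * bump s + f * b / e * c0 * bump' s)\<bar>)"
    by (rule integral_abs_bound)
  also have "\<dots> \<le> (LBINT s. e * C * indicator {-1..1::real} s)"
    by (intro integral_mono key integrable_mult_right integrable_indicator_Icc integrable_abs
        Bochner_Integration.integrable_diff int_h int_l)
  also have "\<dots> = 2 * (e * C)" by simp
  finally have *: "\<bar>(LBINT s. h s) - L * (LBINT s. bump s)\<bar> \<le> 2 * (e * C)" .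
  have "(LBINT k. g k) = e * (LBINT s. h s)"
    using lborel_integral_real_affine[of e g v] e by (simp add: h_def)
  then have "(LBINT k. g k) - e * (LBINT s. bump s) * L
    = e * ((LBINT s. h s) - L * (LBINT s. bump s))"
    by (simp add: algebra_simps)
  then have "\<bar>(LBINT k. g k) - e * (LBINT s. bump s) * L\<bar>
    = e * \<bar>(LBINT s. h s) - L * (LBINT s. bump s)\<bar>"
    using e by (simp add: abs_mult)
  also have "\<dots> \<le> e * (2 * (e * C))" using * e by simp
  finally show ?thesis unfolding g_def L_def C_def by (simp add: power2_eq_square mult_ac)
qed

text \<open>A zero of the nonnegative \<open>phi\<close> is a minimum. Hence the support condition
  on \<open>phi\<close> alone controls both derivatives.\<close>

lemma kruzkov_test_zero:
  assumes "kruzkov_test phi phix phit" "phi x t = 0"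
  shows "phix x t = 0" "phit x t = 0"
proof -
  have pos: "phi y s \<ge> 0" for y s using assms(1) by (simp add: kruzkov_test_def)
  have dx: "((\<lambda>s. phi s t) has_real_derivative phix x t) (at x)"
   and dt: "((\<lambda>s. phi x s) has_real_derivative phit x t) (at t)"
    using assms(1) by (simp_all add: kruzkov_test_def)
  show "phix x t = 0" by (rule DERIV_local_min[OF dx zero_less_one]) (simp add: assms(2) pos)
  show "phit x t = 0" by (rule DERIV_local_min[OF dt zero_less_one]) (simp add: assms(2) pos)
qed

text \<open>The equation sits in the prescribed value of the time derivative. Outside \<Omega> both
  functions are arbitrary.\<close>

definition classical_burgers :: "(real \<times> real) set \<Rightarrow> (real \<Rightarrow> real \<Rightarrow> real) \<Rightarrow> (real \<Rightarrow> real \<Rightarrow> real) \<Rightarrow> bool" where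
  "classical_burgers \<Omega> v vx \<longleftrightarrow> open \<Omega> \<and>
     (\<forall>x t. (x, t) \<in> \<Omega> \<longrightarrow> ((\<lambda>s. v s t) has_real_derivative vx x t) (at x)
        \<and> ((\<lambda>s. v x s) has_real_derivative - (v x t * vx x t)) (at t)) \<and>
     continuous_on \<Omega> (\<lambda>(x, t). v x t) \<and> continuous_on \<Omega> (\<lambda>(x, t). vx x t)"

lemma classical_burgersD:
  assumes "classical_burgers \<Omega> v vx"
  shows "open \<Omega>"
    "\<And>x t. (x, t) \<in> \<Omega> \<Longrightarrow> ((\<lambda>s. v s t) has_real_derivative vx x t) (at x)"
    "\<And>x t. (x, t) \<in> \<Omega> \<Longrightarrow> ((\<lambda>s. v x s) has_real_derivative - (v x t * vx x t)) (at t)"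
    "continuous_on \<Omega> (\<lambda>(x, t). v x t)" "continuous_on \<Omega> (\<lambda>(x, t). vx x t)"
  using assms unfolding classical_burgers_def by blast+

text \<open>Since \<open>v\<close> is uncontrolled outside \<Omega>, derivatives and continuity are
  checked on the open cover by \<Omega> and the complement of K; on the latter everything vanishes
  locally.\<close>

lemma kruzkov_test_moving_level:
  fixes v vx phi phix phit :: "real \<Rightarrow> real \<Rightarrow> real" and \<Omega> K :: "(real \<times> real) set"
  assumes cl: "classical_burgers \<Omega> v vx"
    and phi: "kruzkov_test phi phix phit" and cont_phi: "continuous_on UNIV (\<lambda>(x, t). phi x t)"
    and K: "closed K" "K \<subseteq> \<Omega>" "\<And>x t. (x, t) \<notin> K \<Longrightarrow> phi x t = 0"
    and e: "0 < e"
  shows "kruzkov_test (\<lambda>x t. phi x t * bump ((k - v x t) / e))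
     (\<lambda>x t. phix x t * bump ((k - v x t) / e) - phi x t * bump' ((k - v x t) / e) * vx x t / e)
     (\<lambda>x t. phit x t * bump ((k - v x t) / e) + phi x t * bump' ((k - v x t) / e) * (v x t * vx x t) / e)"
    (is "kruzkov_test ?F ?Fx ?Ft")
proof -
  note \<Omega> = classical_burgersD(1)[OF cl] and v_x = classical_burgersD(2)[OF cl] and v_t = classical_burgersD(3)[OF cl]
    and cont_v = classical_burgersD(4)[OF cl] and cont_vx = classical_burgersD(5)[OF cl]
  have phi': "\<And>x t. phi x t \<ge> 0"
     "\<And>x t. ((\<lambda>s. phi s t) has_real_derivative phix x t) (at x)"
     "\<And>x t. ((\<lambda>s. phi x s) has_real_derivative phit x t) (at t)"
     "continuous_on UNIV (\<lambda>(x, t). phix x t)" "continuous_on UNIV (\<lambda>(x, t). phit x t)"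
     "\<exists>R>0. \<forall>x t. (\<bar>x\<bar> \<ge> R \<or> t \<le> 1 / R \<or> t \<ge> R) \<longrightarrow> phi x t = 0"
    using phi by (simp_all add: kruzkov_test_def)
  have e0: "e \<noteq> 0" using e by simp
  have cover: "\<Omega> \<union> - K = UNIV" using K by auto
  have oK: "open (- K)" using K by (simp add: open_Compl)
  have zero: "phi x t = 0" "phix x t = 0" "phit x t = 0" if "(x, t) \<notin> K" for x t
    using kruzkov_test_zero[OF phi K(3)[OF that]] K(3)[OF that] by auto
  have Dx: "((\<lambda>s. ?F s t) has_real_derivative ?Fx x t) (at x)" for x t
  proof (cases "(x, t) \<in> \<Omega>")
    case True
    have "((\<lambda>s. (k - v s t) / e) has_real_derivative - vx x t / e) (at x)"
      by (rule derivative_eq_intros v_x[OF True] refl e0 | simp add: e0)+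
    from DERIV_mult[OF phi'(2)[of t x] DERIV_chain2[OF DERIV_bump this]]
    show ?thesis by (simp add: algebra_simps)
  next
    case False
    then have nK: "(x, t) \<notin> K" using K by auto
    have "open ((\<lambda>s. (s, t)) -` (- K))"
      by (rule continuous_open_vimage[OF oK]) (intro continuous_intros)
    then have "eventually (\<lambda>s. s \<in> (\<lambda>s. (s, t)) -` (- K)) (nhds x)"
      using nK by (intro eventually_nhds_in_open) auto
    then have ev: "eventually (\<lambda>s. ?F s t = 0) (nhds x)"
      by eventually_elim (simp add: zero)
    have "((\<lambda>s. ?F s t) has_real_derivative 0) (at x)"
      by (rule iffD2[OF DERIV_cong_ev[OF refl ev refl] DERIV_const])
    then show ?thesis using zero[OF nK] by simp
  qed
  have Dt: "((\<lambda>s. ?F x s) has_real_derivative ?Ft x t) (at t)" for x t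
  proof (cases "(x, t) \<in> \<Omega>")
    case True
    have "((\<lambda>s. (k - v x s) / e) has_real_derivative (v x t * vx x t) / e) (at t)"
      by (rule derivative_eq_intros v_t[OF True] refl e0 | simp add: e0)+
    from DERIV_mult[OF phi'(3)[of x t] DERIV_chain2[OF DERIV_bump this]]
    show ?thesis by (simp add: algebra_simps)
  next
    case False
    then have nK: "(x, t) \<notin> K" using K by auto
    have "open ((\<lambda>s. (x, s)) -` (- K))"
      by (rule continuous_open_vimage[OF oK]) (intro continuous_intros)
    then have "eventually (\<lambda>s. s \<in> (\<lambda>s. (x, s)) -` (- K)) (nhds t)"
      using nK by (intro eventually_nhds_in_open) auto
    then have ev: "eventually (\<lambda>s. ?F x s = 0) (nhds t)"
      by eventually_elim (simp add: zero)
    have "((\<lambda>s. ?F x s) has_real_derivative 0) (at t)"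
      by (rule iffD2[OF DERIV_cong_ev[OF refl ev refl] DERIV_const])
    then show ?thesis using zero[OF nK] by simp
  qed
  have sub: "continuous_on \<Omega> (\<lambda>(x, t). f x t)" if "continuous_on UNIV (\<lambda>(x, t). f x t)" for f :: "real \<Rightarrow> real \<Rightarrow> real"
    using that continuous_on_subset by blast
  note cs = cont_v[unfolded case_prod_beta] cont_vx[unfolded case_prod_beta]
    sub[OF cont_phi, unfolded case_prod_beta] sub[OF phi'(4), unfolded case_prod_beta] sub[OF phi'(5), unfolded case_prod_beta]
  have Cx: "continuous_on UNIV (\<lambda>(x, t). ?Fx x t)"
  proof -
    have "continuous_on (- K) (\<lambda>(x, t). ?Fx x t)"
      by (rule continuous_on_eq[of _ "\<lambda>_. 0"]) (auto simp: zero)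
    moreover have "continuous_on \<Omega> (\<lambda>(x, t). ?Fx x t)"
      unfolding case_prod_beta by (intro continuous_intros cs) (use e in auto)
    ultimately show ?thesis using continuous_on_open_Un[OF \<Omega> oK, of "\<lambda>(x, t). ?Fx x t"] cover by simp
  qed
  have Ct: "continuous_on UNIV (\<lambda>(x, t). ?Ft x t)"
  proof -
    have "continuous_on (- K) (\<lambda>(x, t). ?Ft x t)"
      by (rule continuous_on_eq[of _ "\<lambda>_. 0"]) (auto simp: zero)
    moreover have "continuous_on \<Omega> (\<lambda>(x, t). ?Ft x t)"
      unfolding case_prod_beta by (intro continuous_intros cs) (use e in auto)
    ultimately show ?thesis using continuous_on_open_Un[OF \<Omega> oK, of "\<lambda>(x, t). ?Ft x t"] cover by simp
  qed
  obtain R where R: "R > 0" "\<And>x t. \<bar>x\<bar> \<ge> R \<or> t \<le> 1 / R \<or> t \<ge> R \<Longrightarrow> phi x t = 0"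
    using phi'(6) by blast
  show ?thesis
    unfolding kruzkov_test_def
  proof (intro conjI allI)
    show "\<exists>R>0. \<forall>x t. \<bar>x\<bar> \<ge> R \<or> t \<le> 1 / R \<or> t \<ge> R \<longrightarrow> ?F x t = 0"
      using R by (intro exI[of _ R]) auto
  qed (use Dx Dt Cx Ct phi'(1) bump_nonneg in auto)
qed

text \<open>This is the Kato inequality for the pair \<open>u\<close>, \<open>v\<close>. Fubini
  moves the integral over the levels inside the one over K, where \<open>level_average\<close>
  applies at each point.\<close>

theorem kruzkov_moving_level:
  fixes u v vx phi phix phit :: "real \<Rightarrow> real \<Rightarrow> real" and \<Omega> K :: "(real \<times> real) set"
  assumes ent: "entropy_solution u0 u"
    and cl: "classical_burgers \<Omega> v vx"
    and phi: "kruzkov_test phi phix phit" and cont_phi: "continuous_on UNIV (\<lambda>(x, t). phi x t)"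
    and K: "compact K" "K \<subseteq> \<Omega>" "\<And>x t. (x, t) \<notin> K \<Longrightarrow> phi x t = 0"
  shows "0 \<le> (LBINT (x, t). \<bar>u x t - v x t\<bar> * phit x t + \<bar>u x t - v x t\<bar> * (u x t + v x t) / 2 * phix x t)"
proof -
  note \<Omega> = classical_burgersD(1)[OF cl] and cont_v = classical_burgersD(4)[OF cl] and cont_vx = classical_burgersD(5)[OF cl]
  define U where "U p = u (fst p) (snd p)" for p
  \<comment> \<open>Extended by 0, \<open>v\<close> and \<open>vx\<close> become Borel functions on
    the plane; where \<open>phi\<close> is not 0 they are unchanged.\<close>
  define V where "V p = indicator \<Omega> p *\<^sub>R v (fst p) (snd p)" for p
  define W where "W p = indicator \<Omega> p *\<^sub>R vx (fst p) (snd p)" for p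
  define P where "P p = phi (fst p) (snd p)" for p
  define Px where "Px p = phix (fst p) (snd p)" for p
  define Pt where "Pt p = phit (fst p) (snd p)" for p
  have contP: "continuous_on UNIV P" "continuous_on UNIV Px" "continuous_on UNIV Pt"
    using phi cont_phi by (simp_all add: kruzkov_test_def P_def[abs_def] Px_def[abs_def] Pt_def[abs_def] case_prod_beta)
  have [measurable]: "P \<in> borel_measurable borel" "Px \<in> borel_measurable borel" "Pt \<in> borel_measurable borel"
    using contP by (auto intro: borel_measurable_continuous_onI)
  have [measurable]: "U \<in> borel_measurable borel"
    using ent by (simp add: entropy_solution_def U_def[abs_def] split_beta')
  have [measurable]: "V \<in> borel_measurable borel" "W \<in> borel_measurable borel"
    using \<Omega> cont_v cont_vx unfolding V_def[abs_def] W_def[abs_def] split_beta'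
    by (intro borel_measurable_continuous_on_indicator; simp)+
  have zero: "P p = 0" "Px p = 0" "Pt p = 0" if "p \<notin> K" for p
    using kruzkov_test_zero[OF phi K(3), of "fst p" "snd p"] K(3)[of "fst p" "snd p"] that
    by (auto simp: P_def Px_def Pt_def)
  have zero': "Px p = 0" "Pt p = 0" if "P p = 0" for p
    using kruzkov_test_zero[OF phi, of "fst p" "snd p"] that by (auto simp: P_def Px_def Pt_def)
  have VK: "V p = v (fst p) (snd p)" "W p = vx (fst p) (snd p)" if "P p \<noteq> 0" for p
  proof -
    have "p \<in> \<Omega>" using zero(1)[of p] that K(2) by auto
    then show "V p = v (fst p) (snd p)" "W p = vx (fst p) (snd p)" by (simp_all add: V_def W_def)
  qed
  obtain M where M: "\<And>x t. t \<ge> 0 \<Longrightarrow> \<bar>u x t\<bar> \<le> M" using ent by (auto simp: entropy_solution_def)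
  have UM: "\<bar>U p\<bar> \<le> M" if "P p \<noteq> 0" for p
  proof -
    obtain R where "R > 0" "\<forall>x t. \<bar>x\<bar> \<ge> R \<or> t \<le> 1 / R \<or> t \<ge> R \<longrightarrow> phi x t = 0"
      using phi by (auto simp: kruzkov_test_def)
    then have "snd p > 1 / R" using that by (force simp: P_def not_le)
    moreover have "1 / R > 0" using \<open>R > 0\<close> by simp
    ultimately have "snd p \<ge> 0" by linarith
    then show ?thesis using M by (simp add: U_def)
  qed
  have bd: "\<exists>B\<ge>0. \<forall>p\<in>K. \<bar>f p\<bar> \<le> B" if "continuous_on K f" for f :: "real \<times> real \<Rightarrow> real"
  proof -
    have "bounded (f ` K)" by (intro compact_imp_bounded compact_continuous_image that K)
    then obtain B where "\<forall>p\<in>K. norm (f p) \<le> B" by (auto simp: bounded_iff)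
    then show ?thesis by (intro exI[of _ "max B 0"]) (auto simp: le_max_iff_disj)
  qed
  have "continuous_on K (\<lambda>p. v (fst p) (snd p))" "continuous_on K (\<lambda>p. vx (fst p) (snd p))"
    using cont_v cont_vx K(2) unfolding case_prod_beta by (auto intro: continuous_on_subset)
  from bd[OF this(1)] bd[OF this(2)] obtain Bv Bw
    where Bv: "Bv \<ge> 0" "\<And>p. P p \<noteq> 0 \<Longrightarrow> \<bar>V p\<bar> \<le> Bv" and Bw: "Bw \<ge> 0" "\<And>p. P p \<noteq> 0 \<Longrightarrow> \<bar>W p\<bar> \<le> Bw"
    using VK zero(1) by metis
  from bd[OF continuous_on_subset[OF contP(1)]] bd[OF continuous_on_subset[OF contP(2)]] bd[OF continuous_on_subset[OF contP(3)]]
  obtain B0 Bx Bt where B: "B0 \<ge> 0" "\<And>p. \<bar>P p\<bar> \<le> B0" "Bx \<ge> 0" "\<And>p. \<bar>Px p\<bar> \<le> Bx" "Bt \<ge> 0" "\<And>p. \<bar>Pt p\<bar> \<le> Bt"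
    by (smt (verit, ccfv_threshold) zero subset_UNIV)
  \<comment> \<open>The summand 1 makes room for the levels: a level with nonzero
    \<open>bump\<close> is within e \<le> 1 of \<open>V p\<close>, so all relevant k satisfy |k|
    \<le> m.\<close>
  define m where "m = max M 0 + Bv + 1"
  have m: "m \<ge> 1" "\<And>p. P p \<noteq> 0 \<Longrightarrow> \<bar>U p\<bar> \<le> m" "\<And>p. P p \<noteq> 0 \<Longrightarrow> \<bar>V p\<bar> + 1 \<le> m"
    using UM Bv by (fastforce simp: m_def)+
  define c where "c = (LBINT s. bump s)"
  have c: "c > 0" unfolding c_def by (rule integral_bump_pos)
  define L where "L p = \<bar>U p - V p\<bar> * Pt p + \<bar>U p - V p\<bar> * (U p + V p) / 2 * Px p" for p
  have [measurable]: "L \<in> borel_measurable borel" unfolding L_def[abs_def] by measurable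
  have L0: "L p = 0" if "P p = 0" for p using zero'[OF that] by (simp add: L_def)
  have intL: "integrable lborel L"
  proof (rule integrable_compact_support[OF _ K(1)])
    fix p
    show "\<bar>L p\<bar> \<le> (m + m) * Bt + (m + m) * (m + m) / 2 * Bx"
    proof (cases "P p = 0")
      case True then show ?thesis using L0 m(1) B by simp
    next
      case False
      have UV: "\<bar>U p - V p\<bar> \<le> m + m" "\<bar>U p + V p\<bar> \<le> m + m"
        using m(2,3)[OF False] by linarith+
      have "\<bar>L p\<bar> \<le> \<bar>\<bar>U p - V p\<bar> * Pt p\<bar> + \<bar>\<bar>U p - V p\<bar> * (U p + V p) / 2 * Px p\<bar>"
        unfolding L_def by (rule abs_triangle_ineq)
      also have "\<dots> \<le> (m + m) * Bt + (m + m) * (m + m) / 2 * Bx"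
        unfolding abs_mult abs_divide abs_abs abs_numeral
        by (intro add_mono mult_mono divide_right_mono) (use m(1) UV B(1,3,5) B(2,4,6)[of p] in simp_all)
      finally show ?thesis .
    qed
  qed (use L0 zero in auto)
  define Cst where "Cst = 2 * (Bt + 2 * m * Bx + 4 * B0 * Bw)"
  have Cst: "Cst \<ge> 0" using B Bw m(1) by (simp add: Cst_def)
  \<comment> \<open>Averaging over the levels gives e c L up to an error of order e^2 on K. After
    division by e the error is of order e and disappears in the limit.\<close>
  have main: "- (e * (Cst * measure lborel K)) \<le> c * (LBINT p. L p)" if e: "0 < e" "e \<le> 1" for e
  proof -
    define E where "E k p = \<bar>U p - k\<bar> * (Pt p * bump ((k - V p) / e) + P p * bump' ((k - V p) / e) * (V p * W p) / e)
             + sgn (U p - k) * ((U p)\<^sup>2 / 2 - k\<^sup>2 / 2) * (Px p * bump ((k - V p) / e) - P p * bump' ((k - V p) / e) * W p / e)" for k p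
    have E0: "E k p = 0" if "P p = 0" for k p using zero'[OF that] that by (simp add: E_def)
    have Epos: "0 \<le> (LBINT p. E k p)" for k
    proof -
      have *: "kruzkov_test (\<lambda>x t. phi x t * bump ((k - v x t) / e))
     (\<lambda>x t. phix x t * bump ((k - v x t) / e) - phi x t * bump' ((k - v x t) / e) * vx x t / e)
     (\<lambda>x t. phit x t * bump ((k - v x t) / e) + phi x t * bump' ((k - v x t) / e) * (v x t * vx x t) / e)"
        using kruzkov_test_moving_level[OF cl phi cont_phi compact_imp_closed[OF K(1)] K(2,3) e(1)] .
      have "0 \<le> (LBINT (x, t). (\<bar>u x t - k\<bar> * (phit x t * bump ((k - v x t) / e) + phi x t * bump' ((k - v x t) / e) * (v x t * vx x t) / e)
                    + sgn (u x t - k) * ((u x t)\<^sup>2 / 2 - k\<^sup>2 / 2) * (phix x t * bump ((k - v x t) / e) - phi x t * bump' ((k - v x t) / e) * vx x t / e)))"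
        using ent * unfolding entropy_solution_def by blast
      also have "\<dots> = (LBINT p. E k p)"
      proof (intro Bochner_Integration.integral_cong refl)
        fix p :: "real \<times> real"
        show "(case p of (x, t) \<Rightarrow> \<bar>u x t - k\<bar> * (phit x t * bump ((k - v x t) / e) + phi x t * bump' ((k - v x t) / e) * (v x t * vx x t) / e)
                    + sgn (u x t - k) * ((u x t)\<^sup>2 / 2 - k\<^sup>2 / 2) * (phix x t * bump ((k - v x t) / e) - phi x t * bump' ((k - v x t) / e) * vx x t / e)) = E k p"
        proof (cases "P p = 0")
          case True
          then show ?thesis using E0[OF True] zero'[OF True] by (simp add: P_def Px_def Pt_def case_prod_beta)
        next
          case False
          then show ?thesis by (simp add: E_def VK U_def P_def Px_def Pt_def case_prod_beta)
        qed
      qed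
      finally show ?thesis .
    qed
    have inner: "\<bar>(LBINT k. E k p) - e * c * L p\<bar> \<le> e\<^sup>2 * Cst * indicator K p" for p
    proof (cases "P p = 0")
      case True then show ?thesis using E0 L0 Cst e by simp
    next
      case False
      then have "p \<in> K" using zero(1)[of p] by blast
      have "\<bar>(LBINT k. E k p) - e * c * L p\<bar> \<le> 2 * e\<^sup>2 * (\<bar>Pt p\<bar> + 2 * m * \<bar>Px p\<bar> + 4 * \<bar>P p\<bar> * \<bar>W p\<bar>)"
        unfolding E_def L_def c_def by (rule level_average[OF e m(2)[OF False] m(3)[OF False]])
      also have "\<dots> \<le> 2 * e\<^sup>2 * (Bt + 2 * m * Bx + 4 * B0 * Bw)"
        by (intro mult_left_mono add_mono mult_mono) (use B(1,3,5) B(2,4,6)[of p] Bw(1) Bw(2)[OF False] m(1) in simp_all)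
      finally show ?thesis using \<open>p \<in> K\<close> by (simp add: Cst_def algebra_simps)
    qed
    \<comment> \<open>This bound blows up as e tends to 0, which is harmless: it only serves
      integrability for Fubini at a fixed e.\<close>
    define D where "D = (m + m) * (Bt + B0 * 4 * (m * Bw) / e) + m\<^sup>2 * (Bx + B0 * 4 * Bw / e)"
    have D0: "D \<ge> 0" using B(1,3,5) Bw m(1) e
      unfolding D_def by (intro add_nonneg_nonneg mult_nonneg_nonneg divide_nonneg_nonneg) auto
    have Ebound: "\<bar>E k p\<bar> \<le> D" if "P p \<noteq> 0" "\<bar>k\<bar> \<le> m" for k p
    proof -
      define x where "x = (k - V p) / e"
      have Vm: "\<bar>V p\<bar> \<le> m" using m(3)[OF that(1)] by simp
      have bb: "\<bar>bump x\<bar> \<le> 1" using bump_nonneg[of x] bump_le[of x] by simp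
      have 1: "\<bar>U p - k\<bar> \<le> m + m" using m(2)[OF that(1)] that(2) by linarith
      have 2: "\<bar>Pt p * bump x\<bar> \<le> Bt * 1" unfolding abs_mult by (rule mult_mono[OF B(6) bb B(5)]) simp
      have 3: "\<bar>P p * bump' x * (V p * W p)\<bar> \<le> B0 * 4 * (m * Bw)"
        unfolding abs_mult by (intro mult_mono B abs_bump'_le Vm Bw(2)[OF that(1)]) (use B(1) m(1) in simp_all)
      have 4: "\<bar>Px p * bump x\<bar> \<le> Bx * 1" unfolding abs_mult by (rule mult_mono[OF B(4) bb B(3)]) simp
      have 5: "\<bar>P p * bump' x * W p\<bar> \<le> B0 * 4 * Bw"
        unfolding abs_mult by (intro mult_mono B abs_bump'_le Bw(2)[OF that(1)]) (use B(1) in simp_all)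
      have 6: "\<bar>sgn (U p - k) * ((U p)\<^sup>2 / 2 - k\<^sup>2 / 2)\<bar> \<le> m\<^sup>2"
      proof -
        have "(U p)\<^sup>2 \<le> m\<^sup>2" "k\<^sup>2 \<le> m\<^sup>2" using m(1) m(2)[OF that(1)] that(2) by (simp_all add: abs_le_square_iff[symmetric])
        moreover have "\<bar>s * (A / 2 - B / 2)\<bar> \<le> C" if "0 \<le> A" "0 \<le> B" "A \<le> C" "B \<le> C" "s = 0 \<or> s = 1 \<or> s = -1" for A B C s :: real
          using that by (auto simp: abs_if)
        ultimately show ?thesis by (simp add: sgn_if)
      qed
      have 7: "\<bar>Pt p * bump x + P p * bump' x * (V p * W p) / e\<bar> \<le> Bt + B0 * 4 * (m * Bw) / e"
        using 2 divide_right_mono[OF 3, of e] e by (intro order_trans[OF abs_triangle_ineq] add_mono) simp_all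
      have 8: "\<bar>Px p * bump x - P p * bump' x * W p / e\<bar> \<le> Bx + B0 * 4 * Bw / e"
        using 4 divide_right_mono[OF 5, of e] e by (intro order_trans[OF abs_triangle_ineq4] add_mono) simp_all
      have "\<bar>E k p\<bar> \<le> \<bar>U p - k\<bar> * \<bar>Pt p * bump x + P p * bump' x * (V p * W p) / e\<bar>
          + \<bar>sgn (U p - k) * ((U p)\<^sup>2 / 2 - k\<^sup>2 / 2)\<bar> * \<bar>Px p * bump x - P p * bump' x * W p / e\<bar>"
        unfolding E_def x_def[symmetric] by (rule order_trans[OF abs_triangle_ineq]) (simp only: abs_mult abs_abs order_refl)
      also have "\<dots> \<le> D"
        unfolding D_def by (rule add_mono[OF mult_mono[OF 1 7] mult_mono[OF 6 8]]) (use m(1) in simp_all)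
      finally show ?thesis .
    qed
    have Eout: "E k p = 0" if "\<not> \<bar>k\<bar> \<le> m" for k p
    proof (cases "P p = 0")
      case False
      have "\<bar>k - V p\<bar> \<ge> 1" using that m(3)[OF False] by linarith
      then have "\<bar>(k - V p) / e\<bar> \<ge> 1" using e by (simp add: field_simps)
      then show ?thesis using bump_outside[of "(k - V p) / e"] by (simp add: E_def)
    qed (rule E0)
    have intE: "integrable (lborel \<Otimes>\<^sub>M lborel) (case_prod E)"
      unfolding lborel_prod
    proof (rule integrable_compact_support[of _ "{-m..m} \<times> K"])
      have "case_prod E \<in> borel_measurable (borel \<Otimes>\<^sub>M borel)"
        unfolding E_def split_beta' by measurable
      then show "case_prod E \<in> borel_measurable borel" by (simp add: borel_prod)
      show "compact ({-m..m} \<times> K)" by (intro compact_Times K) simp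
      show "\<bar>case_prod E x\<bar> \<le> D" if "x \<in> {-m..m} \<times> K" for x
      proof (cases "P (snd x) = 0")
        case True then show ?thesis using E0[OF True] D0 by (simp add: case_prod_beta)
      next
        case False then show ?thesis using Ebound[OF False, of "fst x"] that by (auto simp: case_prod_beta abs_le_iff)
      qed
      show "case_prod E x = 0" if "x \<notin> {-m..m} \<times> K" for x
      proof (cases "P (snd x) = 0")
        case True then show ?thesis using E0[OF True] by (simp add: case_prod_beta)
      next
        case False
        then have "\<not> \<bar>fst x\<bar> \<le> m" using that zero(1)[of "snd x"] by (cases x) (auto simp: abs_le_iff)
        then show ?thesis by (simp add: Eout case_prod_beta)
      qed
    qed
    have Fub: "(LBINT p. (LBINT k. E k p)) = (LBINT k. (LBINT p. E k p))"
      by (rule lborel_pair.Fubini_integral[OF intE])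
    have intI: "integrable lborel (\<lambda>p. \<integral>k. E k p \<partial>lborel)"
      by (rule lborel_pair.integrable_snd[OF intE])
    have intK: "integrable lborel (indicator K :: _ \<Rightarrow> real)"
      by (rule integrable_compact_support[OF _ K(1), of _ 1]) (use K(1) in \<open>auto intro!: borel_measurable_indicator borel_compact\<close>)
    have "0 \<le> (LBINT k. (LBINT p. E k p))" using Epos by simp
    also have "\<dots> = (LBINT p. (LBINT k. E k p))" using Fub by simp
    also have "\<dots> \<le> (LBINT p. e * c * L p + e\<^sup>2 * Cst * indicator K p)"
      by (intro integral_mono intI Bochner_Integration.integrable_add integrable_mult_right intL intK)
         (use inner in \<open>simp add: abs_le_iff algebra_simps\<close>)
    also have "\<dots> = e * c * (LBINT p. L p) + e\<^sup>2 * Cst * measure lborel K"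
      using intL intK by (simp add: Bochner_Integration.integral_add)
    finally have "0 \<le> e * (c * (LBINT p. L p) + e * (Cst * measure lborel K))"
      by (simp add: algebra_simps power2_eq_square)
    then show ?thesis using e by (simp add: zero_le_mult_iff)
  qed
  have "0 \<le> c * (LBINT p. L p)"
  proof (rule tendsto_le[OF _ tendsto_const])
    show "((\<lambda>e. - (e * (Cst * measure lborel K))) \<longlongrightarrow> 0) (at_right 0)"
      by (auto intro!: tendsto_eq_intros)
    show "\<forall>\<^sub>F e in at_right 0. - (e * (Cst * measure lborel K)) \<le> c * (LBINT p. L p)"
      unfolding eventually_at_right_field by (intro exI[of _ 1] conjI allI impI main) simp_all
  qed simp
  then have "0 \<le> (LBINT p. L p)" using c by (simp add: zero_le_mult_iff)
  also have "\<dots> = (LBINT (x, t). \<bar>u x t - v x t\<bar> * phit x t + \<bar>u x t - v x t\<bar> * (u x t + v x t) / 2 * phix x t)"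
  proof (intro Bochner_Integration.integral_cong refl)
    fix p :: "real \<times> real"
    show "L p = (case p of (x, t) \<Rightarrow> \<bar>u x t - v x t\<bar> * phit x t + \<bar>u x t - v x t\<bar> * (u x t + v x t) / 2 * phix x t)"
      using zero'[of p] L0[of p] VK[of p] by (cases "P p = 0") (auto simp: L_def U_def Px_def Pt_def case_prod_beta)
  qed
  finally show ?thesis .
qed

section \<open>Distance on one period\<close>

definition l1dist :: "(real \<Rightarrow> real) \<Rightarrow> (real \<Rightarrow> real) \<Rightarrow> real" where
  "l1dist f g = (LBINT x. indicator {0..2*pi} x * \<bar>f x - g x\<bar>)"

text \<open>Only values on the closed period are constrained, because the classical comparison
  functions are controlled only near it.\<close>

definition l1able :: "(real \<Rightarrow> real) \<Rightarrow> bool" where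
  "l1able f \<longleftrightarrow> (\<lambda>x. indicator {0..2*pi} x * f x) \<in> borel_measurable borel \<and>
     (\<exists>B. \<forall>x\<in>{0..2*pi}. \<bar>f x\<bar> \<le> B)"

lemma l1able_continuous: "continuous_on {0..2*pi} f \<Longrightarrow> l1able f"
proof -
  assume f: "continuous_on {0..2*pi} f"
  have "bounded (f ` {0..2*pi})" by (intro compact_imp_bounded compact_continuous_image f) simp
  then show ?thesis
    using borel_measurable_continuous_on_indicator[OF _ f] by (auto simp: l1able_def bounded_iff)
qed

lemma l1able_integrable:
  assumes "l1able f" "l1able g"
  shows "integrable lborel (\<lambda>x. indicator {0..2*pi} x * \<bar>f x - g x\<bar>)"
proof -
  obtain A B where *: "\<forall>x\<in>{0..2*pi}. \<bar>f x\<bar> \<le> A" "\<forall>x\<in>{0..2*pi}. \<bar>g x\<bar> \<le> B"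
    using assms by (auto simp: l1able_def)
  have [measurable]: "(\<lambda>x. indicator {0..2*pi} x * f x) \<in> borel_measurable borel"
     "(\<lambda>x. indicator {0..2*pi} x * g x) \<in> borel_measurable borel"
    using assms by (auto simp: l1able_def)
  have eq: "(\<lambda>x. indicator {0..2*pi} x * \<bar>f x - g x\<bar>) =
     (\<lambda>x. \<bar>indicator {0..2*pi} x * f x - indicator {0..2*pi} x * g x\<bar>)"
    by (auto simp: indicator_def)
  show ?thesis unfolding eq
  proof (rule integrable_compact_support[of _ "{0..2*pi}" "A + B"])
    fix x assume x: "x \<in> {0..2*pi}"
    have "\<bar>f x - g x\<bar> \<le> \<bar>f x\<bar> + \<bar>g x\<bar>" by linarith
    also have "\<dots> \<le> A + B" using * x by (intro add_mono) auto
    finally show "\<bar>\<bar>indicator {0..2*pi} x * f x - indicator {0..2*pi} x * g x\<bar>\<bar> \<le> A + B" using x by simp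
  qed auto
qed

lemma l1dist_nonneg: "0 \<le> l1dist f g"
  unfolding l1dist_def by (intro Bochner_Integration.integral_nonneg) auto

lemma l1dist_commute: "l1dist f g = l1dist g f"
  unfolding l1dist_def by (simp add: abs_minus_commute)

lemma l1dist_triangle:
  assumes "l1able f" "l1able g" "l1able h"
  shows "l1dist f h \<le> l1dist f g + l1dist g h"
proof -
  have "l1dist f h \<le> (LBINT x. indicator {0..2*pi} x * \<bar>f x - g x\<bar> + indicator {0..2*pi} x * \<bar>g x - h x\<bar>)"
    unfolding l1dist_def
    by (intro integral_mono Bochner_Integration.integrable_add l1able_integrable assms) (auto simp: indicator_def)
  also have "\<dots> = l1dist f g + l1dist g h"
    unfolding l1dist_def by (intro Bochner_Integration.integral_add l1able_integrable assms)
  finally show ?thesis .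
qed

lemma l1dist_le:
  assumes "l1able f" "l1able g" "\<And>x. x \<in> {0..2*pi} \<Longrightarrow> \<bar>f x - g x\<bar> \<le> r"
  shows "l1dist f g \<le> 2 * pi * r"
proof -
  have "l1dist f g \<le> (LBINT x. r * indicator {0..2*pi} x)"
    unfolding l1dist_def
    by (intro integral_mono l1able_integrable assms integrable_mult_right integrable_indicator_Icc)
       (use assms(3) in \<open>auto simp: indicator_def\<close>)
  also have "\<dots> = 2 * pi * r" by simp
  finally show ?thesis .
qed

lemma nn_integral_l1dist:
  assumes "l1able f" "l1able g"
  shows "(\<integral>\<^sup>+ x\<in>{0..2*pi}. ennreal \<bar>f x - g x\<bar> \<partial>lborel) = ennreal (l1dist f g)"
proof -
  have "(\<integral>\<^sup>+ x\<in>{0..2*pi}. ennreal \<bar>f x - g x\<bar> \<partial>lborel)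
     = (\<integral>\<^sup>+ x. ennreal (indicator {0..2*pi} x * \<bar>f x - g x\<bar>) \<partial>lborel)"
    by (intro nn_integral_cong) (auto simp: indicator_def)
  also have "\<dots> = ennreal (l1dist f g)"
    unfolding l1dist_def by (rule nn_integral_eq_integral[OF l1able_integrable[OF assms]]) auto
  finally show ?thesis .
qed

lemma l1dist_eq_0_AE:
  assumes "l1able f" "l1able g" "l1dist f g = 0"
  shows "AE x in lborel. x \<in> {0..2*pi} \<longrightarrow> f x = g x"
proof -
  have "AE x in lborel. indicator {0..2*pi} x * \<bar>f x - g x\<bar> = 0"
    using integral_nonneg_eq_0_iff_AE[OF l1able_integrable[OF assms(1,2)]] assms(3) by (auto simp: l1dist_def)
  then show ?thesis by eventually_elim (auto simp: indicator_def)
qed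

lemma entropy_solution_l1able:
  assumes "entropy_solution u0 u" "t \<ge> 0"
  shows "l1able (\<lambda>x. u x t)"
proof -
  have m: "(\<lambda>p. u (fst p) (snd p)) \<in> borel_measurable borel"
    using assms by (simp add: entropy_solution_def split_beta')
  have "(\<lambda>x. u (fst (x, t)) (snd (x, t))) \<in> borel_measurable borel"
    by (rule measurable_compose[OF _ m]) measurable
  then have [measurable]: "(\<lambda>x. u x t) \<in> borel_measurable borel" by simp
  show ?thesis using assms unfolding l1able_def entropy_solution_def by (auto, meson)
qed

lemma entropy_solution_l1_continuous:
  assumes "entropy_solution u0 u" "t \<ge> 0" "r > 0"
  obtains d where "d > 0" "\<And>s. s \<ge> 0 \<Longrightarrow> \<bar>s - t\<bar> < d \<Longrightarrow> l1dist (\<lambda>x. u x s) (\<lambda>x. u x t) < r"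
proof -
  have "((\<lambda>s. \<integral>\<^sup>+ x\<in>{0..2*pi}. ennreal \<bar>u x s - u x t\<bar> \<partial>lborel) \<longlongrightarrow> 0) (at t within {0..})"
    using assms by (simp add: entropy_solution_def)
  then have "\<forall>\<^sub>F s in at t within {0..}. (\<integral>\<^sup>+ x\<in>{0..2*pi}. ennreal \<bar>u x s - u x t\<bar> \<partial>lborel) < ennreal r"
    using assms(3) by (intro order_tendstoD(2)) auto
  then obtain d where d: "d > 0" "\<And>s. s \<in> {0..} \<Longrightarrow> s \<noteq> t \<Longrightarrow> dist s t < d \<Longrightarrow> (\<integral>\<^sup>+ x\<in>{0..2*pi}. ennreal \<bar>u x s - u x t\<bar> \<partial>lborel) < ennreal r"
    unfolding eventually_at by blast
  show ?thesis
  proof (rule that[OF d(1)])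
    fix s assume s: "s \<ge> 0" "\<bar>s - t\<bar> < d"
    show "l1dist (\<lambda>x. u x s) (\<lambda>x. u x t) < r"
    proof (cases "s = t")
      case True then show ?thesis using assms(3) by (simp add: l1dist_def)
    next
      case False
      with d(2)[of s] s show ?thesis
        by (simp add: dist_real_def nn_integral_l1dist[OF entropy_solution_l1able[OF assms(1)] entropy_solution_l1able[OF assms(1)]] assms(2) l1dist_nonneg ennreal_less_iff)
    qed
  qed
qed

lemma entropy_solution_initial:
  assumes "entropy_solution u0 u" "l1able u0"
  shows "l1dist (\<lambda>x. u x 0) u0 = 0"
proof -
  have "(\<integral>\<^sup>+ x\<in>{0..2*pi}. ennreal \<bar>u x 0 - u0 x\<bar> \<partial>lborel) = 0"
    using assms by (simp add: entropy_solution_def)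
  then show ?thesis
    using nn_integral_l1dist[OF entropy_solution_l1able[OF assms(1)] assms(2), of 0] l1dist_nonneg[of "\<lambda>x. u x 0" u0] by simp
qed

section \<open>Contraction towards a piecewise smooth solution\<close>

text \<open>Both ramps start at their end point and extend to the right, so the falling one is the
  rising one translated by b - a. With a = 0 and b = 2 pi the two ramps see the same values of a
  periodic function, which is how the ends of the period get glued.\<close>

definition plateau :: "real \<Rightarrow> real \<Rightarrow> real \<Rightarrow> real \<Rightarrow> real" where
  "plateau a b d x = ramp ((x - a) / d) - ramp ((x - b) / d)"
definition plateau' :: "real \<Rightarrow> real \<Rightarrow> real \<Rightarrow> real \<Rightarrow> real" where
  "plateau' a b d x = hat ((x - a) / d) / d - hat ((x - b) / d) / d"

lemma DERIV_plateau:
  assumes "d > 0"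
  shows "(plateau a b d has_real_derivative plateau' a b d x) (at x)"
proof -
  have "((\<lambda>x. ramp ((x - a) / d)) has_real_derivative hat ((x - a) / d) / d) (at x)" for a
  proof -
    have "((\<lambda>x. (x - a) / d) has_real_derivative 1 / d) (at x)"
      using assms by (auto intro!: derivative_eq_intros)
    from DERIV_chain2[OF DERIV_ramp this] show ?thesis by simp
  qed
  then show ?thesis unfolding plateau_def[abs_def] plateau'_def by (intro derivative_intros)
qed

lemma continuous_on_plateau [continuous_intros]:
  "continuous_on S f \<Longrightarrow> d > 0 \<Longrightarrow> continuous_on S (\<lambda>x. plateau a b d (f x))"
  "continuous_on S f \<Longrightarrow> d > 0 \<Longrightarrow> continuous_on S (\<lambda>x. plateau' a b d (f x))"
  unfolding plateau_def plateau'_def by (intro continuous_intros; simp)+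

lemma borel_measurable_plateau [measurable]:
  "plateau a b d \<in> borel_measurable borel" "plateau' a b d \<in> borel_measurable borel"
  unfolding plateau_def[abs_def] plateau'_def[abs_def] by measurable

lemma plateau_bounds:
  assumes "a \<le> b" "d > 0"
  shows "0 \<le> plateau a b d x" "plateau a b d x \<le> 1"
proof -
  have "(x - b) / d \<le> (x - a) / d" using assms by (intro divide_right_mono) auto
  from ramp_mono[OF this] show "0 \<le> plateau a b d x" by (simp add: plateau_def)
  show "plateau a b d x \<le> 1"
    using ramp_bounds(2)[of "(x - a) / d"] ramp_bounds(1)[of "(x - b) / d"] unfolding plateau_def by linarith
qed

lemma abs_plateau'_le:
  assumes "d > 0"
  shows "\<bar>plateau' a b d x\<bar> \<le> 4 / d"
proof -
  have "\<bar>hat p / d\<bar> \<le> 2 / d" for p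
    using hat_nonneg[of p] hat_le[of p] assms by (simp add: divide_right_mono)
  from this[of "(x - a) / d"] this[of "(x - b) / d"] show ?thesis unfolding plateau'_def by linarith
qed

lemma plateau_outside:
  assumes "a \<le> b" "d > 0" "x \<le> a \<or> b + d \<le> x"
  shows "plateau a b d x = 0" "plateau' a b d x = 0"
proof -
  have "(x - a) / d \<le> 0 \<and> (x - b) / d \<le> 0 \<or> 1 \<le> (x - a) / d \<and> 1 \<le> (x - b) / d"
    using assms by (auto simp: divide_nonpos_pos)
  then show "plateau a b d x = 0" "plateau' a b d x = 0"
    by (auto simp: plateau_def plateau'_def ramp_0 ramp_1 hat_outside)
qed

lemma kruzkov_test_box:
  fixes \<delta> \<sigma> t1 t2 :: real
  assumes "\<delta> > 0" "\<sigma> > 0" "0 < t1" "t1 \<le> t2"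
  shows "kruzkov_test
     (\<lambda>x t. plateau 0 (2*pi) \<delta> x * plateau t1 t2 \<sigma> t)
     (\<lambda>x t. plateau' 0 (2*pi) \<delta> x * plateau t1 t2 \<sigma> t)
     (\<lambda>x t. plateau 0 (2*pi) \<delta> x * plateau' t1 t2 \<sigma> t)"
proof -
  \<comment> \<open>1 / t1 occurs because \<open>kruzkov_test\<close> keeps the support above t = 1
    / R.\<close>
  define R where "R = max (max (2*pi + \<delta>) (1 / t1)) (t2 + \<sigma>)"
  have R: "R > 0" "2 * pi + \<delta> \<le> R" "t2 + \<sigma> \<le> R" "1 / R \<le> t1"
  proof -
    show "2 * pi + \<delta> \<le> R" "t2 + \<sigma> \<le> R" by (auto simp: R_def)
    show "R > 0" using assms by (auto simp: R_def less_max_iff_disj add_pos_pos)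
    have "1 / t1 \<le> R" by (auto simp: R_def)
    then show "1 / R \<le> t1" using assms \<open>R > 0\<close> by (simp add: field_simps)
  qed
  show ?thesis
    unfolding kruzkov_test_def
  proof (intro conjI allI)
    fix x t :: real
    show "0 \<le> plateau 0 (2*pi) \<delta> x * plateau t1 t2 \<sigma> t"
      using assms by (intro mult_nonneg_nonneg plateau_bounds) auto
    show "((\<lambda>s. plateau 0 (2*pi) \<delta> s * plateau t1 t2 \<sigma> t) has_real_derivative plateau' 0 (2*pi) \<delta> x * plateau t1 t2 \<sigma> t) (at x)"
      by (intro DERIV_cmult_right DERIV_plateau assms)
    show "((\<lambda>s. plateau 0 (2*pi) \<delta> x * plateau t1 t2 \<sigma> s) has_real_derivative plateau 0 (2*pi) \<delta> x * plateau' t1 t2 \<sigma> t) (at t)"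
      by (intro DERIV_cmult DERIV_plateau assms)
  next
    show "\<exists>R>0. \<forall>x t. R \<le> \<bar>x\<bar> \<or> t \<le> 1 / R \<or> R \<le> t \<longrightarrow> plateau 0 (2*pi) \<delta> x * plateau t1 t2 \<sigma> t = 0"
    proof (intro exI[of _ R] conjI allI impI R)
      fix x t :: real assume *: "R \<le> \<bar>x\<bar> \<or> t \<le> 1 / R \<or> R \<le> t"
      have "(x \<le> 0 \<or> 2*pi + \<delta> \<le> x) \<or> (t \<le> t1 \<or> t2 + \<sigma> \<le> t)"
        using * R by linarith
      then show "plateau 0 (2*pi) \<delta> x * plateau t1 t2 \<sigma> t = 0"
        using plateau_outside(1)[of 0 "2*pi" \<delta> x] plateau_outside(1)[of t1 t2 \<sigma> t] assms by auto
    qed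
  qed (use assms in \<open>auto simp: split_beta' intro!: continuous_intros\<close>)
qed

text \<open>On the period glued at 0 = 2 pi, \<open>v (2*pi) t\<close> is the state left of the seam
  and \<open>v 0 t\<close> the state right of it. \<open>shock\<close> says that the seam does not
  create distance: equality when the two states agree, admissibility of the jump otherwise. The
  space cut-off is made sharp while the time cut-off is still smooth; the latter is then removed by
  continuity in time.\<close>

lemma l1_contraction:
  fixes u v vx :: "real \<Rightarrow> real \<Rightarrow> real" and \<Omega> :: "(real \<times> real) set"
  assumes ent: "entropy_solution u0 u"
    and cl: "classical_burgers \<Omega> v vx"
    and strip: "{0..2*pi} \<times> {a<..<b} \<subseteq> \<Omega>" and a: "0 \<le> a"
    and shock: "\<And>t w. a < t \<Longrightarrow> t < b \<Longrightarrow> \<bar>w - v 0 t\<bar> * (w + v 0 t) \<le> \<bar>w - v (2*pi) t\<bar> * (w + v (2*pi) t)"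
    and t: "a < t1" "t1 < t2" "t2 < b"
  shows "l1dist (\<lambda>x. u x t2) (\<lambda>x. v x t2) \<le> l1dist (\<lambda>x. u x t1) (\<lambda>x. v x t1)"
proof -
  note \<Omega> = classical_burgersD(1)[OF cl] and cont_v = classical_burgersD(4)[OF cl]
  \<comment> \<open>Room before b for the time ramp that starts at t2.\<close>
  define t3 where "t3 = (t2 + b) / 2"
  have t3: "t2 < t3" "t3 < b" using t by (auto simp: t3_def field_simps)
  have t1: "t1 > 0" using a t by simp
  have "compact ({0..2*pi} \<times> {t1..t3})" by (intro compact_Times) auto
  moreover have "{0..2*pi} \<times> {t1..t3} \<subseteq> \<Omega>" using strip t t3 by force
  ultimately obtain d0 where d0: "d0 > 0" "(\<Union>p\<in>{0..2*pi} \<times> {t1..t3}. ball p d0) \<subseteq> \<Omega>"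
    using compact_subset_open_imp_ball_epsilon_subset \<Omega> by metis
  \<comment> \<open>The falling space ramp lies to the right of 2 pi, so K must reach beyond the
    period; the open \<Omega> leaves a uniform margin around the compact strip.\<close>
  define d where "d = d0 / 2"
  have d: "d > 0" using d0 by (simp add: d_def)
  define K where "K = {0..2*pi+d} \<times> {t1..t3}"
  have K: "compact K" unfolding K_def by (intro compact_Times) auto
  have K\<Omega>: "K \<subseteq> \<Omega>"
  proof
    fix p assume p: "p \<in> K"
    obtain x t where xt: "p = (x, t)" by (cases p)
    have "p \<in> ball (min x (2*pi), t) d0"
      using p d0(1) by (auto simp: xt K_def dist_Pair_Pair dist_real_def d_def min_def)
    moreover have "(min x (2*pi), t) \<in> {0..2*pi} \<times> {t1..t3}" using p by (auto simp: xt K_def)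
    ultimately show "p \<in> \<Omega>" using d0(2) by blast
  qed
  have contK: "continuous_on K (\<lambda>p. v (fst p) (snd p))"
    using cont_v K\<Omega> by (auto simp: split_beta' intro: continuous_on_subset)
  obtain M where M: "\<And>x t. t \<ge> 0 \<Longrightarrow> \<bar>u x t\<bar> \<le> M" using ent by (auto simp: entropy_solution_def)
  have per: "u (x + 2 * pi) t = u x t" if "t \<ge> 0" for x t using ent that by (simp add: entropy_solution_def)
  have "bounded ((\<lambda>p. v (fst p) (snd p)) ` K)" by (intro compact_imp_bounded compact_continuous_image contK K)
  then obtain Bv where "\<forall>p\<in>K. norm (v (fst p) (snd p)) \<le> Bv" by (auto simp: bounded_iff)
  then have Bv: "\<bar>v x t\<bar> \<le> Bv" if "(x, t) \<in> K" for x t using that by force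
  define m where "m = max (max M Bv) 1"
  have m: "m \<ge> 1" "\<And>x t. t \<ge> 0 \<Longrightarrow> \<bar>u x t\<bar> \<le> m" "\<And>x t. (x, t) \<in> K \<Longrightarrow> \<bar>v x t\<bar> \<le> m"
    using M Bv by (auto simp: m_def le_max_iff_disj)
  have tK: "t \<ge> 0" if "(x, t) \<in> K" for x t using that t1 by (auto simp: K_def)
  define A where "A x t = indicator K (x, t) * \<bar>u x t - v x t\<bar>" for x t
  define F where "F x t = indicator K (x, t) * (\<bar>u x t - v x t\<bar> * (u x t + v x t) / 2)" for x t
  have uv: "\<bar>u x t - v x t\<bar> \<le> 2 * m" "\<bar>u x t + v x t\<bar> \<le> 2 * m" if "(x, t) \<in> K" for x t
    using m(2)[OF tK[OF that], of x] m(3)[OF that] by linarith+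
  have A_bd: "\<bar>A x t\<bar> \<le> 2 * m" for x t using uv(1)[of x t] m(1) by (auto simp: A_def indicator_def)
  have F_bd: "\<bar>F x t\<bar> \<le> (2 * m) * (2 * m) / 2" for x t
  proof (cases "(x, t) \<in> K")
    case True
    have "\<bar>u x t - v x t\<bar> * \<bar>u x t + v x t\<bar> \<le> (2 * m) * (2 * m)"
      by (intro mult_mono uv[OF True]) (use m(1) in auto)
    then show ?thesis using True by (simp add: F_def abs_mult)
  qed (simp add: F_def)
  have mu: "(\<lambda>p. u (fst p) (snd p)) \<in> borel_measurable borel"
    using ent by (simp add: entropy_solution_def split_beta')
  have mv: "(\<lambda>p. indicator K p * v (fst p) (snd p)) \<in> borel_measurable borel"
    using borel_measurable_continuous_on_indicator[OF borel_compact[OF K] contK] by simp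
  have mK: "(indicator K :: _ \<Rightarrow> real) \<in> borel_measurable borel"
    by (intro borel_measurable_indicator borel_compact K)
  have A_eq: "A x t = indicator K (x, t) * \<bar>u x t - indicator K (x, t) * v x t\<bar>"
   and F_eq: "F x t = indicator K (x, t) * (\<bar>u x t - indicator K (x, t) * v x t\<bar> * (u x t + indicator K (x, t) * v x t) / 2)" for x t
    by (auto simp: A_def F_def indicator_def)
  have mA: "(\<lambda>p. A (fst p) (snd p)) \<in> borel_measurable borel"
    unfolding A_eq prod.collapse using mu mv mK by measurable
  have mF: "(\<lambda>p. F (fst p) (snd p)) \<in> borel_measurable borel"
    unfolding F_eq prod.collapse using mu mv mK by measurable
  have [measurable]: "(\<lambda>x. A (f x) (g x)) \<in> borel_measurable N" "(\<lambda>x. F (f x) (g x)) \<in> borel_measurable N"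
    if [measurable]: "f \<in> borel_measurable N" "g \<in> borel_measurable N" for f g :: "'z \<Rightarrow> real" and N
    using measurable_compose[OF _ mA, of "\<lambda>x. (f x, g x)" N] measurable_compose[OF _ mF, of "\<lambda>x. (f x, g x)" N] by auto
  have Aout: "A x t = 0" "F x t = 0" if "(x, t) \<notin> K" for x t using that by (auto simp: A_def F_def)
  \<comment> \<open>Because \<open>A\<close> is cut off by K, \<open>D\<close> is bounded and Borel
    for all t, while on [t1, t3] it is the L^1 distance.\<close>
  define D where "D t = (LBINT x. indicator {0..2*pi} x * A x t)" for t
  have D_eq: "D t = l1dist (\<lambda>x. u x t) (\<lambda>x. v x t)" if "t \<in> {t1..t3}" for t
    unfolding D_def l1dist_def
    by (intro Bochner_Integration.integral_cong) (use that d in \<open>auto simp: A_def indicator_def K_def\<close>)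
  have [measurable]: "D \<in> borel_measurable borel" unfolding D_def by measurable
  have u_able: "l1able (\<lambda>x. u x t)" if "t \<ge> 0" for t using entropy_solution_l1able[OF ent that] .
  have v_able: "l1able (\<lambda>x. v x t)" if "t \<in> {t1..t3}" for t
  proof (rule l1able_continuous)
    have "continuous_on {0..2*pi} (\<lambda>x. (\<lambda>p. v (fst p) (snd p)) (x, t))"
      by (rule continuous_on_compose2[OF contK]) (use that d in \<open>auto simp: K_def intro!: continuous_intros\<close>)
    then show "continuous_on {0..2*pi} (\<lambda>x. v x t)" by simp
  qed
  have unif: "\<exists>r>0. \<forall>x\<in>K. \<forall>x'\<in>K. dist x' x < r \<longrightarrow> \<bar>v (fst x') (snd x') - v (fst x) (snd x)\<bar> < \<omega>" if "\<omega> > 0" for \<omega>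
    using compact_uniformly_continuous[OF contK K] that unfolding uniformly_continuous_on_def dist_real_def by blast
  have D_bd: "\<bar>D t\<bar> \<le> 2 * pi * (2 * m)" for t
  proof -
    have "\<bar>D t\<bar> \<le> (LBINT x. \<bar>indicator {0..2*pi} x * A x t\<bar>)" unfolding D_def by (rule integral_abs_bound)
    also have "\<dots> \<le> (LBINT x. (2 * m) * indicator {0..2*pi} x)"
    proof (intro integral_mono integrable_mult_right integrable_indicator_Icc)
      show "integrable lborel (\<lambda>x. \<bar>indicator {0..2*pi} x * A x t\<bar>)"
        by (rule integrable_compact_support[of _ "{0..2*pi}" "2*m"]) (use A_bd in auto)
    qed (use A_bd in \<open>auto simp: indicator_def\<close>)
    finally show ?thesis by (simp add: mult_ac)
  qed
  \<comment> \<open>The outcome of sharpening the space cut-off: the claimed inequality between the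
    distances at t1 and t2, averaged over the time ramps with weight \<open>hat\<close>.\<close>
  have smear: "0 \<le> (LBINT s. hat s * (D (t1 + \<sigma> * s) - D (t2 + \<sigma> * s)))" if \<sigma>: "0 < \<sigma>" "\<sigma> \<le> t3 - t2" for \<sigma>
  proof -
    define th where "th = plateau t1 t2 \<sigma>"
    define th' where "th' = plateau' t1 t2 \<sigma>"
    have [measurable]: "th \<in> borel_measurable borel" "th' \<in> borel_measurable borel"
      unfolding th_def th'_def by measurable
    have th_out: "th t = 0" "th' t = 0" if "t \<notin> {t1..t3}" for t
      using plateau_outside[of t1 t2 \<sigma> t] that \<open>t1 < t2\<close> \<sigma> unfolding th_def th'_def by auto
    have th01: "0 \<le> th t" "th t \<le> 1" for t
      using plateau_bounds[of t1 t2 \<sigma> t] \<open>t1 < t2\<close> \<sigma> by (auto simp: th_def)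
    have th'_bd: "\<bar>th' t\<bar> \<le> 4 / \<sigma>" for t
      unfolding th'_def by (rule abs_plateau'_le[OF \<sigma>(1)])
    have int_th': "integrable lborel (\<lambda>t. \<bar>th' t\<bar>)"
      by (rule integrable_compact_support[of _ "{t1..t3}" "4 / \<sigma>"]) (use th'_bd th_out in auto)
    have int_thD: "integrable lborel (\<lambda>t. th' t * D t)"
    proof (rule integrable_compact_support[of _ "{t1..t3}" "4 / \<sigma> * (2 * pi * (2 * m))"])
      show "\<bar>th' t * D t\<bar> \<le> 4 / \<sigma> * (2 * pi * (2 * m))" for t
        unfolding abs_mult by (intro mult_mono th'_bd D_bd) (use \<sigma> in auto)
    qed (use th_out in auto)
    \<comment> \<open>Independence of \<omega> is essential. The first term will collect the edge
      layers of the space cut-off, the second the variation of \<open>v\<close> across its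
      ramps.\<close>
    define C where "C = 4 * m * (LBINT t. \<bar>th' t\<bar>) + (t3 - t1) * (4 * m * (LBINT s. hat s))"
    have "(LBINT t. \<bar>th' t\<bar>) \<ge> 0" by (intro Bochner_Integration.integral_nonneg) auto
    then have C: "C \<ge> 0" unfolding C_def
      using m(1) t t3 integral_hat_pos by (intro add_nonneg_nonneg mult_nonneg_nonneg) auto
    have approx: "0 \<le> (LBINT t. th' t * D t) + \<omega> * C" if \<omega>: "\<omega> > 0" for \<omega>
    proof -
      obtain r where r: "r > 0" "\<forall>x\<in>K. \<forall>x'\<in>K. dist x' x < r \<longrightarrow> \<bar>v (fst x') (snd x') - v (fst x) (snd x)\<bar> < \<omega>"
        using unif[OF \<omega>] by auto
      \<comment> \<open>\<delta> < r keeps the variation of \<open>v\<close> over a ramp below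
        \<omega>, \<delta> \<le> d keeps the ramp inside K, and \<delta> \<le> \<omega> allows the
        edge error of order \<delta> to be counted in \<open>\<omega> * C\<close>.\<close>
      define \<delta> where "\<delta> = min (min d (r / 2)) (min \<omega> 1)"
      have \<delta>: "\<delta> > 0" "\<delta> \<le> d" "\<delta> < r" "\<delta> \<le> \<omega>" "\<delta> \<le> 1" using d r \<omega> by (auto simp: \<delta>_def)
      have pi1: "1 < 2 * pi" using pi_gt3 by simp
      define ch where "ch = plateau 0 (2*pi) \<delta>"
      define ch' where "ch' = plateau' 0 (2*pi) \<delta>"
      have [measurable]: "ch \<in> borel_measurable borel" "ch' \<in> borel_measurable borel"
        unfolding ch_def ch'_def by measurable
      have ch_out: "ch x = 0" "ch' x = 0" if "x \<notin> {0..2*pi+d}" for x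
        using plateau_outside[of 0 "2*pi" \<delta> x] that \<delta> unfolding ch_def ch'_def by auto
      have ch01: "\<bar>ch x\<bar> \<le> 1" for x
        using plateau_bounds[of 0 "2*pi" \<delta> x] \<delta> by (simp add: ch_def)
      have ch'_bd: "\<bar>ch' x\<bar> \<le> 4 / \<delta>" for x
        unfolding ch'_def by (rule abs_plateau'_le[OF \<delta>(1)])
      have ch1: "\<bar>ch x - indicator {0..2*pi} x\<bar> \<le> indicator {0..\<delta>} x + indicator {2*pi..2*pi+\<delta>} x" if "x \<ge> 0" for x
      proof -
        have "x \<in> {0..\<delta>} \<or> x \<in> {2*pi..2*pi+\<delta>} \<or> \<delta> < x \<and> x < 2*pi \<or> x > 2*pi + \<delta>"
          using that by auto
        then consider "x \<in> {0..\<delta>}" | "x \<in> {2*pi..2*pi+\<delta>}" | "\<delta> < x" "x < 2*pi" | "x > 2*pi + \<delta>"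
          by blast
        then show ?thesis
        proof cases
          case 1
          then have "x \<in> {0..2*pi}" "(x - 2*pi) / \<delta> \<le> 0" using \<delta> pi1 by (auto simp: divide_nonpos_pos)
          then show ?thesis using 1 ramp_bounds[of "x / \<delta>"] by (simp add: ch_def plateau_def ramp_0 indicator_def)
        next
          case 2
          then have "1 \<le> x / \<delta>" using \<delta> pi1 by (simp add: field_simps)
          then show ?thesis using 2 ramp_bounds[of "(x - 2*pi) / \<delta>"] by (simp add: ch_def plateau_def ramp_1 indicator_def)
        next
          case 3
          then have "1 \<le> x / \<delta>" "(x - 2*pi) / \<delta> \<le> 0" "x \<in> {0..2*pi}" using \<delta> that by (simp_all add: field_simps)
          then show ?thesis by (simp add: ch_def plateau_def ramp_1 ramp_0)
        next
          case 4
          then have "1 \<le> x / \<delta>" "1 \<le> (x - 2*pi) / \<delta>" "x \<notin> {0..2*pi}" using \<delta> pi1 by (simp_all add: field_simps)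
          then show ?thesis by (simp add: ch_def plateau_def ramp_1 ramp_0)
        qed
      qed
      have intF: "integrable lborel (\<lambda>x. F x t * ch' x)" for t
      proof (rule integrable_compact_support[of _ "{0..2*pi+d}" "(2 * m) * (2 * m) / 2 * (4 / \<delta>)"])
        show "\<bar>F x t * ch' x\<bar> \<le> (2 * m) * (2 * m) / 2 * (4 / \<delta>)" for x
          unfolding abs_mult by (intro mult_mono F_bd ch'_bd) (use m(1) in auto)
      qed (use ch_out in auto)
      have intA: "integrable lborel (\<lambda>x. A x t * ch x)" for t
      proof (rule integrable_compact_support[of _ "{0..2*pi+d}" "(2 * m) * 1"])
        show "\<bar>A x t * ch x\<bar> \<le> (2 * m) * 1" for x
          unfolding abs_mult by (intro mult_mono A_bd ch01) (use m(1) in auto)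
      qed (use ch_out in auto)
      \<comment> \<open>Cut-off and indicator differ on two layers of width \<delta>, where
        \<open>A\<close> is at most 2 m.\<close>
      have partA: "\<bar>(LBINT x. A x t * ch x) - D t\<bar> \<le> 4 * m * \<delta>" for t
      proof -
        have intI: "integrable lborel (\<lambda>x. indicator {0..2*pi} x * A x t)"
          by (rule integrable_compact_support[of _ "{0..2*pi}" "2*m"]) (use A_bd in auto)
        have "\<bar>(LBINT x. A x t * ch x) - D t\<bar> = \<bar>\<integral>x. A x t * ch x - indicator {0..2*pi} x * A x t \<partial>lborel\<bar>"
          unfolding D_def by (subst Bochner_Integration.integral_diff[OF intA intI]) simp
        also have "\<dots> \<le> (LBINT x. \<bar>A x t * ch x - indicator {0..2*pi} x * A x t\<bar>)"
          by (rule integral_abs_bound)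
        also have "\<dots> \<le> (LBINT x. (2 * m) * (indicator {0..\<delta>} x + indicator {2*pi..2*pi+\<delta>} x))"
        proof (intro integral_mono integrable_abs Bochner_Integration.integrable_diff intA intI integrable_mult_right
            Bochner_Integration.integrable_add integrable_indicator_Icc)
          fix x :: real
          show "\<bar>A x t * ch x - indicator {0..2*pi} x * A x t\<bar> \<le> (2 * m) * (indicator {0..\<delta>} x + indicator {2*pi..2*pi+\<delta>} x)"
          proof (cases "x \<ge> 0")
            case True
            have "\<bar>A x t * ch x - indicator {0..2*pi} x * A x t\<bar> = \<bar>A x t\<bar> * \<bar>ch x - indicator {0..2*pi} x\<bar>"
              unfolding abs_mult[symmetric] by (simp add: algebra_simps)
            also have "\<dots> \<le> (2 * m) * (indicator {0..\<delta>} x + indicator {2*pi..2*pi+\<delta>} x)"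
              by (intro mult_mono A_bd ch1 True) (use m(1) in auto)
            finally show ?thesis .
          next
            case False
            then have "A x t = 0" by (intro Aout) (auto simp: K_def)
            then show ?thesis using m(1) by (simp add: indicator_def)
          qed
        qed
        also have "\<dots> = 4 * m * \<delta>" using \<delta> by (simp add: integrable_indicator_Icc)
        finally show ?thesis .
      qed
      \<comment> \<open>The ramps at 0 and 2 pi are compared at the same relative position. There
        \<open>u\<close> takes one common value w by periodicity; freezing \<open>v\<close> at the
        end points costs 2 m \<omega> each, and \<open>shock\<close> settles the rest.\<close>
      have partF: "(LBINT x. F x t * ch' x) \<le> 4 * m * \<omega> * (LBINT s. hat s)" if tt: "t \<in> {t1..t3}" for t
      proof -
        have I1: "integrable lborel (\<lambda>x. F x t * (hat ((x - p) / \<delta>) / \<delta>))" for p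
        proof (rule integrable_compact_support[of _ "{0..2*pi+d}" "(2 * m) * (2 * m) / 2 * (2 / \<delta>)"])
          show "\<bar>F x t * (hat ((x - p) / \<delta>) / \<delta>)\<bar> \<le> (2 * m) * (2 * m) / 2 * (2 / \<delta>)" for x
            unfolding abs_mult by (intro mult_mono F_bd)
              (use m(1) \<delta> hat_nonneg[of "(x - p) / \<delta>"] hat_le[of "(x - p) / \<delta>"] in \<open>auto intro: divide_right_mono\<close>)
        qed (auto simp: Aout K_def)
        have I2: "(LBINT x. F x t * (hat ((x - p) / \<delta>) / \<delta>)) = (LBINT s. hat s * F (p + \<delta> * s) t)" for p
          using lborel_integral_real_affine[of \<delta> "\<lambda>x. F x t * (hat ((x - p) / \<delta>) / \<delta>)" p] \<delta> by (simp add: mult.commute)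
        have I3: "integrable lborel (\<lambda>s. hat s * F (p + \<delta> * s) t)" for p
        proof (rule integrable_compact_support[of _ "{0..1}" "2 * ((2 * m) * (2 * m) / 2)"])
          show "\<bar>hat s * F (p + \<delta> * s) t\<bar> \<le> 2 * ((2 * m) * (2 * m) / 2)" for s
            unfolding abs_mult by (intro mult_mono F_bd) (use hat_nonneg[of s] hat_le[of s] in auto)
        qed (use hat_outside in auto)
        have "(LBINT x. F x t * ch' x) = (LBINT x. F x t * (hat ((x - 0) / \<delta>) / \<delta>) - F x t * (hat ((x - 2*pi) / \<delta>) / \<delta>))"
          by (intro Bochner_Integration.integral_cong) (auto simp: ch'_def plateau'_def algebra_simps)
        also have "\<dots> = (LBINT s. hat s * F (0 + \<delta> * s) t - hat s * F (2*pi + \<delta> * s) t)"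
          by (simp only: Bochner_Integration.integral_diff[OF I1 I1] I2 Bochner_Integration.integral_diff[OF I3 I3])
        also have "\<dots> \<le> (LBINT s. 4 * m * \<omega> * hat s)"
        proof (intro integral_mono Bochner_Integration.integrable_diff I3 integrable_mult_right integrable_hat)
          fix s :: real
          show "hat s * F (0 + \<delta> * s) t - hat s * F (2*pi + \<delta> * s) t \<le> 4 * m * \<omega> * hat s"
          proof (cases "s \<in> {0..1}")
            case False then show ?thesis using hat_outside[of s] by auto
          next
            case True
            then have s: "0 \<le> \<delta> * s" "\<delta> * s \<le> \<delta>" using \<delta> by (auto simp: mult_left_le)
            define y where "y = \<delta> * s"
            have y: "0 \<le> y" "y \<le> \<delta>" using s by (auto simp: y_def)
            have KK: "(y, t) \<in> K" "(2*pi + y, t) \<in> K" "(0, t) \<in> K" "(2*pi, t) \<in> K"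
              using y \<delta> pi1 tt by (auto simp: K_def)
            define w where "w = u y t"
            have w: "u (2*pi + y) t = w" using per[OF tK[OF KK(1)], of y] by (simp add: w_def add.commute)
            have wm: "\<bar>w\<bar> \<le> m" using m(2)[OF tK[OF KK(1)]] by (simp add: w_def)
            have c1: "\<bar>v y t - v 0 t\<bar> \<le> \<omega>"
              using r(2)[rule_format, OF KK(3,1)] y \<delta> by (simp add: dist_Pair_Pair dist_real_def)
            have c2: "\<bar>v (2*pi) t - v (2*pi + y) t\<bar> \<le> \<omega>"
              using r(2)[rule_format, OF KK(2,4)] y \<delta> by (simp add: dist_Pair_Pair dist_real_def)
            have q1: "\<bar>\<bar>w - v y t\<bar> * (w + v y t) / 2 - \<bar>w - v 0 t\<bar> * (w + v 0 t) / 2\<bar> \<le> 2 * m * \<omega>"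
              by (rule order_trans[OF entropy_flux_lipschitz[OF wm m(3)[OF KK(1)] m(3)[OF KK(3)]]])
                 (use c1 m(1) in auto)
            have q2: "\<bar>\<bar>w - v (2*pi) t\<bar> * (w + v (2*pi) t) / 2 - \<bar>w - v (2*pi + y) t\<bar> * (w + v (2*pi + y) t) / 2\<bar> \<le> 2 * m * \<omega>"
              by (rule order_trans[OF entropy_flux_lipschitz[OF wm m(3)[OF KK(4)] m(3)[OF KK(2)]]])
                 (use c2 m(1) in auto)
            have q3: "\<bar>w - v 0 t\<bar> * (w + v 0 t) / 2 \<le> \<bar>w - v (2*pi) t\<bar> * (w + v (2*pi) t) / 2"
              using shock[of t w] tt t t3 by (intro divide_right_mono) auto
            have "F y t - F (2*pi + y) t = \<bar>w - v y t\<bar> * (w + v y t) / 2 - \<bar>w - v (2*pi + y) t\<bar> * (w + v (2*pi + y) t) / 2"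
              using KK by (simp add: F_def w w_def)
            also have "\<dots> \<le> 4 * m * \<omega>" using q1 q2 q3 by linarith
            finally have "hat s * (F y t - F (2*pi + y) t) \<le> hat s * (4 * m * \<omega>)"
              by (intro mult_left_mono hat_nonneg)
            then show ?thesis by (simp add: y_def algebra_simps)
          qed
        qed
        finally show ?thesis by simp
      qed
      define G where "G x t = A x t * (ch x * th' t) + F x t * (ch' x * th t)" for x t
      have intG: "integrable (lborel \<Otimes>\<^sub>M lborel) (case_prod G)"
        unfolding lborel_prod
      proof (rule integrable_compact_support[OF _ K, of _ "(2 * m) * (1 * (4 / \<sigma>)) + (2 * m) * (2 * m) / 2 * (4 / \<delta> * 1)"])
        have "case_prod G \<in> borel_measurable (borel \<Otimes>\<^sub>M borel)"
          unfolding G_def split_beta' by measurable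
        then show "case_prod G \<in> borel_measurable borel" by (simp add: borel_prod)
        show "case_prod G p = 0" if "p \<notin> K" for p using that Aout[of "fst p" "snd p"] by (simp add: G_def split_beta')
        fix p :: "real \<times> real"
        have th1: "\<bar>th (snd p)\<bar> \<le> 1" using th01[of "snd p"] by simp
        show "\<bar>case_prod G p\<bar> \<le> (2 * m) * (1 * (4 / \<sigma>)) + (2 * m) * (2 * m) / 2 * (4 / \<delta> * 1)"
          unfolding G_def split_beta'
          by (rule order_trans[OF abs_triangle_ineq], unfold abs_mult)
             (intro add_mono mult_mono A_bd F_bd ch01 ch'_bd th'_bd th1, use m(1) \<delta> \<sigma> in simp_all)
      qed
      have kt: "kruzkov_test (\<lambda>x t. ch x * th t) (\<lambda>x t. ch' x * th t) (\<lambda>x t. ch x * th' t)"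
        unfolding ch_def ch'_def th_def th'_def using t by (intro kruzkov_test_box \<delta> \<sigma> t1) simp
      have "0 \<le> (LBINT (x, t). \<bar>u x t - v x t\<bar> * (ch x * th' t) + \<bar>u x t - v x t\<bar> * (u x t + v x t) / 2 * (ch' x * th t))"
      proof (rule kruzkov_moving_level[OF ent cl kt _ K K\<Omega>])
        show "continuous_on UNIV (\<lambda>(x, t). ch x * th t)"
          unfolding ch_def th_def split_beta' by (intro continuous_intros \<delta> \<sigma>)
        show "ch x * th t = 0" if "(x, t) \<notin> K" for x t using that ch_out[of x] th_out[of t] by (auto simp: K_def)
      qed
      also have "\<dots> = (\<integral>(x, t). G x t \<partial>(lborel \<Otimes>\<^sub>M lborel))"
        unfolding lborel_prod
      proof (intro Bochner_Integration.integral_cong refl)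
        fix p :: "real \<times> real"
        show "(case p of (x, t) \<Rightarrow> \<bar>u x t - v x t\<bar> * (ch x * th' t) + \<bar>u x t - v x t\<bar> * (u x t + v x t) / 2 * (ch' x * th t)) = (case p of (x, t) \<Rightarrow> G x t)"
          using ch_out[of "fst p"] th_out[of "snd p"] by (cases p) (auto simp: G_def A_def F_def K_def indicator_def)
      qed
      also have "\<dots> = (LBINT t. (LBINT x. G x t))"
        by (rule lborel_pair.integral_snd[symmetric, OF intG])
      also have "\<dots> \<le> (LBINT t. th' t * D t + (4 * m * \<delta> * \<bar>th' t\<bar> + 4 * m * \<omega> * (LBINT s. hat s) * indicator {t1..t3} t))"
      proof (intro integral_mono Bochner_Integration.integrable_add int_thD integrable_mult_right int_th' integrable_indicator_Icc)
        show "integrable lborel (\<lambda>t. \<integral>x. G x t \<partial>lborel)" by (rule lborel_pair.integrable_snd[OF intG])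
        fix t :: real
        have "(LBINT x. G x t) = th' t * (LBINT x. A x t * ch x) + th t * (LBINT x. F x t * ch' x)"
        proof -
          have "(LBINT x. G x t) = (LBINT x. th' t * (A x t * ch x) + th t * (F x t * ch' x))"
            by (intro Bochner_Integration.integral_cong) (auto simp: G_def)
          also have "\<dots> = (LBINT x. th' t * (A x t * ch x)) + (LBINT x. th t * (F x t * ch' x))"
            by (intro Bochner_Integration.integral_add integrable_mult_right intA intF)
          finally show ?thesis by simp
        qed
        also have "\<dots> \<le> th' t * D t + (4 * m * \<delta> * \<bar>th' t\<bar> + 4 * m * \<omega> * (LBINT s. hat s) * indicator {t1..t3} t)"
        proof (cases "t \<in> {t1..t3}")
          case False then show ?thesis using th_out by simp
        next
          case True
          have "th' t * ((LBINT x. A x t * ch x) - D t) \<le> \<bar>th' t\<bar> * (4 * m * \<delta>)"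
            by (rule order_trans[OF abs_ge_self]) (unfold abs_mult, intro mult_left_mono partA, simp)
          moreover have "th t * (LBINT x. F x t * ch' x) \<le> 1 * (4 * m * \<omega> * (LBINT s. hat s))"
          proof (rule order_trans[OF mult_left_mono[OF partF[OF True] th01(1)] mult_right_mono[OF th01(2)]])
            show "0 \<le> 4 * m * \<omega> * (LBINT s. hat s)" using m(1) \<omega> integral_hat_pos by simp
          qed
          ultimately show ?thesis using True by (simp add: algebra_simps)
        qed
        finally show "(LBINT x. G x t) \<le> th' t * D t + (4 * m * \<delta> * \<bar>th' t\<bar> + 4 * m * \<omega> * (LBINT s. hat s) * indicator {t1..t3} t)" .
      qed
      also have "\<dots> = (LBINT t. th' t * D t) + (4 * m * \<delta> * (LBINT t. \<bar>th' t\<bar>) + 4 * m * \<omega> * (LBINT s. hat s) * (t3 - t1))"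
        using t t3 by (simp add: Bochner_Integration.integral_add Bochner_Integration.integrable_add int_thD int_th' integrable_indicator_Icc)
      also have "4 * m * \<delta> * (LBINT t. \<bar>th' t\<bar>) + 4 * m * \<omega> * (LBINT s. hat s) * (t3 - t1) \<le> \<omega> * C"
      proof -
        have "4 * m * \<delta> * (LBINT t. \<bar>th' t\<bar>) \<le> 4 * m * \<omega> * (LBINT t. \<bar>th' t\<bar>)"
          by (intro mult_right_mono mult_left_mono \<delta> Bochner_Integration.integral_nonneg) (use m(1) in auto)
        then show ?thesis by (simp add: C_def algebra_simps)
      qed
      finally show ?thesis by simp
    qed
    have "0 \<le> (LBINT t. th' t * D t)"
    proof (rule field_le_epsilon)
      fix e :: real assume "e > 0"
      have "e / (C + 1) * C \<le> e" using C \<open>e > 0\<close> by (simp add: field_simps)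
      moreover have "0 < e / (C + 1)" using C \<open>e > 0\<close> by simp
      ultimately show "0 \<le> (LBINT t. th' t * D t) + e" using approx[of "e / (C + 1)"] by linarith
    qed
    also have "\<dots> = (LBINT s. hat s * (D (t1 + \<sigma> * s) - D (t2 + \<sigma> * s)))"
    proof -
      have bd: "\<bar>hat q * D z\<bar> \<le> 2 * (2 * pi * (2 * m))" for q z
        unfolding abs_mult by (intro mult_mono D_bd) (use hat_nonneg[of q] hat_le[of q] in auto)
      have I1: "integrable lborel (\<lambda>t. hat ((t - p) / \<sigma>) * D t)" for p
      proof (rule integrable_compact_support[of _ "{p..p+\<sigma>}", OF _ _ bd])
        show "hat ((x - p) / \<sigma>) * D x = 0" if "x \<notin> {p..p+\<sigma>}" for x
          using that \<sigma> hat_outside[of "(x - p) / \<sigma>"] by (auto simp: field_simps)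
      qed auto
      have I2: "(LBINT t. hat ((t - p) / \<sigma>) * D t) = \<sigma> * (LBINT s. hat s * D (p + \<sigma> * s))" for p
        using lborel_integral_real_affine[of \<sigma> "\<lambda>t. hat ((t - p) / \<sigma>) * D t" p] \<sigma> by simp
      have I3: "integrable lborel (\<lambda>s. hat s * D (p + \<sigma> * s))" for p
        by (rule integrable_compact_support[of _ "{0..1}", OF _ _ bd]) (use hat_outside in auto)
      have "(LBINT t. th' t * D t) = (LBINT t. (hat ((t - t1) / \<sigma>) * D t - hat ((t - t2) / \<sigma>) * D t) / \<sigma>)"
        by (intro Bochner_Integration.integral_cong) (simp_all add: th'_def plateau'_def left_diff_distrib diff_divide_distrib)
      also have "\<dots> = (LBINT s. hat s * D (t1 + \<sigma> * s)) - (LBINT s. hat s * D (t2 + \<sigma> * s))"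
      proof -
        have "(LBINT t. (hat ((t - t1) / \<sigma>) * D t - hat ((t - t2) / \<sigma>) * D t) / \<sigma>)
           = (LBINT t. hat ((t - t1) / \<sigma>) * D t - hat ((t - t2) / \<sigma>) * D t) / \<sigma>"
          by (rule integral_divide_zero)
        also have "\<dots> = (\<sigma> * (LBINT s. hat s * D (t1 + \<sigma> * s)) - \<sigma> * (LBINT s. hat s * D (t2 + \<sigma> * s))) / \<sigma>"
          by (simp only: Bochner_Integration.integral_diff[OF I1 I1] I2)
        finally show ?thesis using \<sigma> by (simp add: diff_divide_distrib)
      qed
      also have "\<dots> = (LBINT s. hat s * (D (t1 + \<sigma> * s) - D (t2 + \<sigma> * s)))"
        by (simp only: Bochner_Integration.integral_diff[OF I3 I3, symmetric] right_diff_distrib)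
      finally show ?thesis .
    qed
    finally show ?thesis .
  qed
  have cont: "\<exists>r>0. \<forall>t\<in>{t1..t3}. \<bar>t - t0\<bar> < r \<longrightarrow> \<bar>D t - D t0\<bar> \<le> \<omega>" if "\<omega> > 0" "t0 \<in> {t1..t3}" for \<omega> t0
  proof -
    have t0: "t0 \<ge> 0" using that t1 by auto
    have w: "\<omega> / 2 > 0" "\<omega> / (4 * pi) > 0" using that by simp_all
    obtain r1 where r1: "r1 > 0" "\<And>s. s \<ge> 0 \<Longrightarrow> \<bar>s - t0\<bar> < r1 \<Longrightarrow> l1dist (\<lambda>x. u x s) (\<lambda>x. u x t0) < \<omega> / 2"
      using entropy_solution_l1_continuous[OF ent t0 w(1)] by blast
    obtain r2 where r2: "r2 > 0" "\<forall>x\<in>K. \<forall>x'\<in>K. dist x' x < r2 \<longrightarrow> \<bar>v (fst x') (snd x') - v (fst x) (snd x)\<bar> < \<omega> / (4 * pi)"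
      using unif[OF w(2)] by blast
    show ?thesis
    proof (intro exI[of _ "min r1 r2"] conjI ballI impI)
      show "min r1 r2 > 0" using r1 r2 by simp
      fix t assume tt: "t \<in> {t1..t3}" "\<bar>t - t0\<bar> < min r1 r2"
      then have t': "t \<ge> 0" using t1 by auto
      have 1: "l1dist (\<lambda>x. u x t) (\<lambda>x. u x t0) < \<omega> / 2" using r1(2)[of t] t' tt by auto
      have 2: "l1dist (\<lambda>x. v x t) (\<lambda>x. v x t0) \<le> 2 * pi * (\<omega> / (4 * pi))"
      proof (rule l1dist_le[OF v_able v_able])
        fix x :: real assume "x \<in> {0..2*pi}"
        then have "(x, t) \<in> K" "(x, t0) \<in> K" using tt that d by (auto simp: K_def)
        then show "\<bar>v x t - v x t0\<bar> \<le> \<omega> / (4 * pi)" using r2(2) tt by (force simp: dist_Pair_Pair dist_real_def)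
      qed (use tt that in auto)
      have 3: "D t \<le> l1dist (\<lambda>x. u x t) (\<lambda>x. u x t0) + (D t0 + l1dist (\<lambda>x. v x t0) (\<lambda>x. v x t))"
        unfolding D_eq[OF tt(1)] D_eq[OF that(2)]
        using l1dist_triangle[OF u_able[OF t'] u_able[OF t0] v_able[OF tt(1)]]
           l1dist_triangle[OF u_able[OF t0] v_able[OF that(2)] v_able[OF tt(1)]] by linarith
      have 4: "D t0 \<le> l1dist (\<lambda>x. u x t0) (\<lambda>x. u x t) + (D t + l1dist (\<lambda>x. v x t) (\<lambda>x. v x t0))"
        unfolding D_eq[OF tt(1)] D_eq[OF that(2)]
        using l1dist_triangle[OF u_able[OF t0] u_able[OF t'] v_able[OF that(2)]]
           l1dist_triangle[OF u_able[OF t'] v_able[OF tt(1)] v_able[OF that(2)]] by linarith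
      have "2 * pi * (\<omega> / (4 * pi)) = \<omega> / 2" by simp
      then show "\<bar>D t - D t0\<bar> \<le> \<omega>"
        using 1 2 3 4 l1dist_commute[of "\<lambda>x. u x t0" "\<lambda>x. u x t"] l1dist_commute[of "\<lambda>x. v x t0" "\<lambda>x. v x t"] by linarith
    qed
  qed
  have "D t2 \<le> D t1"
  proof (rule field_le_epsilon)
    fix \<omega> :: real assume "\<omega> > 0"
    then have w: "\<omega> / 2 > 0" by simp
    obtain r1 where r1: "r1 > 0" "\<forall>t\<in>{t1..t3}. \<bar>t - t1\<bar> < r1 \<longrightarrow> \<bar>D t - D t1\<bar> \<le> \<omega> / 2"
      using cont[OF w, of t1] t t3 by auto
    obtain r2 where r2: "r2 > 0" "\<forall>t\<in>{t1..t3}. \<bar>t - t2\<bar> < r2 \<longrightarrow> \<bar>D t - D t2\<bar> \<le> \<omega> / 2"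
      using cont[OF w, of t2] t t3 by auto
    define \<sigma> where "\<sigma> = min (min r1 r2) (t3 - t2) / 2"
    have \<sigma>: "0 < \<sigma>" "\<sigma> \<le> t3 - t2" "\<sigma> < r1" "\<sigma> < r2" using r1 r2 t3 by (auto simp: \<sigma>_def)
    have bd: "hat s * (D (t1 + \<sigma> * s) - D (t2 + \<sigma> * s)) \<le> hat s * (D t1 - D t2 + \<omega>)" for s
    proof (cases "s \<in> {0..1}")
      case True
      then have s: "0 \<le> \<sigma> * s" "\<sigma> * s \<le> \<sigma>" using \<sigma> by (auto simp: mult_left_le)
      have "\<bar>D (t1 + \<sigma> * s) - D t1\<bar> \<le> \<omega> / 2"
        by (rule r1(2)[rule_format]; (unfold atLeastAtMost_iff)?; use s \<sigma> t t3 in linarith)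
      moreover have "\<bar>D (t2 + \<sigma> * s) - D t2\<bar> \<le> \<omega> / 2"
        by (rule r2(2)[rule_format]; (unfold atLeastAtMost_iff)?; use s \<sigma> t t3 in linarith)
      ultimately have "D (t1 + \<sigma> * s) - D (t2 + \<sigma> * s) \<le> D t1 - D t2 + \<omega>" by linarith
      then show ?thesis by (intro mult_left_mono hat_nonneg)
    next
      case False then show ?thesis using hat_outside[of s] by auto
    qed
    have "integrable lborel (\<lambda>s. hat s * (D (t1 + \<sigma> * s) - D (t2 + \<sigma> * s)))"
    proof (rule integrable_compact_support[of _ "{0..1}"])
      fix s :: real
      have "\<bar>D (t1 + \<sigma> * s) - D (t2 + \<sigma> * s)\<bar> \<le> 2 * pi * (2 * m) + 2 * pi * (2 * m)"
        using D_bd[of "t1 + \<sigma> * s"] D_bd[of "t2 + \<sigma> * s"] by linarith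
      then show "\<bar>hat s * (D (t1 + \<sigma> * s) - D (t2 + \<sigma> * s))\<bar> \<le> 2 * (2 * pi * (2 * m) + 2 * pi * (2 * m))"
        unfolding abs_mult by (intro mult_mono) (use hat_nonneg[of s] hat_le[of s] in auto)
    qed (use hat_outside in auto)
    then have "0 \<le> (LBINT s. hat s * (D t1 - D t2 + \<omega>))"
      by (intro order_trans[OF smear[OF \<sigma>(1,2)] integral_mono] bd integrable_mult_left integrable_hat)
    also have "\<dots> = (LBINT s. hat s) * (D t1 - D t2 + \<omega>)" by simp
    finally show "D t2 \<le> D t1 + \<omega>" using integral_hat_pos by (simp add: zero_le_mult_iff)
  qed
  then show ?thesis using D_eq[of t1] D_eq[of t2] t t3 by simp
qed

section \<open>Characteristics\<close>

text \<open>\<open>F\<close> follows the characteristics. Invariance of domain makes its image open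
  and its inverse continuous; since the Jacobian 1 - t cos y is not 0, the continuous inverse is
  differentiable. So one global inverse is obtained, without patching local ones.\<close>

lemma burgers_characteristics:
  fixes \<Gamma> :: "(real \<times> real) set"
  defines "F \<equiv> (\<lambda>(y, t). (y - t * sin y, t)) :: real \<times> real \<Rightarrow> real \<times> real"
  assumes \<Gamma>: "open \<Gamma>" "\<And>y t. (y, t) \<in> \<Gamma> \<Longrightarrow> t * cos y < 1" and inj: "inj_on F \<Gamma>"
  obtains v vx :: "real \<Rightarrow> real \<Rightarrow> real" where "classical_burgers (F ` \<Gamma>) v vx"
    "\<And>y t. (y, t) \<in> \<Gamma> \<Longrightarrow> v (y - t * sin y) t = - sin y"
proof -
  have contF: "continuous_on \<Gamma> F"
    unfolding F_def split_beta' by (intro continuous_intros)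
  have op: "open (F ` \<Gamma>)" by (rule invariance_of_domain[OF contF \<Gamma>(1) inj])
  obtain g where g: "homeomorphism \<Gamma> (F ` \<Gamma>) F g"
    using invariance_of_domain_homeomorphism[OF \<Gamma>(1) contF _ inj] by auto
  have contg: "continuous_on (F ` \<Gamma>) g" using g by (simp add: homeomorphism_def)
  have gF: "g (F p) = p" if "p \<in> \<Gamma>" for p using g that by (simp add: homeomorphism_def)
  have Fg: "F (g z) = z" if "z \<in> F ` \<Gamma>" for z using gF that by auto
  have g_in: "g z \<in> \<Gamma>" if "z \<in> F ` \<Gamma>" for z using gF that by auto
  have snd_g: "snd (g z) = snd z" if "z \<in> F ` \<Gamma>" for z
    using Fg[OF that] by (cases "g z") (auto simp: F_def)
  define v where "v x t = - sin (fst (g (x, t)))" for x t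
  define vx where "vx x t = - cos (fst (g (x, t))) / (1 - t * cos (fst (g (x, t))))" for x t
  have pos: "1 - t * cos (fst (g (x, t))) > 0" if "(x, t) \<in> F ` \<Gamma>" for x t
    using \<Gamma>(2)[of "fst (g (x, t))" t] g_in[OF that] snd_g[OF that] by (metis diff_gt_0_iff_gt prod.collapse snd_conv)
  have Dg: "(g has_derivative (\<lambda>p. ((fst p + sin (fst (g (x, t))) * snd p) / (1 - t * cos (fst (g (x, t)))), snd p))) (at (x, t))"
    (is "(g has_derivative ?g') _") if xt: "(x, t) \<in> F ` \<Gamma>" for x t
  proof (rule has_derivative_inverse_basic[where f = F and T = "F ` \<Gamma>", OF _ _ _ _ op xt])
    define y where "y = fst (g (x, t))"
    have gy: "g (x, t) = (y, t)" using snd_g[OF xt] by (simp add: y_def prod_eq_iff)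
    have y: "1 - t * cos y \<noteq> 0" using pos[OF xt] by (simp add: y_def)
    show "(F has_derivative (\<lambda>p. ((1 - t * cos y) * fst p - sin y * snd p, snd p))) (at (g (x, t)))"
      unfolding F_def split_beta' gy by (auto intro!: derivative_eq_intros simp: algebra_simps)
    show "bounded_linear ?g'"
      unfolding y_def[symmetric] divide_inverse by (intro bounded_linear_intros)
    show "?g' \<circ> (\<lambda>p. ((1 - t * cos y) * fst p - sin y * snd p, snd p)) = id"
      using y by (auto simp: fun_eq_iff y_def[symmetric])
    show "F (g z) = z" if "z \<in> F ` \<Gamma>" for z by (rule Fg[OF that])
    show "continuous (at (x, t)) g" using continuous_on_eq_continuous_at[OF op] contg xt by blast
  qed
  have Dv: "((\<lambda>s. v s t) has_real_derivative vx x t) (at x)"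
       "((\<lambda>s. v x s) has_real_derivative - (v x t * vx x t)) (at t)" if xt: "(x, t) \<in> F ` \<Gamma>" for x t
  proof -
    define y where "y = fst (g (x, t))"
    note G = has_derivative_fst[OF Dg[OF xt]]
    have "((\<lambda>s. (s, t)) has_derivative (\<lambda>h. (h, 0))) (at x)" by (auto intro!: derivative_eq_intros)
    note comp = has_derivative_compose[OF this G]
    have "((\<lambda>s. fst (g (s, t))) has_real_derivative (1 / (1 - t * cos y))) (at x)"
      unfolding has_field_derivative_def
      by (rule has_derivative_eq_rhs[OF comp]) (auto simp: fun_eq_iff y_def)
    from DERIV_minus[OF DERIV_chain2[OF DERIV_sin this]]
    show "((\<lambda>s. v s t) has_real_derivative vx x t) (at x)" by (simp add: v_def vx_def y_def)
    have "((\<lambda>s. (x, s)) has_derivative (\<lambda>h. (0, h))) (at t)" by (auto intro!: derivative_eq_intros)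
    note comp = has_derivative_compose[OF this G]
    have "((\<lambda>s. fst (g (x, s))) has_real_derivative (sin y / (1 - t * cos y))) (at t)"
      unfolding has_field_derivative_def
      by (rule has_derivative_eq_rhs[OF comp]) (auto simp: fun_eq_iff y_def)
    from DERIV_minus[OF DERIV_chain2[OF DERIV_sin this]]
    show "((\<lambda>s. v x s) has_real_derivative - (v x t * vx x t)) (at t)" by (simp add: v_def vx_def y_def mult.commute)
  qed
  have contY: "continuous_on (F ` \<Gamma>) (\<lambda>p. fst (g p))" using contg by (rule continuous_on_fst)
  have nz: "\<forall>p\<in>F ` \<Gamma>. 1 - snd p * cos (fst (g p)) \<noteq> 0"
    using pos less_irrefl by (metis prod.collapse)
  have cont: "continuous_on (F ` \<Gamma>) (\<lambda>(x, t). v x t)" "continuous_on (F ` \<Gamma>) (\<lambda>(x, t). vx x t)"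
    unfolding v_def vx_def split_beta' prod.collapse
    using nz by (intro continuous_intros contY; simp)+
  show thesis
  proof (rule that)
    show "classical_burgers (F ` \<Gamma>) v vx" unfolding classical_burgers_def using op Dv cont by blast
  qed (use gF in \<open>auto simp: v_def F_def\<close>)
qed

lemma abs_sin_diff_le: "\<bar>sin a - sin b\<bar> \<le> \<bar>a - b\<bar>" for a b :: real
proof -
  have "\<bar>sin a - sin b\<bar> = 2 * \<bar>sin ((a - b) / 2)\<bar> * \<bar>cos ((a + b) / 2)\<bar>"
    by (simp add: sin_diff_sin abs_mult)
  also have "\<dots> \<le> 2 * \<bar>(a - b) / 2\<bar> * 1"
    by (intro mult_mono abs_sin_x_le_abs_x) auto
  finally show ?thesis by simp
qed

lemma DERIV_char: "((\<lambda>y. y - t * sin y) has_real_derivative 1 - t * cos y) (at y)" for t y :: real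
  by (auto intro!: derivative_eq_intros)

lemma char_mono_pre:
  fixes t a b :: real
  assumes "0 \<le> t" "t < 1" "a < b"
  shows "a - t * sin a < b - t * sin b"
proof -
  have "t * (sin b - sin a) \<le> t * \<bar>b - a\<bar>"
    using assms abs_sin_diff_le[of b a] by (intro mult_left_mono) auto
  also have "\<dots> < 1 * \<bar>b - a\<bar>" using assms by (intro mult_strict_right_mono) auto
  finally show ?thesis using assms by (simp add: algebra_simps)
qed

lemma cos_less_1: "0 < x \<Longrightarrow> x < 2 * pi \<Longrightarrow> cos x < 1" for x :: real
  using sin_gt_zero[of "x / 2"] cos_double_sin[of "x / 2"] by simp

lemma char_mono_1:
  fixes a b :: real
  assumes "0 \<le> a" "a < b" "b \<le> 2 * pi"
  shows "a - sin a < b - sin b"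
proof (rule DERIV_pos_imp_increasing_open[OF assms(2)])
  fix x assume "a < x" "x < b"
  then have "cos x < 1" using assms by (intro cos_less_1) auto
  then show "\<exists>y. ((\<lambda>y. y - sin y) has_real_derivative y) (at x) \<and> y > 0"
    using DERIV_char[of 1 x] by (intro exI[of _ "1 - cos x"]) auto
qed (intro continuous_intros)

text \<open>On (0, 2 pi) the cosine falls and then rises, so on [a, b] it is largest at an end
  point. A positive slope at both ends is therefore positive in between.\<close>

lemma char_mono_post:
  fixes t a b :: real
  assumes t: "0 \<le> t" and ab: "0 < a" "a < b" "b < 2 * pi" and c: "t * cos a < 1" "t * cos b < 1"
  shows "a - t * sin a < b - t * sin b"
proof (rule DERIV_pos_imp_increasing[OF ab(2)])
  fix x assume x: "a \<le> x" "x \<le> b"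
  have "cos x \<le> cos a \<or> cos x \<le> cos b"
  proof (cases "x \<le> pi")
    case True
    then show ?thesis using x ab by (intro disjI1 cos_monotone_0_pi_le) auto
  next
    case False
    then have "cos (2 * pi - x) \<le> cos (2 * pi - b)" using x ab by (intro cos_monotone_0_pi_le) auto
    then show ?thesis by (simp add: cos_diff)
  qed
  then have "t * cos x \<le> t * cos a \<or> t * cos x \<le> t * cos b" using t by (auto intro: mult_left_mono)
  then show "\<exists>y. ((\<lambda>y. y - t * sin y) has_real_derivative y) (at x) \<and> y > 0"
    using c by (intro exI[of _ "1 - t * cos x"] conjI DERIV_char) auto
qed

text \<open>The derivative of sin y - y cos y is y sin y. With cos a = 1 / t the inequality reads a
  < t sin a.\<close>

lemma mult_cos_less_sin:
  fixes y :: real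
  assumes "0 < y" "y < pi"
  shows "y * cos y < sin y"
proof -
  have "sin 0 - 0 * cos 0 < sin y - y * cos y"
  proof (rule DERIV_pos_imp_increasing_open[OF assms(1)])
    fix x assume "0 < x" "x < y"
    then show "\<exists>z. ((\<lambda>y. sin y - y * cos y) has_real_derivative z) (at x) \<and> z > 0"
      using assms sin_gt_zero[of x]
      by (intro exI[of _ "x * sin x"]) (auto intro!: derivative_eq_intros)
  qed (intro continuous_intros)
  then show ?thesis by simp
qed

text \<open>The slope 1 - t cos y vanishes at a = arccos (1 / t) and at 2 pi - a. At these turning
  points the value is already below 0 and above 2 pi, so the increasing branch between them covers
  the closed period.\<close>

lemma char_foot_post:
  fixes t x :: real
  assumes t: "1 < t" and x: "x \<in> {0..2*pi}"
  obtains y where "0 < y" "y < 2 * pi" "t * cos y < 1" "y - t * sin y = x"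
proof -
  define a where "a = arccos (1 / t)"
  have t1: "0 < 1 / t" "1 / t < 1" using t by auto
  have ca: "cos a = 1 / t" unfolding a_def by (rule cos_arccos) (use t1 in linarith)+
  have a: "0 < a" "a < pi / 2"
  proof -
    have "a \<ge> 0" "a \<le> pi" using arccos_lbound[of "1 / t"] arccos_ubound[of "1 / t"] t1 by (auto simp: a_def)
    moreover have "a \<noteq> 0" using ca t1 by auto
    ultimately show "0 < a" by simp
    show "a < pi / 2"
    proof (rule ccontr)
      assume "\<not> a < pi / 2"
      then have "cos a \<le> cos (pi / 2)" using \<open>a \<le> pi\<close> by (intro cos_monotone_0_pi_le) auto
      then show False using ca t1 by simp
    qed
  qed
  have fa: "a - t * sin a < 0"
    using mult_cos_less_sin[of a] a ca t by (simp add: field_simps)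
  have fb: "(2 * pi - a) - t * sin (2 * pi - a) > 2 * pi" using fa by (simp add: sin_diff)
  have "\<exists>y\<ge>a. y \<le> 2 * pi - a \<and> y - t * sin y = x"
    by (rule IVT'[of "\<lambda>y. y - t * sin y"]) (use fa fb x a in \<open>auto intro!: continuous_intros\<close>)
  then obtain y where y: "a \<le> y" "y \<le> 2 * pi - a" "y - t * sin y = x" by auto
  have "y \<noteq> a" "y \<noteq> 2 * pi - a" using y fa fb x by auto
  then have y': "a < y" "y < 2 * pi - a" using y by auto
  have "cos y < cos a"
  proof (cases "y \<le> pi")
    case True then show ?thesis using y' a by (intro cos_monotone_0_pi) auto
  next
    case False
    then have "cos (2 * pi - y) < cos a" using y' a by (intro cos_monotone_0_pi) auto
    then show ?thesis by (simp add: cos_diff)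
  qed
  then have "t * cos y < 1" using ca t by (simp add: field_simps)
  then show thesis using that[of y] y y' a by auto
qed

lemma char_foot_pre:
  fixes t x :: real
  assumes t: "0 \<le> t" "t < 1" and x: "x \<in> {0..2*pi}"
  obtains y where "0 \<le> y" "y \<le> 2 * pi" "y - t * sin y = x"
proof -
  have "\<exists>y\<ge>0. y \<le> 2 * pi \<and> y - t * sin y = x"
    by (rule IVT'[of "\<lambda>y. y - t * sin y"]) (use x in \<open>auto intro!: continuous_intros\<close>)
  then show thesis using that by blast
qed

text \<open>Needed to cross t = 1. The slope 1 - cos y vanishes at both ends of the period, so the
  inverse is not Lipschitz, and compactness supplies a modulus of continuity.\<close>

lemma char_inverse_uniform:
  fixes e :: real
  assumes "e > 0"
  obtains d where "d > 0" "\<And>a b. a \<in> {0..2*pi} \<Longrightarrow> b \<in> {0..2*pi} \<Longrightarrow> \<bar>(a - sin a) - (b - sin b)\<bar> < d \<Longrightarrow> \<bar>a - b\<bar> < e"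
proof -
  let ?f = "\<lambda>y::real. y - sin y" and ?I = "{0..2*pi}"
  have inj: "inj_on ?f ?I"
    by (rule linorder_inj_onI) (use char_mono_1 in \<open>force+\<close>)
  have cf: "continuous_on ?I ?f" by (intro continuous_intros)
  have "continuous_on (?f ` ?I) (inv_into ?I ?f)"
    by (rule continuous_on_inv[OF cf]) (use inv_into_f_f[OF inj] in auto)
  moreover have "compact (?f ` ?I)" by (intro compact_continuous_image cf) simp
  ultimately have "uniformly_continuous_on (?f ` ?I) (inv_into ?I ?f)"
    by (rule compact_uniformly_continuous)
  then obtain d where d: "d > 0" "\<forall>x\<in>?f ` ?I. \<forall>x'\<in>?f ` ?I. dist x' x < d \<longrightarrow> dist (inv_into ?I ?f x') (inv_into ?I ?f x) < e"
    using assms unfolding uniformly_continuous_on_def by blast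
  show thesis
  proof (rule that[OF d(1)])
    fix a b :: real assume *: "a \<in> ?I" "b \<in> ?I" "\<bar>?f a - ?f b\<bar> < d"
    then have "dist (inv_into ?I ?f (?f a)) (inv_into ?I ?f (?f b)) < e"
      using d(2)[rule_format, OF imageI[OF *(2)] imageI[OF *(1)]] by (simp add: dist_real_def)
    then show "\<bar>a - b\<bar> < e"
      using inv_into_f_f[OF inj *(1)] inv_into_f_f[OF inj *(2)] by (simp add: dist_real_def)
  qed
qed

lemma shock_flux:
  fixes w a :: real
  assumes "a \<ge> 0"
  shows "\<bar>w + a\<bar> * (w - a) \<le> \<bar>w - a\<bar> * (w + a)"
proof -
  consider "w \<ge> a" | "w \<le> - a" | "- a < w" "w < a" by linarith
  then show ?thesis
  proof cases
    case 1
    then have "\<bar>w + a\<bar> = w + a" "\<bar>w - a\<bar> = w - a" using assms by linarith+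
    then show ?thesis by (simp add: mult.commute)
  next
    case 2
    then have "\<bar>w + a\<bar> = - (w + a)" "\<bar>w - a\<bar> = - (w - a)" using assms by linarith+
    then show ?thesis by (simp add: algebra_simps)
  next
    case 3
    then have "\<bar>w + a\<bar> * (w - a) \<le> 0" "0 \<le> \<bar>w - a\<bar> * (w + a)"
      by (auto intro: mult_nonneg_nonpos)
    then show ?thesis by linarith
  qed
qed

section \<open>The entropy solution after shock formation\<close>

lemma l1able_slice:
  assumes "continuous_on \<Omega> (\<lambda>(x, t). v x t)" "{0..2*pi} \<times> {t} \<subseteq> \<Omega>"
  shows "l1able (\<lambda>x. v x t)"
proof (rule l1able_continuous)
  have "continuous_on {0..2*pi} (\<lambda>x. (\<lambda>(x, t). v x t) (x, t))"
    by (rule continuous_on_compose2[OF assms(1)]) (use assms(2) in \<open>auto intro!: continuous_intros\<close>)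
  then show "continuous_on {0..2*pi} (\<lambda>x. v x t)" by simp
qed

theorem sine_entropy_solution_late:
  fixes u :: "real \<Rightarrow> real \<Rightarrow> real" and T :: real
  assumes ent: "entropy_solution (\<lambda>x. - sin x) u" and T: "T > 1"
  shows "AE x in lborel. x \<in> {0..2*pi} \<longrightarrow> (\<exists>y\<in>{0..2*pi}. y - T * sin y = x \<and> u x T = - sin y)"
proof -
  let ?F = "(\<lambda>(y, t). (y - t * sin y, t)) :: real \<times> real \<Rightarrow> real \<times> real"
  \<comment> \<open>Before t = 1 the feet run over the whole line, so a neighbourhood of the period
    comes for free. Afterwards \<Gamma>2 keeps only the branch of positive slope, whose open image
    still contains the closed period by \<open>char_foot_post\<close>.\<close>
  define \<Gamma>1 :: "(real \<times> real) set" where "\<Gamma>1 = UNIV \<times> {0<..<1}"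
  define \<Gamma>2 :: "(real \<times> real) set" where "\<Gamma>2 = {p. 1 < snd p \<and> 0 < fst p \<and> fst p < 2 * pi \<and> snd p * cos (fst p) < 1}"
  have o1: "open \<Gamma>1" unfolding \<Gamma>1_def by (intro open_Times) auto
  have o2: "open \<Gamma>2" unfolding \<Gamma>2_def by (intro open_Collect_conj open_Collect_less continuous_intros)
  have c1: "t * cos y < 1" if "(y, t) \<in> \<Gamma>1" for y t
  proof -
    have "t * cos y \<le> t * 1" using that by (intro mult_left_mono) (auto simp: \<Gamma>1_def)
    also have "\<dots> < 1" using that by (simp add: \<Gamma>1_def)
    finally show ?thesis .
  qed
  have c2: "t * cos y < 1" if "(y, t) \<in> \<Gamma>2" for y t using that by (simp add: \<Gamma>2_def)
  have i1: "inj_on ?F \<Gamma>1"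
  proof (rule inj_onI, clarsimp)
    fix a b t assume *: "(a, t) \<in> \<Gamma>1" "(b, t) \<in> \<Gamma>1" "a - t * sin a = b - t * sin b"
    then show "a = b" using char_mono_pre[of t a b] char_mono_pre[of t b a] by (force simp: \<Gamma>1_def)
  qed
  have i2: "inj_on ?F \<Gamma>2"
  proof (rule inj_onI, clarsimp)
    fix a b t assume *: "(a, t) \<in> \<Gamma>2" "(b, t) \<in> \<Gamma>2" "a - t * sin a = b - t * sin b"
    then show "a = b" using char_mono_post[of t a b] char_mono_post[of t b a] by (force simp: \<Gamma>2_def)
  qed
  obtain v1 w1 :: "real \<Rightarrow> real \<Rightarrow> real" where v1: "classical_burgers (?F ` \<Gamma>1) v1 w1"
    "\<And>y t. (y, t) \<in> \<Gamma>1 \<Longrightarrow> v1 (y - t * sin y) t = - sin y"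
  proof (rule burgers_characteristics[OF o1 c1 i1], assumption, goal_cases)
    case (1 v w)
    show ?case by (rule 1(1); fact 1)
  qed
  obtain v2 w2 :: "real \<Rightarrow> real \<Rightarrow> real" where v2: "classical_burgers (?F ` \<Gamma>2) v2 w2"
    "\<And>y t. (y, t) \<in> \<Gamma>2 \<Longrightarrow> v2 (y - t * sin y) t = - sin y"
  proof (rule burgers_characteristics[OF o2 c2 i2], assumption, goal_cases)
    case (1 v w)
    show ?case by (rule 1(1); fact 1)
  qed
  have foot1: "\<exists>y\<in>{0..2*pi}. (y, t) \<in> \<Gamma>1 \<and> y - t * sin y = x \<and> v1 x t = - sin y"
    if tx: "0 < t" "t < 1" "x \<in> {0..2*pi}" for x t
  proof -
    obtain y where "0 \<le> y" "y \<le> 2 * pi" "y - t * sin y = x"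
      using char_foot_pre[OF less_imp_le[OF tx(1)] tx(2,3)] by blast
    then show ?thesis using v1(2)[of y t] tx by (intro bexI[of _ y]) (auto simp: \<Gamma>1_def)
  qed
  have foot2: "\<exists>y\<in>{0..2*pi}. (y, t) \<in> \<Gamma>2 \<and> y - t * sin y = x \<and> v2 x t = - sin y"
    if tx: "1 < t" "x \<in> {0..2*pi}" for x t
  proof -
    obtain y where "0 < y" "y < 2 * pi" "t * cos y < 1" "y - t * sin y = x"
      using char_foot_post[OF tx] by blast
    then show ?thesis using v2(2)[of y t] tx by (intro bexI[of _ y]) (auto simp: \<Gamma>2_def)
  qed
  have strip1: "{0..2*pi} \<times> {0<..<1} \<subseteq> ?F ` \<Gamma>1"
  proof
    fix p :: "real \<times> real" assume "p \<in> {0..2*pi} \<times> {0<..<1}"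
    then obtain y where "(y, snd p) \<in> \<Gamma>1" "y - snd p * sin y = fst p" using foot1[of "snd p" "fst p"] by auto
    then show "p \<in> ?F ` \<Gamma>1" by (intro image_eqI[of _ _ "(y, snd p)"]) auto
  qed
  have strip2: "{0..2*pi} \<times> {1<..<b} \<subseteq> ?F ` \<Gamma>2" for b
  proof
    fix p :: "real \<times> real" assume "p \<in> {0..2*pi} \<times> {1<..<b}"
    then obtain y where "(y, snd p) \<in> \<Gamma>2" "y - snd p * sin y = fst p" using foot2[of "snd p" "fst p"] by auto
    then show "p \<in> ?F ` \<Gamma>2" by (intro image_eqI[of _ _ "(y, snd p)"]) auto
  qed
  have able1: "l1able (\<lambda>x. v1 x t)" if "0 < t" "t < 1" for t
    by (rule l1able_slice[OF classical_burgersD(4)[OF v1(1)]]) (use strip1 that in force)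
  have able2: "l1able (\<lambda>x. v2 x t)" if "1 < t" for t
    by (rule l1able_slice[OF classical_burgersD(4)[OF v2(1)]]) (use strip2[of "t + 1"] that in force)
  note able = entropy_solution_l1able[OF ent]
  have able0: "l1able (\<lambda>x. - sin x)" by (intro l1able_continuous continuous_intros)
  have D1: "l1dist (\<lambda>x. u x t) (\<lambda>x. v1 x t) \<le> l1dist (\<lambda>x. u x s) (\<lambda>x. v1 x s)" if "0 < s" "s < t" "t < 1" for s t
  proof (rule l1_contraction[OF ent v1(1) strip1 order_refl _ that])
    fix t w :: real assume "0 < t" "t < 1"
    then have "v1 0 t = 0" "v1 (2*pi) t = 0" using v1(2)[of 0 t] v1(2)[of "2*pi" t] by (auto simp: \<Gamma>1_def)
    then show "\<bar>w - v1 0 t\<bar> * (w + v1 0 t) \<le> \<bar>w - v1 (2*pi) t\<bar> * (w + v1 (2*pi) t)" by simp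
  qed
  have Z1: "l1dist (\<lambda>x. u x t) (\<lambda>x. v1 x t) = 0" if t: "0 < t" "t < 1" for t
  proof -
    have "l1dist (\<lambda>x. u x t) (\<lambda>x. v1 x t) \<le> 0"
    proof (rule field_le_epsilon)
      fix e :: real assume "e > 0"
      then have "e / 2 > 0" by simp
      from entropy_solution_l1_continuous[OF ent order_refl this] obtain d where d: "d > 0"
        "\<And>s. s \<ge> 0 \<Longrightarrow> \<bar>s - 0\<bar> < d \<Longrightarrow> l1dist (\<lambda>x. u x s) (\<lambda>x. u x 0) < e / 2" by blast
      \<comment> \<open>A point and its foot are s |sin y| apart, so \<open>v1\<close> at time s is
        within 2 pi s \<le> e / 2 of the data; d / 2 does the same for \<open>u\<close>, and t / 2
        keeps s before t.\<close>
      define s where "s = min (d / 2) (min (t / 2) (e / (4 * pi)))"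
      have s: "0 < s" "s < d" "s < t" "s \<le> e / (4 * pi)" using d t \<open>e > 0\<close> by (auto simp: s_def)
      have "l1dist (\<lambda>x. - sin x) (\<lambda>x. v1 x s) \<le> 2 * pi * s"
      proof (rule l1dist_le[OF able0 able1])
        fix x :: real assume "x \<in> {0..2*pi}"
        then obtain y where y: "y - s * sin y = x" "v1 x s = - sin y" using foot1[of s x] s t by auto
        have "\<bar>sin x - sin y\<bar> \<le> \<bar>x - y\<bar>" by (rule abs_sin_diff_le)
        also have "\<bar>x - y\<bar> = s * \<bar>sin y\<bar>" using y(1) s(1) by (auto simp: abs_mult)
        also have "\<dots> \<le> s * 1" using s by (intro mult_left_mono) auto
        finally show "\<bar>- sin x - v1 x s\<bar> \<le> s" using y by simp
      qed (use s t in auto)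
      also have "\<dots> \<le> 2 * pi * (e / (4 * pi))" using s by (intro mult_left_mono) auto
      also have "\<dots> = e / 2" by simp
      finally have 1: "l1dist (\<lambda>x. - sin x) (\<lambda>x. v1 x s) \<le> e / 2" .
      have "l1dist (\<lambda>x. u x t) (\<lambda>x. v1 x t) \<le> l1dist (\<lambda>x. u x s) (\<lambda>x. v1 x s)"
        by (rule D1) (use s t in auto)
      also have "\<dots> \<le> l1dist (\<lambda>x. u x s) (\<lambda>x. u x 0) + l1dist (\<lambda>x. u x 0) (\<lambda>x. v1 x s)"
        by (intro l1dist_triangle able able1) (use s t in auto)
      also have "l1dist (\<lambda>x. u x 0) (\<lambda>x. v1 x s) \<le> l1dist (\<lambda>x. u x 0) (\<lambda>x. - sin x) + l1dist (\<lambda>x. - sin x) (\<lambda>x. v1 x s)"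
        by (intro l1dist_triangle able able1 able0) (use s t in auto)
      also have "l1dist (\<lambda>x. u x 0) (\<lambda>x. - sin x) = 0" by (rule entropy_solution_initial[OF ent able0])
      finally show "l1dist (\<lambda>x. u x t) (\<lambda>x. v1 x t) \<le> 0 + e" using d(2)[of s] s 1 by simp
    qed
    then show ?thesis using l1dist_nonneg by (simp add: order_antisym)
  qed
  have D2: "l1dist (\<lambda>x. u x t) (\<lambda>x. v2 x t) \<le> l1dist (\<lambda>x. u x s) (\<lambda>x. v2 x s)" if "1 < s" "s < t" for s t
  proof (rule l1_contraction[OF ent v2(1) strip2[of "t + 1"] _ _ that])
    fix t w :: real assume t: "1 < t"
    obtain y where y: "0 < y" "y < 2 * pi" "t * cos y < 1" "y - t * sin y = 0"
      using char_foot_post[OF t, of 0] by (metis atLeastAtMost_iff order_refl pi_ge_zero mult_nonneg_nonneg zero_le_numeral)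
    have "t * sin y > 0" using y by simp
    then have sy: "sin y > 0" using t by (simp add: zero_less_mult_iff)
    have "v2 0 t = - sin y" using v2(2)[of y t] y t by (simp add: \<Gamma>2_def)
    moreover have "v2 (2*pi) t = sin y"
    proof -
      have "(2 * pi - y, t) \<in> \<Gamma>2" using y t by (simp add: \<Gamma>2_def cos_diff)
      moreover have "(2 * pi - y) - t * sin (2 * pi - y) = 2 * pi" using y by (simp add: sin_diff)
      ultimately show ?thesis using v2(2)[of "2 * pi - y" t] by (simp add: sin_diff)
    qed
    ultimately show "\<bar>w - v2 0 t\<bar> * (w + v2 0 t) \<le> \<bar>w - v2 (2*pi) t\<bar> * (w + v2 (2*pi) t)"
      using shock_flux[of "sin y" w] sy by simp
  qed auto
  have Z2: "l1dist (\<lambda>x. u x T) (\<lambda>x. v2 x T) = 0"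
  proof -
    have "l1dist (\<lambda>x. u x T) (\<lambda>x. v2 x T) \<le> 0"
    proof (rule field_le_epsilon)
      fix e :: real assume e: "e > 0"
      then have "e / 4 > 0" "e / (4 * pi) > 0" by simp_all
      obtain d where d: "d > 0" "\<And>s. s \<ge> 0 \<Longrightarrow> \<bar>s - 1\<bar> < d \<Longrightarrow> l1dist (\<lambda>x. u x s) (\<lambda>x. u x 1) < e / 4"
        using entropy_solution_l1_continuous[OF ent zero_le_one \<open>e / 4 > 0\<close>] by blast
      obtain r where r: "r > 0" "\<And>a b. a \<in> {0..2*pi} \<Longrightarrow> b \<in> {0..2*pi} \<Longrightarrow> \<bar>(a - sin a) - (b - sin b)\<bar> < r \<Longrightarrow> \<bar>a - b\<bar> < e / (4 * pi)"
        using char_inverse_uniform[OF \<open>e / (4 * pi) > 0\<close>] by blast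
      \<comment> \<open>The chain u (1 + k), u 1, u (1 - k), v1 (1 - k), v2 (1 + k) crosses the
        critical time at the costs e/4, e/4, 0, e/2. The feet a, b of one x satisfy |(a - sin a) -
        (b - sin b)| \<le> 2 k, whence the requirement 2 k < r.\<close>
      define k where "k = min (min (d / 2) (r / 4)) (min (1 / 2) ((T - 1) / 2))"
      have k: "0 < k" "k < d" "2 * k < r" "k < 1" "k < T - 1" using d r T by (auto simp: k_def min_def)
      have 1: "l1dist (\<lambda>x. u x (1 - k)) (\<lambda>x. u x 1) < e / 4" "l1dist (\<lambda>x. u x (1 + k)) (\<lambda>x. u x 1) < e / 4"
        using d(2)[of "1 - k"] d(2)[of "1 + k"] k by auto
      have "l1dist (\<lambda>x. v1 x (1 - k)) (\<lambda>x. v2 x (1 + k)) \<le> 2 * pi * (e / (4 * pi))"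
      proof (rule l1dist_le[OF able1 able2])
        fix x :: real assume x: "x \<in> {0..2*pi}"
        obtain a where a: "a \<in> {0..2*pi}" "a - (1 - k) * sin a = x" "v1 x (1 - k) = - sin a"
          using foot1[of "1 - k" x] x k by auto
        obtain b where b: "b \<in> {0..2*pi}" "b - (1 + k) * sin b = x" "v2 x (1 + k) = - sin b"
          using foot2[of "1 + k" x] x k by auto
        have "(a - sin a) - (b - sin b) = - k * (sin a + sin b)" using a(2) b(2) by (simp add: algebra_simps)
        also have "\<bar>\<dots>\<bar> \<le> k * 2"
        proof -
          have "\<bar>sin a + sin b\<bar> \<le> 2" using abs_sin_le_one[of a] abs_sin_le_one[of b] by linarith
          then show ?thesis using k by (simp add: abs_mult)
        qed
        finally have "\<bar>a - b\<bar> < e / (4 * pi)" using k by (intro r(2) a b) simp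
        then show "\<bar>v1 x (1 - k) - v2 x (1 + k)\<bar> \<le> e / (4 * pi)"
          using abs_sin_diff_le[of b a] a b by (simp add: abs_minus_commute)
      qed (use k in auto)
      also have "\<dots> = e / 2" by simp
      finally have 2: "l1dist (\<lambda>x. v1 x (1 - k)) (\<lambda>x. v2 x (1 + k)) \<le> e / 2" .
      have "l1dist (\<lambda>x. u x T) (\<lambda>x. v2 x T) \<le> l1dist (\<lambda>x. u x (1 + k)) (\<lambda>x. v2 x (1 + k))"
        by (rule D2) (use k in auto)
      also have "\<dots> \<le> l1dist (\<lambda>x. u x (1 + k)) (\<lambda>x. u x 1) + l1dist (\<lambda>x. u x 1) (\<lambda>x. v2 x (1 + k))"
        by (intro l1dist_triangle able able2) (use k in auto)
      also have "l1dist (\<lambda>x. u x 1) (\<lambda>x. v2 x (1 + k)) \<le> l1dist (\<lambda>x. u x 1) (\<lambda>x. u x (1 - k)) + l1dist (\<lambda>x. u x (1 - k)) (\<lambda>x. v2 x (1 + k))"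
        by (intro l1dist_triangle able able2) (use k in auto)
      also have "l1dist (\<lambda>x. u x (1 - k)) (\<lambda>x. v2 x (1 + k)) \<le> l1dist (\<lambda>x. u x (1 - k)) (\<lambda>x. v1 x (1 - k)) + l1dist (\<lambda>x. v1 x (1 - k)) (\<lambda>x. v2 x (1 + k))"
        by (intro l1dist_triangle able able1 able2) (use k in auto)
      also have "l1dist (\<lambda>x. u x (1 - k)) (\<lambda>x. v1 x (1 - k)) = 0" by (rule Z1) (use k in auto)
      finally show "l1dist (\<lambda>x. u x T) (\<lambda>x. v2 x T) \<le> 0 + e"
        using 1 2 l1dist_commute[of "\<lambda>x. u x 1" "\<lambda>x. u x (1 - k)"] by linarith
    qed
    then show ?thesis using l1dist_nonneg by (simp add: order_antisym)
  qed
  have "AE x in lborel. x \<in> {0..2*pi} \<longrightarrow> u x T = v2 x T"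
    by (rule l1dist_eq_0_AE[OF able able2 Z2]) (use T in auto)
  then show ?thesis
  proof eventually_elim
    case (elim x)
    then show ?case using foot2[OF T, of x] by metis
  qed
qed

section \<open>Reduction of shifted data to - sin by translation invariance\<close>

lemma nn_integral_periodic:
  fixes f :: "real \<Rightarrow> real"
  assumes f: "f \<in> borel_measurable borel" and per: "\<And>x. f (x + 2 * pi) = f x" and c: "c \<in> {0..2*pi}"
  shows "(\<integral>\<^sup>+ x\<in>{0..2*pi}. ennreal (f (x + c)) \<partial>lborel) = (\<integral>\<^sup>+ x\<in>{0..2*pi}. ennreal (f x) \<partial>lborel)"
proof -
  note [measurable] = f
  let ?g = "\<lambda>x. ennreal (f x)"
  have null: "AE x in lborel. x \<noteq> (a::real)" for a by (rule AE_lborel_singleton)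
  have shift: "(\<integral>\<^sup>+ x. h x \<partial>lborel) = (\<integral>\<^sup>+ x. h (x + a) \<partial>lborel)" if "h \<in> borel_measurable borel" for h :: "real \<Rightarrow> ennreal" and a
    using nn_integral_real_affine[OF that, of 1 a] by (simp add: add.commute)
  have "(\<integral>\<^sup>+ x\<in>{0..2*pi}. ?g x \<partial>lborel) = (\<integral>\<^sup>+ x. ?g x * indicator {c..2*pi} x + ?g x * indicator {0..c} x \<partial>lborel)"
  proof (rule nn_integral_cong_AE)
    show "AE x in lborel. ?g x * indicator {0..2*pi} x = ?g x * indicator {c..2*pi} x + ?g x * indicator {0..c} x"
      using null[of c] by eventually_elim (use c in \<open>auto simp: indicator_def\<close>)
  qed
  also have "\<dots> = (\<integral>\<^sup>+ x. ?g x * indicator {c..2*pi} x \<partial>lborel) + (\<integral>\<^sup>+ x. ?g x * indicator {0..c} x \<partial>lborel)"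
    by (intro nn_integral_add) auto
  also have "(\<integral>\<^sup>+ x. ?g x * indicator {c..2*pi} x \<partial>lborel) = (\<integral>\<^sup>+ x. ?g (x + c) * indicator {0..2*pi-c} x \<partial>lborel)"
    by (subst shift[of _ c]) (auto intro!: nn_integral_cong simp: indicator_def)
  also have "(\<integral>\<^sup>+ x. ?g x * indicator {0..c} x \<partial>lborel) = (\<integral>\<^sup>+ x. ?g (x + c) * indicator {2*pi-c..2*pi} x \<partial>lborel)"
  proof (subst shift[of _ "c - 2 * pi"])
    have "f (x + (c - 2 * pi)) = f (x + c)" for x using per[of "x + (c - 2 * pi)"] by (simp add: algebra_simps)
    then show "(\<integral>\<^sup>+ x. ?g (x + (c - 2 * pi)) * indicator {0..c} (x + (c - 2 * pi)) \<partial>lborel) = (\<integral>\<^sup>+ x. ?g (x + c) * indicator {2*pi-c..2*pi} x \<partial>lborel)"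
      by (auto intro!: nn_integral_cong simp: indicator_def)
  qed auto
  also have "(\<integral>\<^sup>+ x. ?g (x + c) * indicator {0..2*pi-c} x \<partial>lborel) + (\<integral>\<^sup>+ x. ?g (x + c) * indicator {2*pi-c..2*pi} x \<partial>lborel)
     = (\<integral>\<^sup>+ x. ?g (x + c) * indicator {0..2*pi-c} x + ?g (x + c) * indicator {2*pi-c..2*pi} x \<partial>lborel)"
    by (intro nn_integral_add[symmetric]) auto
  also have "\<dots> = (\<integral>\<^sup>+ x\<in>{0..2*pi}. ?g (x + c) \<partial>lborel)"
  proof (rule nn_integral_cong_AE)
    show "AE x in lborel. ?g (x + c) * indicator {0..2*pi-c} x + ?g (x + c) * indicator {2*pi-c..2*pi} x
        = ?g (x + c) * indicator {0..2*pi} x"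
      using null[of "2*pi-c"] by eventually_elim (use c in \<open>auto simp: indicator_def\<close>)
  qed
  finally show ?thesis by simp
qed

text \<open>Test functions are translated the opposite way, and invariance of Lebesgue measure on
  the plane moves the integral back. Conditions over one period survive because the integrands are
  periodic.\<close>

lemma entropy_solution_translate:
  assumes ent: "entropy_solution (\<lambda>x. - sin (x - c)) u" and c: "c \<in> {0..2*pi}"
  shows "entropy_solution (\<lambda>x. - sin x) (\<lambda>x t. u (x + c) t)"
  unfolding entropy_solution_def
proof (intro conjI allI impI)
  have per: "u (x + 2 * pi) t = u x t" if "t \<ge> 0" for x t using ent that by (simp add: entropy_solution_def)
  have mu: "(\<lambda>p. u (fst p) (snd p)) \<in> borel_measurable borel"
    using ent by (simp add: entropy_solution_def split_beta')
  have m1: "(\<lambda>x. u (f x) (g x)) \<in> borel_measurable N"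
    if "f \<in> borel_measurable N" "g \<in> borel_measurable N" for f g :: "'z \<Rightarrow> real" and N
    using measurable_compose[OF _ mu, of "\<lambda>x. (f x, g x)" N] that by simp
  show "u (x + 2 * pi + c) t = u (x + c) t" if "t \<ge> 0" for x t
    using per[OF that, of "x + c"] by (simp add: algebra_simps)
  show "(\<lambda>(x, t). u (x + c) t) \<in> borel_measurable lborel"
    unfolding split_beta' by (simp, intro m1) (auto intro!: borel_measurable_continuous_onI continuous_intros)
  show "\<exists>M. \<forall>x t. t \<ge> 0 \<longrightarrow> \<bar>u (x + c) t\<bar> \<le> M"
    using ent unfolding entropy_solution_def by blast
  show "((\<lambda>s. \<integral>\<^sup>+ x\<in>{0..2*pi}. ennreal \<bar>u (x + c) s - u (x + c) t\<bar> \<partial>lborel) \<longlongrightarrow> 0) (at t within {0..})"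
    if t: "t \<ge> 0" for t
  proof -
    have "((\<lambda>s. \<integral>\<^sup>+ x\<in>{0..2*pi}. ennreal \<bar>u x s - u x t\<bar> \<partial>lborel) \<longlongrightarrow> 0) (at t within {0..})"
      using ent t by (simp add: entropy_solution_def)
    moreover have "\<forall>\<^sub>F s in at t within {0..}. (\<integral>\<^sup>+ x\<in>{0..2*pi}. ennreal \<bar>u x s - u x t\<bar> \<partial>lborel)
        = (\<integral>\<^sup>+ x\<in>{0..2*pi}. ennreal \<bar>u (x + c) s - u (x + c) t\<bar> \<partial>lborel)"
      unfolding eventually_at_filter
    proof (rule always_eventually, intro allI impI)
      fix s :: real assume "s \<in> {0..}"
      then show "(\<integral>\<^sup>+ x\<in>{0..2*pi}. ennreal \<bar>u x s - u x t\<bar> \<partial>lborel)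
        = (\<integral>\<^sup>+ x\<in>{0..2*pi}. ennreal \<bar>u (x + c) s - u (x + c) t\<bar> \<partial>lborel)"
        using t c by (intro nn_integral_periodic[symmetric]) (auto simp: per intro!: borel_measurable_abs borel_measurable_diff m1)
    qed
    ultimately show ?thesis by (rule Lim_transform_eventually)
  qed
  show "(\<integral>\<^sup>+ x\<in>{0..2*pi}. ennreal \<bar>u (x + c) 0 - - sin x\<bar> \<partial>lborel) = 0"
  proof -
    have "(\<integral>\<^sup>+ x\<in>{0..2*pi}. ennreal \<bar>u (x + c) 0 - - sin ((x + c) - c)\<bar> \<partial>lborel) = (\<integral>\<^sup>+ x\<in>{0..2*pi}. ennreal \<bar>u x 0 - - sin (x - c)\<bar> \<partial>lborel)"
    proof (rule nn_integral_periodic[OF _ _ c])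
      show "(\<lambda>x. \<bar>u x 0 - - sin (x - c)\<bar>) \<in> borel_measurable borel"
        by (intro borel_measurable_abs borel_measurable_diff m1) auto
      have "sin (x + 2 * pi - c) = sin (x - c)" for x using sin_periodic[of "x - c"] by (simp add: algebra_simps)
      then show "\<bar>u (x + 2 * pi) 0 - - sin (x + 2 * pi - c)\<bar> = \<bar>u x 0 - - sin (x - c)\<bar>" for x by (simp add: per)
    qed
    then show ?thesis using ent by (simp add: entropy_solution_def)
  qed
  fix k phi phix phit assume kt: "kruzkov_test phi phix phit"
  have "kruzkov_test (\<lambda>x t. phi (x - c) t) (\<lambda>x t. phix (x - c) t) (\<lambda>x t. phit (x - c) t)"
    unfolding kruzkov_test_def
  proof (intro conjI allI)
    fix x t
    show "phi (x - c) t \<ge> 0" using kt by (simp add: kruzkov_test_def)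
    have "((\<lambda>s. s - c) has_real_derivative 1) (at x)" by (auto intro!: derivative_eq_intros)
    then show "((\<lambda>s. phi (s - c) t) has_real_derivative phix (x - c) t) (at x)"
      using kt DERIV_chain2[of "\<lambda>s. phi s t" "phix (x - c) t" "\<lambda>s. s - c" x 1] by (auto simp: kruzkov_test_def)
    show "((\<lambda>s. phi (x - c) s) has_real_derivative phit (x - c) t) (at t)" using kt by (simp add: kruzkov_test_def)
  next
    have comp: "continuous_on UNIV (\<lambda>(x, t). f (x - c) t)" if "continuous_on UNIV (\<lambda>(x, t). f x t)" for f :: "real \<Rightarrow> real \<Rightarrow> real"
    proof -
      have "continuous_on UNIV (\<lambda>p::real \<times> real. (fst p - c, snd p))" by (intro continuous_intros)
      from continuous_on_compose2[OF that this] show ?thesis by (simp add: split_beta')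
    qed
    show "continuous_on UNIV (\<lambda>(x, t). phix (x - c) t)" "continuous_on UNIV (\<lambda>(x, t). phit (x - c) t)"
      using kt by (auto simp: kruzkov_test_def intro!: comp)
    obtain R where R: "R > 0" "\<And>x t. \<bar>x\<bar> \<ge> R \<or> t \<le> 1 / R \<or> t \<ge> R \<Longrightarrow> phi x t = 0"
      using kt unfolding kruzkov_test_def by blast
    show "\<exists>R>0. \<forall>x t. \<bar>x\<bar> \<ge> R \<or> t \<le> 1 / R \<or> t \<ge> R \<longrightarrow> phi (x - c) t = 0"
    proof (intro exI[of _ "R + \<bar>c\<bar>"] conjI allI impI)
      show "R + \<bar>c\<bar> > 0" using R by simp
      fix x t assume "\<bar>x\<bar> \<ge> R + \<bar>c\<bar> \<or> t \<le> 1 / (R + \<bar>c\<bar>) \<or> t \<ge> R + \<bar>c\<bar>"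
      moreover have "1 / (R + \<bar>c\<bar>) \<le> 1 / R" using R by (intro divide_left_mono) auto
      ultimately have "\<bar>x - c\<bar> \<ge> R \<or> t \<le> 1 / R \<or> t \<ge> R" by linarith
      then show "phi (x - c) t = 0" by (rule R(2))
    qed
  qed
  then have "0 \<le> (LBINT (x, t). (\<bar>u x t - k\<bar> * phit (x - c) t
       + sgn (u x t - k) * ((u x t)\<^sup>2 / 2 - k\<^sup>2 / 2) * phix (x - c) t))" (is "0 \<le> integral\<^sup>L lborel ?G")
    using ent unfolding entropy_solution_def by blast
  also have "\<dots> = (LBINT p. ?G ((c, 0) + p))"
  proof -
    have phm: "continuous_on UNIV (\<lambda>(x, t). phix x t)" "continuous_on UNIV (\<lambda>(x, t). phit x t)"
      using kt by (auto simp: kruzkov_test_def)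
    have [measurable]: "(\<lambda>p. phix (fst p - c) (snd p)) \<in> borel_measurable borel" "(\<lambda>p. phit (fst p - c) (snd p)) \<in> borel_measurable borel"
    proof -
      have "continuous_on UNIV (\<lambda>p::real \<times> real. (fst p - c, snd p))" by (intro continuous_intros)
      from continuous_on_compose2[OF phm(1) this] continuous_on_compose2[OF phm(2) this]
      show "(\<lambda>p. phix (fst p - c) (snd p)) \<in> borel_measurable borel" "(\<lambda>p. phit (fst p - c) (snd p)) \<in> borel_measurable borel"
        by (auto simp: split_beta' intro: borel_measurable_continuous_onI)
    qed
    note [measurable] = mu
    have "?G \<in> borel_measurable borel" unfolding split_beta' by measurable
    then have "(\<integral>p. ?G p \<partial>distr lborel borel ((+) (c, 0))) = (LBINT p. ?G ((c, 0) + p))"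
      by (intro integral_distr) auto
    then show ?thesis by (simp only: lborel_distr_plus)
  qed
  also have "\<dots> = (LBINT (x, t). (\<bar>u (x + c) t - k\<bar> * phit x t
       + sgn (u (x + c) t - k) * ((u (x + c) t)\<^sup>2 / 2 - k\<^sup>2 / 2) * phix x t))"
    by (intro Bochner_Integration.integral_cong) (auto simp: add.commute)
  finally show "0 \<le> (LBINT (x, t). (\<bar>u (x + c) t - k\<bar> * phit x t
       + sgn (u (x + c) t - k) * ((u (x + c) t)\<^sup>2 / 2 - k\<^sup>2 / 2) * phix x t))" .
qed

section \<open>Realising maps by ReLU networks\<close>

text \<open>The meaning of one row of a layer, restricted to inputs of the right length. The closure
  rules let layers be written as formulas; \<open>layer_of_lin\<close> recovers the weights.\<close>

definition affine_form :: "nat \<Rightarrow> (real list \<Rightarrow> real) \<Rightarrow> bool" where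
  "affine_form n f \<longleftrightarrow> (\<exists>a b. \<forall>x. length x = n \<longrightarrow> f x = (\<Sum>i<n. a i * x ! i) + b)"

lemma affine_form_const [intro!]: "affine_form n (\<lambda>_. c)"
  unfolding affine_form_def by (rule exI[of _ "\<lambda>_. 0"]) auto

lemma affine_form_nth [intro!]: "i < n \<Longrightarrow> affine_form n (\<lambda>x. x ! i)"
  unfolding affine_form_def
  by (rule exI[of _ "\<lambda>j. if j = i then 1 else 0"], rule exI[of _ 0]) (auto simp: if_distrib[of "\<lambda>c. c * _"] cong: if_cong)

lemma affine_form_add [intro!]:
  assumes "affine_form n f" "affine_form n g"
  shows "affine_form n (\<lambda>x. f x + g x)"
proof -
  obtain a b a' b' where "\<forall>x. length x = n \<longrightarrow> f x = (\<Sum>i<n. a i * x ! i) + b"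
    "\<forall>x. length x = n \<longrightarrow> g x = (\<Sum>i<n. a' i * x ! i) + b'"
    using assms unfolding affine_form_def by blast
  then show ?thesis unfolding affine_form_def
    by (intro exI[of _ "\<lambda>i. a i + a' i"] exI[of _ "b + b'"]) (auto simp: algebra_simps sum.distrib)
qed

lemma affine_form_cmult [intro!]:
  assumes "affine_form n f"
  shows "affine_form n (\<lambda>x. c * f x)"
proof -
  obtain a b where "\<forall>x. length x = n \<longrightarrow> f x = (\<Sum>i<n. a i * x ! i) + b"
    using assms unfolding affine_form_def by blast
  then show ?thesis unfolding affine_form_def
    by (intro exI[of _ "\<lambda>i. c * a i"] exI[of _ "c * b"]) (auto simp: algebra_simps sum_distrib_left)
qed

lemma affine_form_multc [intro!]: "affine_form n f \<Longrightarrow> affine_form n (\<lambda>x. f x * c)"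
  using affine_form_cmult[of n f c] by (simp add: mult.commute)

lemma affine_form_divide [intro!]: "affine_form n f \<Longrightarrow> affine_form n (\<lambda>x. f x / c)"
  using affine_form_cmult[of n f "1 / c"] by simp

lemma affine_form_minus [intro!]: "affine_form n f \<Longrightarrow> affine_form n (\<lambda>x. - f x)"
  using affine_form_cmult[of n f "-1"] by simp

lemma affine_form_diff [intro!]: "affine_form n f \<Longrightarrow> affine_form n g \<Longrightarrow> affine_form n (\<lambda>x. f x - g x)"
  using affine_form_add[of n f "\<lambda>x. - g x"] affine_form_minus[of n g] by simp

lemma affine_form_sum: "(\<And>i. i \<in> I \<Longrightarrow> affine_form n (f i)) \<Longrightarrow> affine_form n (\<lambda>x. \<Sum>i\<in>I. f i x)"
  by (induction I rule: infinite_finite_induct) auto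

lemma affine_form_compose:
  assumes "affine_form (length es) f" "\<forall>e\<in>set es. affine_form n e"
  shows "affine_form n (\<lambda>x. f (map (\<lambda>e. e x) es))"
proof -
  obtain a b where ab: "\<forall>x. length x = length es \<longrightarrow> f x = (\<Sum>i<length es. a i * x ! i) + b"
    using assms(1) unfolding affine_form_def by blast
  have "affine_form n (\<lambda>x. (\<Sum>i<length es. a i * (es ! i) x) + b)"
    by (intro affine_form_add affine_form_const affine_form_sum affine_form_cmult) (use assms(2) in auto)
  moreover have "(\<lambda>x. f (map (\<lambda>e. e x) es)) = (\<lambda>x. (\<Sum>i<length es. a i * (es ! i) x) + b)"
    using ab by auto
  ultimately show ?thesis by simp
qed

definition layer_ok :: "nat \<Rightarrow> layer \<Rightarrow> bool" where
  "layer_ok n L \<longleftrightarrow> length (fst L) = length (snd L) \<and> (\<forall>row\<in>set (fst L). length row = n)"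

lemma sum_list_map2_mult:
  "length row = n \<Longrightarrow> length x = n \<Longrightarrow> sum_list (map2 (*) row x) = (\<Sum>i<n. row ! i * x ! i)" for row x :: "real list"
  by (subst sum_list_sum_nth) (simp add: atLeast0LessThan)

lemma length_affine: "layer_ok n L \<Longrightarrow> length (affine L x) = length (snd L)"
  by (simp add: layer_ok_def affine_def)

lemma affine_form_affine:
  assumes "layer_ok n L" "j < length (snd L)"
  shows "affine_form n (\<lambda>x. affine L x ! j)"
proof -
  have "fst L ! j \<in> set (fst L)" using assms by (simp add: layer_ok_def)
  then have "length (fst L ! j) = n" using assms by (simp add: layer_ok_def)
  then show ?thesis unfolding affine_form_def
    by (intro exI[of _ "\<lambda>i. fst L ! j ! i"] exI[of _ "snd L ! j"])
       (use assms in \<open>auto simp: affine_def layer_ok_def sum_list_map2_mult\<close>)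
qed

lemma layer_of_lin:
  assumes "\<forall>e\<in>set es. affine_form n e"
  obtains L where "layer_ok n L" "length (snd L) = length es" "\<And>x. length x = n \<Longrightarrow> affine L x = map (\<lambda>e. e x) es"
proof -
  have "\<exists>L. layer_ok n L \<and> length (snd L) = length es \<and> (\<forall>x. length x = n \<longrightarrow> affine L x = map (\<lambda>e. e x) es)"
    using assms
  proof (induction es)
    case Nil
    then show ?case by (intro exI[of _ "([], [])"]) (auto simp: layer_ok_def affine_def)
  next
    case (Cons e es)
    then obtain L where L: "layer_ok n L" "length (snd L) = length es" "\<forall>x. length x = n \<longrightarrow> affine L x = map (\<lambda>e. e x) es"
      by auto
    obtain a b where ab: "\<forall>x. length x = n \<longrightarrow> e x = (\<Sum>i<n. a i * x ! i) + b"
      using Cons.prems by (auto simp: affine_form_def)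
    show ?case
      by (intro exI[of _ "(map a [0..<n] # fst L, b # snd L)"])
         (use L ab in \<open>auto simp: layer_ok_def affine_def sum_list_map2_mult[where n = n]\<close>)
  qed
  then show thesis using that by blast
qed

lemma valid_net_single: "valid_net n q [L] \<longleftrightarrow> layer_ok n L \<and> length (snd L) = q"
  by (auto simp: valid_net_def layer_ok_def)

lemma valid_net_Cons: "valid_net n q (L # L' # Ls) \<longleftrightarrow> layer_ok n L \<and> valid_net (length (snd L)) q (L' # Ls)"
proof -
  have *: "(\<forall>i<length (L # L' # Ls). P i) \<longleftrightarrow> P 0 \<and> (\<forall>i<length (L' # Ls). P (Suc i))" for P
    using All_less_Suc2[of "length (L' # Ls)" P] by simp
  show ?thesis
    unfolding valid_net_def layer_ok_def * by (auto simp: nth_Cons' split: if_splits)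
qed

lemma net_width_Cons: "net_width (L # L' # Ls) = max (length (snd L)) (net_width (L' # Ls))"
  by (simp add: net_width_def)

lemma net_depth_Cons: "net_depth (L # L' # Ls) = Suc (net_depth (L' # Ls))"
  by (simp add: net_depth_def)

text \<open>The width is an upper bound but the depth is exact, and \<open>F\<close> matters only on
  inputs of length n. Networks grow at the input side: \<open>F\<close> is the part that comes after
  the layer being added.\<close>

definition net_fun :: "nat \<Rightarrow> nat \<Rightarrow> nat \<Rightarrow> nat \<Rightarrow> (real list \<Rightarrow> real list) \<Rightarrow> bool" where
  "net_fun n q w d F \<longleftrightarrow> (\<exists>Ls. valid_net n q Ls \<and> net_width Ls \<le> w \<and> net_depth Ls = d \<and>
     (\<forall>x. length x = n \<longrightarrow> realize Ls x = F x))"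

lemma net_fun_affine:
  assumes "\<forall>e\<in>set es. affine_form n e" "length es = q"
  shows "net_fun n q 0 0 (\<lambda>x. map (\<lambda>e. e x) es)"
proof -
  obtain L where "layer_ok n L" "length (snd L) = length es" "\<And>x. length x = n \<Longrightarrow> affine L x = map (\<lambda>e. e x) es"
    using layer_of_lin[OF assms(1)] by blast
  then show ?thesis unfolding net_fun_def
    by (intro exI[of _ "[L]"]) (use assms(2) in \<open>auto simp: valid_net_single net_width_def net_depth_def\<close>)
qed

text \<open>An affine map merges with the first layer, at no cost in depth or width.\<close>

lemma net_fun_affine_comp:
  assumes "net_fun m q w d F" "\<forall>e\<in>set es. affine_form n e" "length es = m"
  shows "net_fun n q w d (\<lambda>x. F (map (\<lambda>e. e x) es))"
proof -
  obtain Ls0 where Ls0: "valid_net m q Ls0" "net_width Ls0 \<le> w" "net_depth Ls0 = d" "\<And>x. length x = m \<Longrightarrow> realize Ls0 x = F x"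
    using assms(1) by (auto simp: net_fun_def)
  then obtain L Ls where Ls: "Ls0 = L # Ls" by (cases Ls0) (auto simp: valid_net_def)
  have okL: "layer_ok m L" using Ls0(1) unfolding Ls by (cases Ls) (auto simp: valid_net_single valid_net_Cons)
  define es' where "es' = map (\<lambda>j x. affine L (map (\<lambda>e. e x) es) ! j) [0..<length (snd L)]"
  have "\<forall>e\<in>set es'. affine_form n e"
  proof
    fix e assume "e \<in> set es'"
    then obtain j where j: "j < length (snd L)" "e = (\<lambda>x. affine L (map (\<lambda>e. e x) es) ! j)"
      by (auto simp: es'_def)
    show "affine_form n e" unfolding j(2)
      by (rule affine_form_compose[of es "\<lambda>x. affine L x ! j"]) (use affine_form_affine[OF okL j(1)] assms in auto)
  qed
  then obtain L' where L': "layer_ok n L'" "length (snd L') = length (snd L)"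
     "\<And>x. length x = n \<Longrightarrow> affine L' x = affine L (map (\<lambda>e. e x) es)"
  proof (rule layer_of_lin)
    fix L' assume *: "layer_ok n L'" "length (snd L') = length es'" "\<And>x. length x = n \<Longrightarrow> affine L' x = map (\<lambda>e. e x) es'"
    show thesis
    proof (rule that[OF *(1)])
      show "length (snd L') = length (snd L)" using *(2) by (simp add: es'_def)
      show "affine L' x = affine L (map (\<lambda>e. e x) es)" if "length x = n" for x
        unfolding *(3)[OF that] by (rule nth_equalityI) (auto simp: es'_def length_affine[OF okL])
    qed
  qed
  show ?thesis unfolding net_fun_def
  proof (intro exI[of _ "L' # Ls"] conjI allI impI)
    show "valid_net n q (L' # Ls)" using Ls0(1) L' unfolding Ls
      by (cases Ls) (auto simp: valid_net_single valid_net_Cons)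
    show "net_width (L' # Ls) \<le> w" using Ls0(2) L'(2) unfolding Ls
      by (cases Ls) (auto simp: net_width_Cons net_width_def)
    show "net_depth (L' # Ls) = d" using Ls0(3) unfolding Ls by (simp add: net_depth_def)
    fix x :: "real list" assume x: "length x = n"
    have "realize (L' # Ls) x = realize (L # Ls) (map (\<lambda>e. e x) es)"
      using L'(3)[OF x] by (cases Ls) auto
    then show "realize (L' # Ls) x = F (map (\<lambda>e. e x) es)"
      using Ls0(4)[of "map (\<lambda>e. e x) es"] assms(3) by (simp add: Ls)
  qed
qed

lemma net_fun_relu_comp:
  assumes "net_fun m q w d F" "\<forall>e\<in>set es. affine_form n e" "length es = m"
  shows "net_fun n q (max m w) (Suc d) (\<lambda>x. F (map (\<lambda>e. max 0 (e x)) es))"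
proof -
  obtain Ls0 where Ls0: "valid_net m q Ls0" "net_width Ls0 \<le> w" "net_depth Ls0 = d" "\<And>x. length x = m \<Longrightarrow> realize Ls0 x = F x"
    using assms(1) by (auto simp: net_fun_def)
  then obtain L' Ls where Ls: "Ls0 = L' # Ls" by (cases Ls0) (auto simp: valid_net_def)
  obtain L where L: "layer_ok n L" "length (snd L) = length es" "\<And>x. length x = n \<Longrightarrow> affine L x = map (\<lambda>e. e x) es"
    using layer_of_lin[OF assms(2)] by blast
  show ?thesis unfolding net_fun_def
  proof (intro exI[of _ "L # Ls0"] conjI allI impI)
    show "valid_net n q (L # Ls0)" using Ls0(1) L assms(3) by (simp add: Ls valid_net_Cons)
    show "net_width (L # Ls0) \<le> max m w" using Ls0(2) L assms(3) by (auto simp: Ls net_width_Cons)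
    show "net_depth (L # Ls0) = Suc d" using Ls0(3) by (simp add: Ls net_depth_Cons)
    fix x :: "real list" assume x: "length x = n"
    show "realize (L # Ls0) x = F (map (\<lambda>e. max 0 (e x)) es)"
      using Ls0(4)[of "map (\<lambda>e. max 0 (e x)) es"] L(3)[OF x] assms(3) by (simp add: Ls relu_vec_def comp_def)
  qed
qed

section \<open>One bisection step as two ReLU layers\<close>

definition soft :: "real \<Rightarrow> real \<Rightarrow> real" where
  "soft \<eta> z = max 0 (z / \<eta>) - max 0 (z / \<eta> - 1)"

text \<open>\<open>gate b d = b * d\<close> for \<open>b \<in> {0, 1}\<close> and \<open>|d| \<le> 2\<close>.\<close>

definition gate :: "real \<Rightarrow> real \<Rightarrow> real" where
  "gate b d = max 0 (d + 2 * (b - 1)) - max 0 (- d + 2 * (b - 1))"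

text \<open>In a state \<open>(q, s, c)\<close> of the bisection that has advanced by \<open>y\<close>, \<open>q\<close> is the initial \<open>q\<close> minus \<open>y\<close>, and \<open>(s, c)\<close>
  are sine and cosine of \<open>\<omega> + \<kappa> y\<close>. The trunk uses \<open>\<kappa> = 1\<close>, \<open>\<omega> = 0\<close> with test \<open>z - y + T sin y > 0\<close>, the shift
  \<open>\<kappa> = -1\<close>, \<open>\<omega> = \<xi>\<close> with test \<open>sin (\<xi> - y) > 0\<close>.\<close>

type_synonym state = "real \<times> real \<times> real"

text \<open>\<open>ds\<close> and \<open>dc\<close> are the changes of sine and cosine under
  rotation by \<kappa> h. The test is evaluated at the candidate h further on, and \<open>b\<close>
  decides between the candidate and the old state.\<close>

definition soft_step :: "real \<Rightarrow> real \<Rightarrow> real \<Rightarrow> real \<Rightarrow> real \<Rightarrow> state \<Rightarrow> state" where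
  "soft_step \<kappa> \<alpha> \<theta> h \<eta> = (\<lambda>(q, s, c).
     let ds = s * (cos h - 1) + \<kappa> * c * sin h; dc = c * (cos h - 1) - \<kappa> * s * sin h;
         b = soft \<eta> (\<alpha> * (q - h) + \<theta> * (s + ds))
     in (q - h * b, s + gate b ds, c + gate b dc))"

text \<open>The steps pi, pi/2, pi/4, ... halve a search interval of initial length 2 pi.\<close>

fun soft_run :: "real \<Rightarrow> real \<Rightarrow> real \<Rightarrow> real \<Rightarrow> nat \<Rightarrow> state \<Rightarrow> state" where
  "soft_run \<kappa> \<alpha> \<theta> \<eta> 0 p = p"
| "soft_run \<kappa> \<alpha> \<theta> \<eta> (Suc n) p = soft_step \<kappa> \<alpha> \<theta> (pi / 2 ^ n) \<eta> (soft_run \<kappa> \<alpha> \<theta> \<eta> n p)"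

definition list_of_state :: "state \<Rightarrow> real list" where "list_of_state = (\<lambda>(q, s, c). [q, s, c])"
definition state_of_list :: "real list \<Rightarrow> state" where "state_of_list x = (x ! 0, x ! 1, x ! 2)"

lemma state_of_list_of_state [simp]: "state_of_list (list_of_state p) = p"
  by (cases p) (simp add: state_of_list_def list_of_state_def)

lemma length_list_of_state [simp]: "length (list_of_state p) = 3"
  by (cases p) (simp add: list_of_state_def)

text \<open>A signed value crosses a ReLU layer as the pair of its positive and negative
  parts.\<close>

lemma relu_diff: "max 0 a - max 0 (- a) = (a::real)" by simp

lemma soft_nonneg: "\<eta> > 0 \<Longrightarrow> soft \<eta> z \<ge> 0"
  by (simp add: soft_def max_def)

text \<open>The first hidden layer has 8 units: three signed values as pairs and the two units of
  \<open>soft\<close>. The second has 11: the three pairs again, one unit for \<open>b\<close>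
  (which is nonnegative) and two for each \<open>gate\<close>. The output \<open>es3\<close> is
  affine and merges with what follows.\<close>

lemma net_fun_soft_step:
  assumes F: "net_fun 3 q w d F" and \<eta>: "\<eta> > 0"
  shows "net_fun 3 q (max 11 w) (d + 2) (\<lambda>x. F (list_of_state (soft_step \<kappa> \<alpha> \<theta> h \<eta> (state_of_list x))))"
proof -
  let ?ds = "\<lambda>s c. s * (cos h - 1) + c * (\<kappa> * sin h)"
  let ?dc = "\<lambda>s c. c * (cos h - 1) - s * (\<kappa> * sin h)"
  let ?P = "\<lambda>x. \<alpha> * (x ! 0 - h) + \<theta> * (x ! 1 + ?ds (x ! 1) (x ! 2))"
  define es1 :: "(real list \<Rightarrow> real) list" where
    "es1 = [\<lambda>x. x ! 0, \<lambda>x. - (x ! 0), \<lambda>x. x ! 1, \<lambda>x. - (x ! 1), \<lambda>x. x ! 2, \<lambda>x. - (x ! 2),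
       \<lambda>x. ?P x / \<eta>, \<lambda>x. ?P x / \<eta> - 1]"
  let ?S = "\<lambda>x. x ! 2 - x ! 3" and ?C = "\<lambda>x. x ! 4 - x ! 5" and ?B = "\<lambda>x. x ! 6 - x ! 7"
  define es2 :: "(real list \<Rightarrow> real) list" where
    "es2 = [\<lambda>x. x ! 0 - x ! 1, \<lambda>x. - (x ! 0 - x ! 1), \<lambda>x. ?S x, \<lambda>x. - ?S x, \<lambda>x. ?C x, \<lambda>x. - ?C x, \<lambda>x. ?B x,
       \<lambda>x. ?ds (?S x) (?C x) + 2 * (?B x - 1), \<lambda>x. - ?ds (?S x) (?C x) + 2 * (?B x - 1),
       \<lambda>x. ?dc (?S x) (?C x) + 2 * (?B x - 1), \<lambda>x. - ?dc (?S x) (?C x) + 2 * (?B x - 1)]"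
  define es3 :: "(real list \<Rightarrow> real) list" where
    "es3 = [\<lambda>x. x ! 0 - x ! 1 - h * x ! 6, \<lambda>x. x ! 2 - x ! 3 + (x ! 7 - x ! 8), \<lambda>x. x ! 4 - x ! 5 + (x ! 9 - x ! 10)]"
  have lin: "\<forall>e\<in>set es1. affine_form 3 e" "\<forall>e\<in>set es2. affine_form 8 e" "\<forall>e\<in>set es3. affine_form 11 e"
    unfolding es1_def es2_def es3_def by (auto simp del: minus_diff_eq minus_add_distrib)
  have "net_fun 11 q w d (\<lambda>x. F (map (\<lambda>e. e x) es3))"
    by (rule net_fun_affine_comp[OF F lin(3)]) (simp add: es3_def)
  from net_fun_relu_comp[OF this lin(2)]
  have "net_fun 8 q (max 11 w) (Suc d) (\<lambda>x. F (map (\<lambda>e. e (map (\<lambda>e. max 0 (e x)) es2)) es3))"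
    by (simp add: es2_def)
  from net_fun_relu_comp[OF this lin(1)]
  have *: "net_fun 3 q (max 8 (max 11 w)) (Suc (Suc d)) (\<lambda>x. F (map (\<lambda>e. e (map (\<lambda>e. max 0 (e (map (\<lambda>e. max 0 (e x)) es1))) es2)) es3))"
    by (simp add: es1_def)
  have "map (\<lambda>e. e (map (\<lambda>e. max 0 (e (map (\<lambda>e. max 0 (e x)) es1))) es2)) es3 = list_of_state (soft_step \<kappa> \<alpha> \<theta> h \<eta> (state_of_list x))" for x
  proof -
    obtain q s c where x: "state_of_list x = (q, s, c)" by (cases "state_of_list x")
    have 1: "map (\<lambda>e. max 0 (e x)) es1 = [max 0 q, max 0 (- q), max 0 s, max 0 (- s), max 0 c, max 0 (- c),
         max 0 ((\<alpha> * (q - h) + \<theta> * (s + ?ds s c)) / \<eta>), max 0 ((\<alpha> * (q - h) + \<theta> * (s + ?ds s c)) / \<eta> - 1)]" (is "_ = ?l1")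
      using x by (simp add: es1_def state_of_list_def)
    define b where "b = soft \<eta> (\<alpha> * (q - h) + \<theta> * (s + ?ds s c))"
    have 2: "map (\<lambda>e. max 0 (e [a0, a1, a2, a3, a4, a5, a6, a7])) es2
       = [max 0 q, max 0 (- q), max 0 s, max 0 (- s), max 0 c, max 0 (- c), max 0 b,
       max 0 (?ds s c + 2 * (b - 1)), max 0 (- ?ds s c + 2 * (b - 1)), max 0 (?dc s c + 2 * (b - 1)), max 0 (- ?dc s c + 2 * (b - 1))]"
      if "a0 - a1 = q" "a2 - a3 = s" "a4 - a5 = c" "a6 - a7 = b" for a0 a1 a2 a3 a4 a5 a6 a7
      unfolding that[symmetric] by (simp add: es2_def)
    have 2: "map (\<lambda>e. max 0 (e ?l1)) es2 = [max 0 q, max 0 (- q), max 0 s, max 0 (- s), max 0 c, max 0 (- c), max 0 b,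
       max 0 (?ds s c + 2 * (b - 1)), max 0 (- ?ds s c + 2 * (b - 1)), max 0 (?dc s c + 2 * (b - 1)), max 0 (- ?dc s c + 2 * (b - 1))]" (is "_ = ?l2")
      by (rule 2) (auto simp: max_def b_def soft_def)
    have b: "max 0 b = b" using soft_nonneg[OF \<eta>] by (simp add: b_def)
    have 3: "map (\<lambda>e. e ?l2) es3 = [q - h * b, s + gate b (?ds s c), c + gate b (?dc s c)]"
      by (simp add: es3_def b gate_def relu_diff)
    show ?thesis
      unfolding 1 2 3 x by (simp add: soft_step_def list_of_state_def Let_def b_def mult_ac)
  qed
  with * show ?thesis by simp
qed

lemma net_fun_cong:
  assumes "net_fun n q w d F" "\<And>x. length x = n \<Longrightarrow> F x = G x" "w \<le> w'"
  shows "net_fun n q w' d G"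
  using assms unfolding net_fun_def by (metis order_trans)

lemma list_of_state_of_list: "length x = 3 \<Longrightarrow> list_of_state (state_of_list x) = x"
  by (auto simp: list_of_state_def state_of_list_def numeral_3_eq_3 numeral_2_eq_2 length_Suc_conv)

text \<open>The induction hands the last step over to the part after it, hence the generalisation
  over \<open>F\<close>, \<open>w\<close> and \<open>d\<close>.\<close>

lemma net_fun_soft_run:
  assumes "net_fun 3 q w d F" "\<eta> > 0"
  shows "net_fun 3 q (max 11 w) (d + 2 * n) (\<lambda>x. F (list_of_state (soft_run \<kappa> \<alpha> \<theta> \<eta> n (state_of_list x))))"
  using assms(1)
proof (induction n arbitrary: F w d)
  case 0
  then show ?case by (auto intro: net_fun_cong simp: list_of_state_of_list)
next
  case (Suc n)
  from Suc.IH[OF net_fun_soft_step[OF Suc.prems assms(2), of \<kappa> \<alpha> \<theta> "pi / 2 ^ n"]]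
  show ?case by simp
qed

lemma net_fun_shift:
  assumes "\<eta> > 0"
  shows "net_fun 3 1 11 (2 * n) (\<lambda>e. [fst (soft_run (-1) 0 1 \<eta> n (0, e ! 0, e ! 1))])"
proof -
  have "net_fun 3 1 0 0 (\<lambda>x. map (\<lambda>e. e x) [\<lambda>x. x ! 0])"
    by (rule net_fun_affine) auto
  then have "net_fun 3 1 0 0 (\<lambda>x. [x ! 0])" by simp
  from net_fun_soft_run[OF this assms, of n "-1" 0 1]
  have "net_fun 3 1 11 (2 * n) (\<lambda>x. [list_of_state (soft_run (-1) 0 1 \<eta> n (state_of_list x)) ! 0])" by simp
  from net_fun_affine_comp[OF this]
  have "net_fun 3 1 11 (2 * n) (\<lambda>e. [list_of_state (soft_run (-1) 0 1 \<eta> n (state_of_list (map (\<lambda>f. f e) [\<lambda>_. 0, \<lambda>x. x ! 0, \<lambda>x. x ! 1]))) ! 0])"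
    by this auto
  then show ?thesis by (simp add: state_of_list_def list_of_state_def case_prod_beta)
qed

text \<open>The initial value moves z \<le> 0 up by one period, up to the ramp of
  \<open>soft\<close>. The final expression is - s clipped to [-1, 1]: inside the ramps the pair
  need not stay on the unit circle, and clipping keeps the output bounded for dominated
  convergence.\<close>

definition soft_trunk :: "real \<Rightarrow> real \<Rightarrow> nat \<Rightarrow> real \<Rightarrow> real" where
  "soft_trunk T \<eta> n z = (let s = fst (snd (soft_run 1 1 T \<eta> n (z + 2 * pi - 2 * pi * soft \<eta> z, 0, 1)))
     in max 0 (1 - s) - max 0 (- 1 - s) - 1)"

text \<open>Beyond the 2 n layers of the search, one hidden layer wraps z into the period and one
  clips the output.\<close>

lemma net_fun_trunk:
  assumes "\<eta> > 0"
  shows "net_fun 1 1 11 (2 * n + 2) (\<lambda>z. [soft_trunk T \<eta> n (z ! 0)])"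
proof -
  let ?clip = "\<lambda>s. max 0 (1 - s) - max 0 (- 1 - s) - 1 :: real"
  let ?s = "\<lambda>p. fst (snd (soft_run 1 1 T \<eta> n p))"
  have "net_fun 2 1 0 0 (\<lambda>x. map (\<lambda>e. e x) [\<lambda>x. x ! 0 - x ! 1 - 1])"
    by (rule net_fun_affine) auto
  then have out: "net_fun 2 1 0 0 (\<lambda>x. [x ! 0 - x ! 1 - 1])" by simp
  have lin: "\<forall>e\<in>set [\<lambda>x. 1 - x ! 1, \<lambda>x. - 1 - x ! 1]. affine_form 3 e" by auto
  from net_fun_relu_comp[OF out lin] have "net_fun 3 1 2 1 (\<lambda>x. [?clip (x ! 1)])" by simp
  from net_fun_soft_run[OF this assms, of n 1 1 T]
  have run: "net_fun 3 1 11 (2 * n + 1) (\<lambda>x. [?clip (?s (state_of_list x))])" by (simp add: list_of_state_def case_prod_beta)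
  have lin: "\<forall>e\<in>set [\<lambda>x. x ! 0 - x ! 1 + 2 * pi - 2 * pi * (x ! 2 - x ! 3), \<lambda>_. 0, \<lambda>_. 1]. affine_form 4 e" by auto
  from net_fun_affine_comp[OF run lin]
  have run: "net_fun 4 1 11 (2 * n + 1) (\<lambda>x. [?clip (?s (x ! 0 - x ! 1 + 2 * pi - 2 * pi * (x ! 2 - x ! 3), 0, 1))])"
    by (simp add: state_of_list_def)
  have lin: "\<forall>e\<in>set [\<lambda>z. z ! 0, \<lambda>z. - (z ! 0), \<lambda>z. z ! 0 / \<eta>, \<lambda>z. z ! 0 / \<eta> - 1]. affine_form 1 e" by auto
  from net_fun_relu_comp[OF run lin]
  have "net_fun 1 1 11 (2 * n + 2) (\<lambda>z. [?clip (?s (max 0 (z ! 0) - max 0 (- (z ! 0)) + 2 * pi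
     - 2 * pi * (max 0 (z ! 0 / \<eta>) - max 0 (z ! 0 / \<eta> - 1)), 0, 1))])"
    by simp
  then show ?thesis by (simp add: relu_diff soft_trunk_def Let_def soft_def)
qed

lemma net_fun_one: "net_fun 3 1 0 0 (\<lambda>_. [1])"
  using net_fun_affine[of "[\<lambda>_. 1]" 3 1] by auto

lemma sdon_exists:
  fixes T \<eta> :: real and n :: nat
  assumes "\<eta> > 0"
  obtains xs br tr sc sh where "length xs = 3" "is_sdon xs 1 br tr sc sh"
    "sdon_width br tr sc sh \<le> 22" "sdon_depth br tr sc sh = 2 * n + 2"
    "\<And>\<xi> x. sdon_eval xs 1 br tr sc sh (\<lambda>x. - sin (x - \<xi>)) x
       = soft_trunk T \<eta> n (x + fst (soft_run (-1) 0 1 \<eta> n (0, sin \<xi>, cos \<xi>)))"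
proof -
  obtain br where br: "valid_net 3 1 br" "net_width br = 0" "net_depth br = 0" "\<And>x. length x = 3 \<Longrightarrow> realize br x = [1]"
    using net_fun_one by (auto simp: net_fun_def)
  obtain sh where sh: "valid_net 3 1 sh" "net_width sh \<le> 11" "net_depth sh = 2 * n"
     "\<And>e. length e = 3 \<Longrightarrow> realize sh e = [fst (soft_run (-1) 0 1 \<eta> n (0, e ! 0, e ! 1))]"
    using net_fun_shift[OF assms] by (auto simp: net_fun_def)
  obtain tr where tr: "valid_net 1 1 tr" "net_width tr \<le> 11" "net_depth tr = 2 * n + 2"
     "\<And>z. length z = 1 \<Longrightarrow> realize tr z = [soft_trunk T \<eta> n (z ! 0)]"
    using net_fun_trunk[OF assms] unfolding net_fun_def by blast
  show thesis
  \<comment> \<open>At 0 and 3 pi / 2 the function - sin (x - \<xi>) takes the values sin \<xi> and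
    cos \<xi>, the initial pair of the shift search. The constant network 1 is both branch and
    scale.\<close>
  proof (rule that[of "[0, 3 * pi / 2, pi]" br tr br sh])
    fix \<xi> x
    have "sin (3 * pi / 2 - \<xi>) = - cos \<xi>"
      using sin_diff[of "3 * pi / 2" \<xi>] sin_3over2_pi cos_3over2_pi by (simp add: mult.commute)
    then show "sdon_eval [0, 3 * pi / 2, pi] 1 br tr br sh (\<lambda>x. - sin (x - \<xi>)) x
       = soft_trunk T \<eta> n (x + fst (soft_run (-1) 0 1 \<eta> n (0, sin \<xi>, cos \<xi>)))"
      by (simp add: sdon_eval_def Let_def br(4) sh(4) tr(4))
  qed (use br sh tr in \<open>auto simp: is_sdon_def sdon_width_def sdon_depth_def numeral_3_eq_3\<close>)
qed

section \<open>Bisection with the exact threshold\<close>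

definition hard_step :: "real \<Rightarrow> real \<Rightarrow> real \<Rightarrow> real \<Rightarrow> state \<Rightarrow> state" where
  "hard_step \<kappa> \<alpha> \<theta> h = (\<lambda>(q, s, c).
     let ds = s * (cos h - 1) + \<kappa> * c * sin h; dc = c * (cos h - 1) - \<kappa> * s * sin h
     in if \<alpha> * (q - h) + \<theta> * (s + ds) > 0 then (q - h, s + ds, c + dc) else (q, s, c))"

fun hard_run :: "real \<Rightarrow> real \<Rightarrow> real \<Rightarrow> nat \<Rightarrow> state \<Rightarrow> state" where
  "hard_run \<kappa> \<alpha> \<theta> 0 p = p"
| "hard_run \<kappa> \<alpha> \<theta> (Suc n) p = hard_step \<kappa> \<alpha> \<theta> (pi / 2 ^ n) (hard_run \<kappa> \<alpha> \<theta> n p)"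

lemma rot_step:
  fixes \<kappa> :: real
  assumes "\<kappa> = 1 \<or> \<kappa> = -1"
  shows "sin p + (sin p * (cos h - 1) + \<kappa> * cos p * sin h) = sin (p + \<kappa> * h)"
        "cos p + (cos p * (cos h - 1) - \<kappa> * sin p * sin h) = cos (p + \<kappa> * h)"
  using assms by (auto simp: sin_add cos_add sin_diff cos_diff algebra_simps)

text \<open>The test \<open>P\<close> has to be correct only for \<open>d\<close> within \<open>m\<close> of \<open>y\<close>: the sine test of the shift is wrong further away.\<close>

definition bsearch :: "real \<Rightarrow> real \<Rightarrow> (real \<Rightarrow> real) \<Rightarrow> bool" where
  "bsearch y m P \<longleftrightarrow> 0 \<le> y \<and> y < 2 * m \<and>
     (\<forall>d. 0 < d \<longrightarrow> d < 2 * m \<longrightarrow> d - y \<le> m \<longrightarrow> y - d < m \<longrightarrow> (P d > 0 \<longrightarrow> d \<le> y) \<and> (P d \<le> 0 \<longrightarrow> y \<le> d))"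

text \<open>The offset \<open>y'\<close> of the state is the partial binary expansion of the sign change \<open>y\<close>
  of \<open>d \<mapsto> \<alpha> (q - d) + \<theta> sin (\<omega> + \<kappa> d)\<close>.\<close>

lemma hard_run_search:
  assumes \<kappa>: "\<kappa> = 1 \<or> \<kappa> = -1" and y: "bsearch y pi (\<lambda>d. \<alpha> * (q - d) + \<theta> * sin (\<omega> + \<kappa> * d))"
  shows "\<exists>y'. hard_run \<kappa> \<alpha> \<theta> n (q, sin \<omega>, cos \<omega>) = (q - y', sin (\<omega> + \<kappa> * y'), cos (\<omega> + \<kappa> * y'))
     \<and> 0 \<le> y' \<and> y' \<le> y \<and> y \<le> y' + 2 * pi / 2 ^ n \<and> y' + 2 * pi / 2 ^ n \<le> 2 * pi"
proof (induction n)
  case 0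
  then show ?case using y by (intro exI[of _ 0]) (auto simp: bsearch_def)
next
  case (Suc n)
  then obtain y' where y': "hard_run \<kappa> \<alpha> \<theta> n (q, sin \<omega>, cos \<omega>) = (q - y', sin (\<omega> + \<kappa> * y'), cos (\<omega> + \<kappa> * y'))"
     "0 \<le> y'" "y' \<le> y" "y \<le> y' + 2 * pi / 2 ^ n" "y' + 2 * pi / 2 ^ n \<le> 2 * pi" by blast
  define h where "h = pi / 2 ^ n"
  have h: "h > 0" "2 * pi / 2 ^ n = 2 * h" "2 * pi / 2 ^ Suc n = h" "h \<le> pi"
    by (auto simp: h_def divide_le_eq)
  have ang: "\<omega> + \<kappa> * y' + \<kappa> * h = \<omega> + \<kappa> * (y' + h)" by (simp add: algebra_simps)
  have run: "hard_run \<kappa> \<alpha> \<theta> (Suc n) (q, sin \<omega>, cos \<omega>) =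
     (if \<alpha> * (q - (y' + h)) + \<theta> * sin (\<omega> + \<kappa> * (y' + h)) > 0
      then (q - (y' + h), sin (\<omega> + \<kappa> * (y' + h)), cos (\<omega> + \<kappa> * (y' + h)))
      else (q - y', sin (\<omega> + \<kappa> * y'), cos (\<omega> + \<kappa> * y')))"
    unfolding hard_run.simps y'(1) h_def[symmetric] hard_step_def
    by (simp only: prod.case Let_def rot_step[OF \<kappa>] ang) (simp add: algebra_simps)
  have y2: "y < 2 * pi" using y by (simp add: bsearch_def)
  have y'h: "y \<le> y' + 2 * h" "y' + 2 * h \<le> 2 * pi" using y'(4,5) unfolding h(2) by auto
  have s: "0 < y' + h" "y' + h < 2 * pi" "(y' + h) - y \<le> pi" "y - (y' + h) < pi"
  proof -
    show "0 < y' + h" "y' + h < 2 * pi" "(y' + h) - y \<le> pi" using y' y'h h by linarith+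
    \<comment> \<open>For h < pi the distance is at most h. For the first midpoint, h = pi,
      strictness comes from y < 2 pi.\<close>
    show "y - (y' + h) < pi" using y'(2) y'h h(1,4) y2 by (cases "h = pi") linarith+
  qed
  have "(\<alpha> * (q - (y' + h)) + \<theta> * sin (\<omega> + \<kappa> * (y' + h)) > 0 \<longrightarrow> y' + h \<le> y) \<and>
        (\<alpha> * (q - (y' + h)) + \<theta> * sin (\<omega> + \<kappa> * (y' + h)) \<le> 0 \<longrightarrow> y \<le> y' + h)"
    using y s unfolding bsearch_def by blast
  then show ?case
    unfolding run h(3) using y' y'h h
    by (cases "\<alpha> * (q - (y' + h)) + \<theta> * sin (\<omega> + \<kappa> * (y' + h)) > 0")
       (auto intro: exI[of _ "y' + h"] exI[of _ y'])
qed

text \<open>For z > 0 the ramp is saturated once its width is below z; for z \<le> 0 it is always 0.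
  The value 0 at z = 0 agrees with the strict tests of the exact search, so the limit is attained at
  every input without exception.\<close>

lemma soft_eventually: "\<forall>\<^sub>F k in sequentially. soft (1 / real (Suc k)) z = (if z > 0 then 1 else 0)"
proof (cases "z > 0")
  case True
  obtain N :: nat where "1 / z < real N" using reals_Archimedean2 by blast
  then have "1 \<le> z * real (Suc k)" if "k \<ge> N" for k
  proof -
    have "1 / z \<le> real (Suc k)" using \<open>1 / z < real N\<close> that by linarith
    then show ?thesis using True by (simp add: field_simps)
  qed
  then have "\<forall>\<^sub>F k in sequentially. 1 \<le> z * real (Suc k)" unfolding eventually_sequentially by blast
  then show ?thesis by eventually_elim (use True in \<open>auto simp: soft_def max_def\<close>)
next
  case False
  have "z * real (Suc k) \<le> 0" for k using False by (simp add: mult_nonpos_nonneg)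
  then have "max 0 (z * real (Suc k)) = 0" "max 0 (z * real (Suc k) - 1) = 0" for k
    by (simp_all add: max_absorb1 order_trans[of _ 0 1] del: of_nat_Suc)
  then have "soft (1 / real (Suc k)) z = 0" for k by (simp add: soft_def del: of_nat_Suc)
  then show ?thesis using False by simp
qed

lemma gate_exact: "\<bar>d\<bar> \<le> 2 \<Longrightarrow> gate 1 d = d \<and> gate 0 d = 0"
  by (auto simp: gate_def)

lemma sin_cos_diff_le_2: "\<bar>sin a - sin b\<bar> \<le> 2" "\<bar>cos a - cos b\<bar> \<le> 2" for a b :: real
  using abs_sin_le_one[of a] abs_sin_le_one[of b] abs_cos_le_one[of a] abs_cos_le_one[of b] by linarith+

lemma soft_step_eventually:
  assumes \<kappa>: "\<kappa> = 1 \<or> \<kappa> = -1"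
  shows "\<forall>\<^sub>F k in sequentially. soft_step \<kappa> \<alpha> \<theta> h (1 / real (Suc k)) (q, sin p, cos p) = hard_step \<kappa> \<alpha> \<theta> h (q, sin p, cos p)"
proof -
  define ds where "ds = sin p * (cos h - 1) + \<kappa> * cos p * sin h"
  define dc where "dc = cos p * (cos h - 1) - \<kappa> * sin p * sin h"
  have "ds = sin (p + \<kappa> * h) - sin p" "dc = cos (p + \<kappa> * h) - cos p"
    using rot_step[OF \<kappa>, of p h] by (auto simp: ds_def dc_def algebra_simps)
  then have "\<bar>ds\<bar> \<le> 2" "\<bar>dc\<bar> \<le> 2"
    using sin_cos_diff_le_2 by auto
  note g = gate_exact[OF this(1)] gate_exact[OF this(2)]
  from soft_eventually[of "\<alpha> * (q - h) + \<theta> * (sin p + ds)"]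
  show ?thesis
    by eventually_elim (simp add: soft_step_def hard_step_def Let_def ds_def[symmetric] dc_def[symmetric] g)
qed

text \<open>The first conjunct keeps the exact run on the unit circle, where increments are at most
  2 and \<open>gate\<close> is exact. Since the runs eventually coincide, and are not merely close,
  the discontinuous test of the next step does no harm.\<close>

lemma soft_run_eventually:
  assumes \<kappa>: "\<kappa> = 1 \<or> \<kappa> = -1"
  shows "(\<exists>q' p'. hard_run \<kappa> \<alpha> \<theta> n (q, sin p, cos p) = (q', sin p', cos p')) \<and>
    (\<forall>\<^sub>F k in sequentially. soft_run \<kappa> \<alpha> \<theta> (1 / real (Suc k)) n (q, sin p, cos p) = hard_run \<kappa> \<alpha> \<theta> n (q, sin p, cos p))"
proof (induction n)
  case 0
  then show ?case by auto
next
  case (Suc n)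
  then obtain q' p' where run: "hard_run \<kappa> \<alpha> \<theta> n (q, sin p, cos p) = (q', sin p', cos p')" by blast
  have "\<forall>\<^sub>F k in sequentially. soft_run \<kappa> \<alpha> \<theta> (1 / real (Suc k)) (Suc n) (q, sin p, cos p) = hard_run \<kappa> \<alpha> \<theta> (Suc n) (q, sin p, cos p)"
    using conjunct2[OF Suc] soft_step_eventually[OF \<kappa>, of \<alpha> \<theta> "pi / 2 ^ n" q' p']
    by eventually_elim (simp add: run)
  moreover have "\<exists>q' p'. hard_run \<kappa> \<alpha> \<theta> (Suc n) (q, sin p, cos p) = (q', sin p', cos p')"
    unfolding hard_run.simps run hard_step_def prod.case Let_def rot_step[OF \<kappa>] by (auto split: if_splits)
  ultimately show ?case by blast
qed

text \<open>sin d = 2 sin (d/2) cos (d/2) is at least d cos (d/2)^2 by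
  \<open>mult_cos_less_sin\<close>, and cos (d/2)^2 \<ge> 1/2 because cos d \<ge> 0.\<close>

lemma sin_ge_half:
  fixes d :: real
  assumes "0 \<le> d" "d \<le> pi / 2"
  shows "d / 2 \<le> sin d"
proof (cases "d = 0")
  case False
  have "cos (d / 2) > 0" by (rule cos_gt_zero_pi) (use assms pi_gt3 in linarith)+
  have "d / 2 * 1 \<le> d * (cos (d / 2))\<^sup>2"
  proof -
    have "cos d \<ge> 0" using assms by (intro cos_ge_zero) auto
    then have "1 / 2 \<le> (cos (d / 2))\<^sup>2" using cos_double_cos[of "d / 2"] by simp
    then have "d * (1 / 2) \<le> d * (cos (d / 2))\<^sup>2" using assms by (intro mult_left_mono) auto
    then show ?thesis by simp
  qed
  also have "\<dots> = 2 * (d / 2 * cos (d / 2)) * cos (d / 2)" by (simp add: power2_eq_square)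
  also have "\<dots> \<le> 2 * sin (d / 2) * cos (d / 2)"
    using mult_cos_less_sin[of "d / 2"] assms False \<open>cos (d / 2) > 0\<close> by (intro mult_right_mono mult_left_mono) auto
  also have "\<dots> = sin d" using sin_double[of "d / 2"] by simp
  finally show ?thesis by simp
qed simp

section \<open>Kepler's equation y - T sin y = z for T > pi\<close>

context
  fixes T :: real
  assumes T: "T > pi"
begin

text \<open>Follows from T > 2 and sin d \<ge> d / 2.\<close>

lemma kepler_left: "0 < d \<Longrightarrow> d \<le> pi / 2 \<Longrightarrow> d - T * sin d < 0"
proof -
  assume d: "0 < d" "d \<le> pi / 2"
  have "d = 2 * (d / 2)" by simp
  also have "\<dots> < T * (d / 2)" using d T pi_gt3 by (intro mult_strict_right_mono) auto
  also have "\<dots> \<le> T * sin d" using d T pi_gt3 by (intro mult_left_mono sin_ge_half) auto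
  finally show ?thesis by simp
qed

lemma kepler_right: "3 * pi / 2 \<le> d \<Longrightarrow> d < 2 * pi \<Longrightarrow> d - T * sin d > 2 * pi"
  using kepler_left[of "2 * pi - d"] by (simp add: sin_diff)

text \<open>On [pi/2, 3 pi/2] the sine decreases, so - T sin y only adds to the growth of y.\<close>

lemma kepler_expand:
  assumes "pi / 2 \<le> a" "a \<le> b" "b \<le> 3 * pi / 2"
  shows "b - a \<le> (b - T * sin b) - (a - T * sin a)"
proof -
  have "cos (b - pi / 2) \<le> cos (a - pi / 2)" using assms by (intro cos_monotone_0_pi_le) auto
  then have "sin b \<le> sin a" by (simp add: cos_diff)
  then have "T * sin b \<le> T * sin a" using T pi_gt3 by (intro mult_left_mono) auto
  then show ?thesis by simp
qed

lemma kepler_lipschitz: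
  assumes "a \<in> {pi/2..3*pi/2}" "b \<in> {pi/2..3*pi/2}"
  shows "\<bar>a - b\<bar> \<le> \<bar>(a - T * sin a) - (b - T * sin b)\<bar>"
  using kepler_expand[of a b] kepler_expand[of b a] assms by (cases "a \<le> b") auto

lemma kepler_root:
  assumes "z \<in> {0..2*pi}"
  obtains y where "y \<in> {pi/2..3*pi/2}" "y - T * sin y = z"
proof -
  have s: "sin (3 * pi / 2) = -1" using sin_3over2_pi by (simp add: mult.commute)
  have "\<exists>y\<ge>pi/2. y \<le> 3*pi/2 \<and> y - T * sin y = z"
    by (rule IVT'[of "\<lambda>y. y - T * sin y"]) (use assms T pi_gt3 s in \<open>auto intro!: continuous_intros\<close>)
  then show thesis using that by auto
qed

text \<open>Identifies the foot supplied by the entropy solution, known only to lie in the period,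
  with the root that the trunk finds. The values 0 and 2 pi are excluded because there y = z is a
  further root.\<close>

lemma kepler_root_unique:
  assumes "0 < z" "z < 2 * pi" "y \<in> {0..2*pi}" "y - T * sin y = z"
  shows "y \<in> {pi/2..3*pi/2}"
proof -
  have "y \<noteq> 0" "y \<noteq> 2 * pi" using assms by auto
  then have "0 < y" "y < 2 * pi" using assms by auto
  then show ?thesis using kepler_left[of y] kepler_right[of y] assms by force
qed

text \<open>Outside [pi/2, 3 pi/2] the values of y - T sin y leave [0, 2 pi] on the correct side, so
  despite the lack of monotonicity the test is right at every d in (0, 2 pi).\<close>

lemma kepler_bsearch:
  assumes z: "z \<in> {0..2*pi}" and y: "y \<in> {pi/2..3*pi/2}" "y - T * sin y = z"
  shows "bsearch y pi (\<lambda>d. 1 * (z - d) + T * sin (0 + 1 * d))"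
  unfolding bsearch_def
proof (intro conjI allI impI)
  show "0 \<le> y" "y < 2 * pi" using y pi_gt3 by auto
  fix d assume d: "0 < d" "d < 2 * pi"
  consider "d \<le> pi / 2" | "3 * pi / 2 \<le> d" | "d \<in> {pi/2..3*pi/2}" by force
  then have "(1 * (z - d) + T * sin (0 + 1 * d) > 0 \<longrightarrow> d \<le> y) \<and> (1 * (z - d) + T * sin (0 + 1 * d) \<le> 0 \<longrightarrow> y \<le> d)"
  proof cases
    case 1 then show ?thesis using kepler_left[of d] d z y by auto
  next
    case 2 then show ?thesis using kepler_right[of d] d z y by auto
  next
    case 3 then show ?thesis using kepler_expand[of d y] kepler_expand[of y d] y by force
  qed
  then show "1 * (z - d) + T * sin (0 + 1 * d) > 0 \<Longrightarrow> d \<le> y" "1 * (z - d) + T * sin (0 + 1 * d) \<le> 0 \<Longrightarrow> y \<le> d"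
    by blast+
qed

end

text \<open>sin (\<xi> - d) has the sign of \<xi> - d only up to distance pi. Its zero at d - \<xi>
  = pi still gives the right answer, the one at \<xi> - d = pi does not; hence the asymmetric bounds
  in \<open>bsearch\<close>.\<close>

lemma angle_bsearch:
  assumes "0 \<le> \<xi>" "\<xi> < 2 * pi"
  shows "bsearch \<xi> pi (\<lambda>d. 0 * (0 - d) + 1 * sin (\<xi> + - 1 * d))"
  unfolding bsearch_def
proof (intro conjI allI impI)
  fix d assume d: "0 < d" "d < 2 * pi" "d - \<xi> \<le> pi" "\<xi> - d < pi"
  show "d \<le> \<xi>" if "0 * (0 - d) + 1 * sin (\<xi> + - 1 * d) > 0"
  proof (rule ccontr)
    assume "\<not> d \<le> \<xi>"
    then have "sin (d - \<xi>) \<ge> 0" using d by (intro sin_ge_zero) auto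
    then show False using that sin_minus[of "d - \<xi>"] by simp
  qed
  show "\<xi> \<le> d" if "0 * (0 - d) + 1 * sin (\<xi> + - 1 * d) \<le> 0"
  proof (rule ccontr)
    assume "\<not> \<xi> \<le> d"
    then have "sin (\<xi> - d) > 0" using d by (intro sin_gt_zero) auto
    then show False using that by simp
  qed
qed (use assms in auto)

section \<open>Error of the network with exact tests\<close>

definition hard_trunk :: "real \<Rightarrow> nat \<Rightarrow> real \<Rightarrow> real" where
  "hard_trunk T n z = (let s = fst (snd (hard_run 1 1 T n (if z > 0 then z else z + 2 * pi, 0, 1)))
     in max 0 (1 - s) - max 0 (- 1 - s) - 1)"

definition hard_sdon :: "real \<Rightarrow> nat \<Rightarrow> real \<Rightarrow> real \<Rightarrow> real" where
  "hard_sdon T n \<xi> x = hard_trunk T n (x + fst (hard_run (-1) 0 1 n (0, sin \<xi>, cos \<xi>)))"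

definition soft_sdon :: "real \<Rightarrow> real \<Rightarrow> nat \<Rightarrow> real \<Rightarrow> real \<Rightarrow> real" where
  "soft_sdon T \<eta> n \<xi> x = soft_trunk T \<eta> n (x + fst (soft_run (-1) 0 1 \<eta> n (0, sin \<xi>, cos \<xi>)))"

text \<open>With H = 2 pi / 2^n, the shift is off by at most H, which moves the root by at most H,
  and the trunk search adds another H. Within H of the shock the two sides may be confused, and the
  error is only bounded by 2.\<close>

lemma hard_sdon_error:
  assumes T: "T > pi" and \<xi>: "0 \<le> \<xi>" "\<xi> < 2 * pi" and x: "0 \<le> x" "x < 2 * pi" and ne: "x \<noteq> \<xi>"
    and Y: "Y \<in> {0..2*pi}" "Y - T * sin Y = (if x > \<xi> then x - \<xi> else x - \<xi> + 2 * pi)"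
  shows "\<bar>- sin Y - hard_sdon T n \<xi> x\<bar> \<le> 2 * (2 * pi / 2 ^ n) + 2 * indicator {\<xi> - 2 * pi / 2 ^ n..\<xi> + 2 * pi / 2 ^ n} x"
proof -
  define H where "H = 2 * pi / 2 ^ n"
  have H: "H > 0" by (simp add: H_def)
  obtain y' where y': "hard_run (-1) 0 1 n (0, sin \<xi>, cos \<xi>) = (0 - y', sin (\<xi> + - 1 * y'), cos (\<xi> + - 1 * y'))"
    "0 \<le> y'" "y' \<le> \<xi>" "\<xi> \<le> y' + H"
    using hard_run_search[OF _ angle_bsearch[OF \<xi>], of n] unfolding H_def by blast
  define z where "z = x - y'"
  define z' where "z' = (if z > 0 then z else z + 2 * pi)"
  have z': "z' \<in> {0..2*pi}" using x y' \<xi> by (auto simp: z'_def z_def)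
  obtain Z where Z: "Z \<in> {pi/2..3*pi/2}" "Z - T * sin Z = z'" using kepler_root[OF T z'] by blast
  obtain r where r: "hard_run 1 1 T n (z', sin 0, cos 0) = (z' - r, sin (0 + 1 * r), cos (0 + 1 * r))" "r \<le> Z" "Z \<le> r + H"
    using hard_run_search[OF _ kepler_bsearch[OF T z' Z], of n] unfolding H_def by blast
  have "hard_sdon T n \<xi> x = max 0 (1 - sin r) - max 0 (- 1 - sin r) - 1"
    using r(1) by (simp add: hard_sdon_def hard_trunk_def y'(1) z_def[symmetric] z'_def[symmetric] Let_def)
  also have "\<dots> = - sin r" using sin_le_one[of r] sin_ge_minus_one[of r] by simp
  finally have N: "hard_sdon T n \<xi> x = - sin r" .
  show ?thesis
  proof (cases "\<bar>x - \<xi>\<bar> \<le> H")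
    case True
    then have "x \<in> {\<xi> - H..\<xi> + H}" by auto
    then show ?thesis unfolding N H_def[symmetric]
      using H sin_cos_diff_le_2(1)[of r Y] by simp
  next
    case False
    define w' where "w' = (if x > \<xi> then x - \<xi> else x - \<xi> + 2 * pi)"
    have w': "0 < w'" "w' < 2 * pi" using x \<xi> ne False H by (auto simp: w'_def)
    \<comment> \<open>As y' \<le> \<xi>, the wrapping decisions for x - y' and x - \<xi> differ only
      for y' < x \<le> \<xi>, that is within H of the shock.\<close>
    have zw: "\<bar>z' - w'\<bar> \<le> H" using False y' H by (auto simp: z'_def w'_def z_def abs_if split: if_splits)
    have "Y \<in> {pi/2..3*pi/2}" by (rule kepler_root_unique[OF T w' Y(1)]) (simp add: Y(2) w'_def)
    from kepler_lipschitz[OF T this Z(1)] have "\<bar>Y - Z\<bar> \<le> H" using zw Z(2) Y(2) by (simp add: w'_def abs_minus_commute)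
    then have "\<bar>Y - r\<bar> \<le> 2 * H" using r by linarith
    then have "\<bar>sin Y - sin r\<bar> \<le> 2 * H" using abs_sin_diff_le[of Y r] by linarith
    then show ?thesis unfolding N H_def[symmetric] using abs_minus_commute[of "sin Y"] by (simp add: indicator_def)
  qed
qed

lemma soft_sdon_eventually: "\<forall>\<^sub>F k in sequentially. soft_sdon T (1 / real (Suc k)) n \<xi> x = hard_sdon T n \<xi> x"
proof -
  define z where "z = x + fst (hard_run (-1) 0 1 n (0, sin \<xi>, cos \<xi>))"
  have "\<forall>\<^sub>F k in sequentially. soft_run (-1) 0 1 (1 / real (Suc k)) n (0, sin \<xi>, cos \<xi>) = hard_run (-1) 0 1 n (0, sin \<xi>, cos \<xi>)"
    using soft_run_eventually[of "-1"] by blast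
  moreover have "\<forall>\<^sub>F k in sequentially. soft (1 / real (Suc k)) z = (if z > 0 then 1 else 0)"
    by (rule soft_eventually)
  moreover have "\<forall>\<^sub>F k in sequentially. soft_run 1 1 T (1 / real (Suc k)) n (if z > 0 then z else z + 2 * pi, sin 0, cos 0)
      = hard_run 1 1 T n (if z > 0 then z else z + 2 * pi, sin 0, cos 0)"
    using soft_run_eventually[of 1] by blast
  ultimately show ?thesis
    by eventually_elim (auto simp: soft_sdon_def hard_sdon_def soft_trunk_def hard_trunk_def z_def Let_def)
qed

lemma soft_sdon_bound: "\<bar>soft_sdon T \<eta> n \<xi> x\<bar> \<le> 1" and hard_sdon_bound: "\<bar>hard_sdon T n \<xi> x\<bar> \<le> 1"
  by (auto simp: soft_sdon_def soft_trunk_def hard_sdon_def hard_trunk_def Let_def max_def)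

lemma continuous_on_soft_run:
  assumes "\<eta> > 0" "continuous_on S f"
  shows "continuous_on S (\<lambda>p. soft_run \<kappa> \<alpha> \<theta> \<eta> n (f p))"
proof (induction n)
  case (Suc n)
  show ?case
    unfolding soft_run.simps soft_step_def split_beta' Let_def soft_def gate_def
    by (intro continuous_intros Suc) (use assms in auto)
qed (use assms in simp)

lemma continuous_on_soft_sdon:
  assumes "\<eta> > 0"
  shows "continuous_on UNIV (\<lambda>p. soft_sdon T \<eta> n (fst p) (snd p))"
  unfolding soft_sdon_def soft_trunk_def Let_def soft_def
  by (intro continuous_intros continuous_on_soft_run) (use assms in auto)

lemma borel_measurable_soft_sdon:
  "\<eta> > 0 \<Longrightarrow> (\<lambda>p. soft_sdon T \<eta> n (fst p) (snd p)) \<in> borel_measurable borel"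
  by (intro borel_measurable_continuous_onI continuous_on_soft_sdon)

text \<open>Despite its jumps it is a pointwise limit of the continuous
  \<open>soft_sdon\<close>.\<close>

lemma borel_measurable_hard_sdon:
  "(\<lambda>p. hard_sdon T n (fst p) (snd p)) \<in> borel_measurable borel"
proof (rule borel_measurable_LIMSEQ_real)
  show "(\<lambda>p. soft_sdon T (1 / real (Suc k)) n (fst p) (snd p)) \<in> borel_measurable borel" for k
    by (rule borel_measurable_soft_sdon) simp
  show "(\<lambda>k. soft_sdon T (1 / real (Suc k)) n (fst p) (snd p)) \<longlonglongrightarrow> hard_sdon T n (fst p) (snd p)" for p
    by (rule tendsto_eventually) (rule soft_sdon_eventually)
qed

section \<open>Error of the network\<close>

lemma AE_lborel_shift:
  fixes a :: real
  assumes "AE x in lborel. P x"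
  shows "AE x in lborel. P (x + a)"
proof -
  have "AE x in distr lborel borel ((+) a). P x" using assms by (subst lborel_distr_plus)
  then have "AE x in lborel. P (a + x)" by (rule AE_distrD[rotated]) simp
  then show ?thesis by (simp add: add.commute)
qed

lemma entropy_solution_hard_sdon:
  assumes T: "T > pi" and \<xi>: "0 \<le> \<xi>" "\<xi> < 2 * pi" and ent: "entropy_solution (\<lambda>x. - sin (x - \<xi>)) u"
  shows "AE x in lborel. x \<in> {0..2*pi} \<longrightarrow> \<bar>u x T - hard_sdon T n \<xi> x\<bar>
     \<le> 2 * (2 * pi / 2 ^ n) + 2 * indicator {\<xi> - 2 * pi / 2 ^ n..\<xi> + 2 * pi / 2 ^ n} x"
proof -
  have T1: "T > 1" using T pi_gt3 by simp
  have late: "AE s in lborel. s \<in> {0..2*pi} \<longrightarrow> (\<exists>y\<in>{0..2*pi}. y - T * sin y = s \<and> u (s + \<xi>) T = - sin y)"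
    by (rule sine_entropy_solution_late[OF entropy_solution_translate[OF ent] T1]) (use \<xi> in auto)
  have per: "u (x + 2 * pi) T = u x T" for x
    using ent T1 by (simp add: entropy_solution_def)
  have "AE x in lborel. x \<noteq> \<xi>" "AE x in lborel. x \<noteq> 2 * pi" by (rule AE_lborel_singleton)+
  \<comment> \<open>The translated solution is read at x - \<xi> to the right of the shock and at x
    - \<xi> + 2 pi to its left, so the null set is translated in two ways.\<close>
  with AE_lborel_shift[OF late, of "- \<xi>"] AE_lborel_shift[OF late, of "2 * pi - \<xi>"]
  show ?thesis
  proof eventually_elim
    case (elim x)
    show ?case
    proof
      assume x: "x \<in> {0..2*pi}"
      have "\<exists>y\<in>{0..2*pi}. y - T * sin y = (if x > \<xi> then x - \<xi> else x - \<xi> + 2 * pi) \<and> u x T = - sin y"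
      proof (cases "x > \<xi>")
        case True
        then show ?thesis using elim(1) x \<xi> by auto
      next
        case False
        then have "x + (2 * pi - \<xi>) \<in> {0..2*pi}" using x \<xi> by auto
        then show ?thesis using elim(2) False per[of x] by (auto simp: algebra_simps)
      qed
      then obtain y where y: "y \<in> {0..2*pi}" "y - T * sin y = (if x > \<xi> then x - \<xi> else x - \<xi> + 2 * pi)" "u x T = - sin y"
        by blast
      show "\<bar>u x T - hard_sdon T n \<xi> x\<bar> \<le> 2 * (2 * pi / 2 ^ n) + 2 * indicator {\<xi> - 2 * pi / 2 ^ n..\<xi> + 2 * pi / 2 ^ n} x"
        unfolding y(3) by (rule hard_sdon_error[OF T \<xi> _ _ elim(3) y(1,2)]) (use x elim(4) in auto)
    qed
  qed
qed

lemma soft_sdon_close: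
  fixes e :: real
  assumes "e > 0"
  obtains \<eta> where "\<eta> > 0"
    "(\<integral>\<^sup>+ \<xi>\<in>{0..2*pi}. (\<integral>\<^sup>+ x\<in>{0..2*pi}. ennreal \<bar>hard_sdon T n \<xi> x - soft_sdon T \<eta> n \<xi> x\<bar> \<partial>lborel) \<partial>lborel) < ennreal e"
proof -
  let ?Q = "{0..2*pi} \<times> {0..2*pi} :: (real \<times> real) set"
  define g where "g k p = ennreal (indicator ?Q p * \<bar>hard_sdon T n (fst p) (snd p) - soft_sdon T (1 / real (Suc k)) n (fst p) (snd p)\<bar>)" for k p
  have mQ: "?Q \<in> sets borel" by (intro borel_closed closed_Times) auto
  have [measurable]: "(\<lambda>p. soft_sdon T (1 / real (Suc k)) n (fst p) (snd p)) \<in> borel_measurable borel" for k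
    by (rule borel_measurable_soft_sdon) simp
  have [measurable]: "(\<lambda>p. hard_sdon T n (fst p) (snd p)) \<in> borel_measurable borel"
    by (rule borel_measurable_hard_sdon)
  note [measurable] = mQ
  have mg: "g k \<in> borel_measurable borel" for k unfolding g_def by measurable
  have "(\<lambda>k. \<integral>\<^sup>+ p. g k p \<partial>lborel) \<longlonglongrightarrow> (\<integral>\<^sup>+ p. 0 \<partial>(lborel :: (real \<times> real) measure))"
  \<comment> \<open>Both outputs are clipped to [-1, 1], so 2 dominates their distance on the
    square.\<close>
  proof (rule nn_integral_dominated_convergence[where w = "\<lambda>p. 2 * indicator ?Q p"])
    show "AE p in lborel. g k p \<le> 2 * indicator ?Q p" for k
    proof (intro AE_I2)
      fix p :: "real \<times> real"
      have "\<bar>hard_sdon T n (fst p) (snd p) - soft_sdon T (1 / real (Suc k)) n (fst p) (snd p)\<bar> \<le> 2"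
        using hard_sdon_bound[of T n "fst p" "snd p"] soft_sdon_bound[of T "1 / real (Suc k)" n "fst p" "snd p"] by linarith
      then have "ennreal \<bar>hard_sdon T n (fst p) (snd p) - soft_sdon T (1 / real (Suc k)) n (fst p) (snd p)\<bar> \<le> ennreal 2"
        by (rule ennreal_leI)
      then show "g k p \<le> 2 * indicator ?Q p" by (auto simp: g_def indicator_def)
    qed
    have "emeasure lborel ?Q < \<infinity>" by (intro emeasure_compact_finite compact_Times) auto
    then show "(\<integral>\<^sup>+ p. 2 * indicator ?Q p \<partial>lborel) < \<infinity>"
      using mQ by (simp add: nn_integral_cmult_indicator ennreal_mult_less_top)
    show "AE p in lborel. (\<lambda>k. g k p) \<longlonglongrightarrow> 0"
    proof (intro AE_I2 tendsto_eventually)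
      fix p :: "real \<times> real"
      show "\<forall>\<^sub>F k in sequentially. g k p = 0"
        using soft_sdon_eventually[of T n "fst p" "snd p"] by eventually_elim (simp add: g_def)
    qed
  qed (use mg mQ in auto)
  then have "(\<lambda>k. \<integral>\<^sup>+ p. g k p \<partial>lborel) \<longlonglongrightarrow> 0" by simp
  then have "\<forall>\<^sub>F k in sequentially. (\<integral>\<^sup>+ p. g k p \<partial>lborel) < ennreal e"
    by (rule order_tendstoD(2)) (use assms in simp)
  then obtain k where k: "(\<integral>\<^sup>+ p. g k p \<partial>lborel) < ennreal e"
    by (auto simp: eventually_sequentially)
  have "(\<integral>\<^sup>+ p. g k p \<partial>lborel) = (\<integral>\<^sup>+ \<xi>. (\<integral>\<^sup>+ x. g k (\<xi>, x) \<partial>lborel) \<partial>lborel)"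
    using lborel.nn_integral_fst[of "g k" lborel] mg[of k] by (simp add: lborel_prod)
  also have "\<dots> = (\<integral>\<^sup>+ \<xi>\<in>{0..2*pi}. (\<integral>\<^sup>+ x\<in>{0..2*pi}. ennreal \<bar>hard_sdon T n \<xi> x - soft_sdon T (1 / real (Suc k)) n \<xi> x\<bar> \<partial>lborel) \<partial>lborel)"
  proof (rule nn_integral_cong)
    fix \<xi> :: real
    show "(\<integral>\<^sup>+ x. g k (\<xi>, x) \<partial>lborel) = (\<integral>\<^sup>+ x\<in>{0..2*pi}. ennreal \<bar>hard_sdon T n \<xi> x - soft_sdon T (1 / real (Suc k)) n \<xi> x\<bar> \<partial>lborel) * indicator {0..2*pi} \<xi>"
      by (cases "\<xi> \<in> {0..2*pi}") (auto simp: g_def indicator_def intro!: nn_integral_cong)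
  qed
  finally show thesis using that[of "1 / real (Suc k)"] k by simp
qed

text \<open>Nothing is known about the dependence of \<open>U\<close> on \<xi>, not even
  measurability. So \<open>U\<close> is estimated at each fixed \<xi> by a constant plus the
  measurable \<open>S \<xi>\<close>, and only this bound is integrated term by term.\<close>

lemma expectation_error:
  fixes U :: "real \<Rightarrow> real \<Rightarrow> real \<Rightarrow> real"
  assumes T: "T > pi" and \<eta>: "\<eta> > 0"
    and close: "(\<integral>\<^sup>+ \<xi>\<in>{0..2*pi}. (\<integral>\<^sup>+ x\<in>{0..2*pi}. ennreal \<bar>hard_sdon T n \<xi> x - soft_sdon T \<eta> n \<xi> x\<bar> \<partial>lborel) \<partial>lborel) \<le> ennreal e"
    and e: "e > 0" and U: "\<forall>\<xi>\<in>{0..2*pi}. entropy_solution (\<lambda>x. - sin (x - \<xi>)) (U \<xi>)"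
  shows "(\<integral>\<^sup>+ \<xi>. (\<integral>\<^sup>+ x\<in>{0..2*pi}. ennreal \<bar>U \<xi> x T - soft_sdon T \<eta> n \<xi> x\<bar> \<partial>lborel)
             \<partial>(uniform_measure lborel {0..2*pi})) \<le> ennreal ((4 * pi + 4) * (2 * pi / 2 ^ n) + e)"
proof -
  define H where "H = 2 * pi / 2 ^ n"
  have H: "H > 0" by (simp add: H_def)
  let ?\<mu> = "uniform_measure lborel {0..2*pi}"
  define S where "S \<xi> = (\<integral>\<^sup>+ x\<in>{0..2*pi}. ennreal \<bar>hard_sdon T n \<xi> x - soft_sdon T \<eta> n \<xi> x\<bar> \<partial>lborel)" for \<xi>
  note m = borel_measurable_soft_sdon[OF \<eta>, of T n] borel_measurable_hard_sdon[of T n]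
  have msec: "(\<lambda>x. hard_sdon T n \<xi> x) \<in> borel_measurable borel" "(\<lambda>x. soft_sdon T \<eta> n \<xi> x) \<in> borel_measurable borel" for \<xi>
    using measurable_compose[OF _ m(1), of "\<lambda>x. (\<xi>, x)" borel] measurable_compose[OF _ m(2), of "\<lambda>x. (\<xi>, x)" borel] by auto
  have mS: "S \<in> borel_measurable borel"
  proof -
    have "(\<lambda>p. ennreal \<bar>hard_sdon T n (fst p) (snd p) - soft_sdon T \<eta> n (fst p) (snd p)\<bar> * indicator {0..2*pi} (snd p)) \<in> borel_measurable (borel \<Otimes>\<^sub>M borel)"
      using m unfolding borel_prod[symmetric] by measurable
    then have "(\<lambda>p. ennreal \<bar>hard_sdon T n (fst p) (snd p) - soft_sdon T \<eta> n (fst p) (snd p)\<bar> * indicator {0..2*pi} (snd p)) \<in> borel_measurable (borel \<Otimes>\<^sub>M lborel)"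
      by simp
    from lborel.borel_measurable_nn_integral_fst[OF this] show ?thesis by (simp add: S_def[abs_def])
  qed
  have inner: "(\<integral>\<^sup>+ x\<in>{0..2*pi}. ennreal \<bar>U \<xi> x T - soft_sdon T \<eta> n \<xi> x\<bar> \<partial>lborel) \<le> ennreal ((4 * pi + 4) * H) + S \<xi>"
    if \<xi>: "0 \<le> \<xi>" "\<xi> < 2 * pi" for \<xi>
  proof -
    have "entropy_solution (\<lambda>x. - sin (x - \<xi>)) (U \<xi>)" using U \<xi> by auto
    from entropy_solution_hard_sdon[OF T \<xi> this, of n]
    have "AE x in lborel. ennreal \<bar>U \<xi> x T - soft_sdon T \<eta> n \<xi> x\<bar> * indicator {0..2*pi} x
       \<le> (ennreal (2 * H) * indicator {0..2*pi} x + ennreal 2 * indicator {\<xi> - H..\<xi> + H} x)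
          + ennreal \<bar>hard_sdon T n \<xi> x - soft_sdon T \<eta> n \<xi> x\<bar> * indicator {0..2*pi} x"
    proof eventually_elim
      case (elim x)
      show ?case
      proof (cases "x \<in> {0..2*pi}")
        case True
        then have "\<bar>U \<xi> x T - hard_sdon T n \<xi> x\<bar> \<le> 2 * H + 2 * indicator {\<xi> - H..\<xi> + H} x"
          using elim by (simp add: H_def)
        then have "\<bar>U \<xi> x T - soft_sdon T \<eta> n \<xi> x\<bar> \<le> (2 * H + 2 * indicator {\<xi> - H..\<xi> + H} x) + \<bar>hard_sdon T n \<xi> x - soft_sdon T \<eta> n \<xi> x\<bar>"
          by linarith
        from ennreal_leI[OF this] show ?thesis
          using True H by (cases "x \<in> {\<xi> - H..\<xi> + H}") (simp_all add: ennreal_plus ennreal_mult)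
      qed simp
    qed
    then have "(\<integral>\<^sup>+ x\<in>{0..2*pi}. ennreal \<bar>U \<xi> x T - soft_sdon T \<eta> n \<xi> x\<bar> \<partial>lborel)
       \<le> (\<integral>\<^sup>+ x. (ennreal (2 * H) * indicator {0..2*pi} x + ennreal 2 * indicator {\<xi> - H..\<xi> + H} x)
          + ennreal \<bar>hard_sdon T n \<xi> x - soft_sdon T \<eta> n \<xi> x\<bar> * indicator {0..2*pi} x \<partial>lborel)"
      by (rule nn_integral_mono_AE)
    also have "\<dots> = (\<integral>\<^sup>+ x. ennreal (2 * H) * indicator {0..2*pi} x + ennreal 2 * indicator {\<xi> - H..\<xi> + H} x \<partial>lborel) + S \<xi>"
      unfolding S_def using msec by (intro nn_integral_add) auto
    also have "(\<integral>\<^sup>+ x. ennreal (2 * H) * indicator {0..2*pi} x + ennreal 2 * indicator {\<xi> - H..\<xi> + H} x \<partial>lborel)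
       = (\<integral>\<^sup>+ x. ennreal (2 * H) * indicator {0..2*pi} x \<partial>lborel) + (\<integral>\<^sup>+ x. ennreal 2 * indicator {\<xi> - H..\<xi> + H} x \<partial>lborel)"
      by (intro nn_integral_add) auto
    \<comment> \<open>The value 2 H over a period of length 2 pi, and 2 over an interval of length 2
      H around the shock: together (4 pi + 4) H.\<close>
    also have "\<dots> = ennreal (2 * H) * ennreal (2 * pi) + ennreal 2 * ennreal (2 * H)"
      using H by (simp add: nn_integral_cmult_indicator)
    also have "\<dots> = ennreal ((4 * pi + 4) * H)"
      using H by (simp only: ennreal_mult[symmetric] ennreal_plus[symmetric] mult_nonneg_nonneg less_imp_le zero_le_numeral pi_ge_zero) (simp add: algebra_simps)
    finally show ?thesis .
  qed
  have em: "emeasure lborel {0..2*pi} = ennreal (2 * pi)" by simp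
  interpret P: prob_space ?\<mu>
    by (rule prob_space_uniform_measure) (auto simp: em)
  have "AE \<xi> in ?\<mu>. (\<integral>\<^sup>+ x\<in>{0..2*pi}. ennreal \<bar>U \<xi> x T - soft_sdon T \<eta> n \<xi> x\<bar> \<partial>lborel) \<le> ennreal ((4 * pi + 4) * H) + S \<xi>"
  proof (rule AE_uniform_measureI)
    have "AE \<xi> in lborel. \<xi> \<noteq> 2 * pi" by (rule AE_lborel_singleton)
    then show "AE \<xi> in lborel. \<xi> \<in> {0..2*pi} \<longrightarrow> (\<integral>\<^sup>+ x\<in>{0..2*pi}. ennreal \<bar>U \<xi> x T - soft_sdon T \<eta> n \<xi> x\<bar> \<partial>lborel) \<le> ennreal ((4 * pi + 4) * H) + S \<xi>"
      by eventually_elim (use inner in auto)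
  qed simp
  then have "(\<integral>\<^sup>+ \<xi>. (\<integral>\<^sup>+ x\<in>{0..2*pi}. ennreal \<bar>U \<xi> x T - soft_sdon T \<eta> n \<xi> x\<bar> \<partial>lborel) \<partial>?\<mu>)
      \<le> (\<integral>\<^sup>+ \<xi>. ennreal ((4 * pi + 4) * H) + S \<xi> \<partial>?\<mu>)"
    by (rule nn_integral_mono_AE)
  also have "\<dots> = (\<integral>\<^sup>+ \<xi>. ennreal ((4 * pi + 4) * H) \<partial>?\<mu>) + (\<integral>\<^sup>+ \<xi>. S \<xi> \<partial>?\<mu>)"
    using mS by (intro nn_integral_add) auto
  also have "(\<integral>\<^sup>+ \<xi>. ennreal ((4 * pi + 4) * H) \<partial>?\<mu>) = ennreal ((4 * pi + 4) * H)"
    using P.emeasure_space_1 by simp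
  also have "(\<integral>\<^sup>+ \<xi>. S \<xi> \<partial>?\<mu>) = (\<integral>\<^sup>+ \<xi>\<in>{0..2*pi}. S \<xi> \<partial>lborel) / emeasure lborel {0..2*pi}"
    using mS by (intro nn_integral_uniform_measure) auto
  also have "\<dots> \<le> ennreal e / ennreal (2 * pi)"
    unfolding em using close by (intro divide_right_mono_ennreal) (simp add: S_def)
  also have "\<dots> \<le> ennreal e"
  proof -
    have "e / (2 * pi) \<le> e" using e pi_gt3 by (simp add: field_simps)
    then show ?thesis using e by (simp add: divide_ennreal ennreal_leI)
  qed
  finally show ?thesis
    using e H unfolding H_def[symmetric] by (simp add: ennreal_plus add_left_mono)
qed

lemma search_depth:
  fixes \<epsilon> :: real
  assumes "0 < \<epsilon>" "\<epsilon> \<le> 1/2"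
  obtains n :: nat where "(4 * pi + 4) * (2 * pi / 2 ^ n) \<le> \<epsilon> / 2" "real (2 * n + 2) \<le> 100 * (ln (1 / \<epsilon>))\<^sup>2"
    "1 \<le> 4 * (ln (1 / \<epsilon>))\<^sup>2"
proof -
  define l where "l = log 2 (1 / \<epsilon>)"
  have l1: "1 \<le> l"
  proof -
    have "2 \<le> 1 / \<epsilon>" using assms by (simp add: field_simps)
    then have "log 2 2 \<le> l" unfolding l_def by (subst log_le_cancel_iff) (use assms in auto)
    then show ?thesis by simp
  qed
  have l2: "l\<^sup>2 \<le> 4 * (ln (1 / \<epsilon>))\<^sup>2"
  proof -
    have "ln 2 \<ge> (1/2 :: real)"
      using ln_one_minus_pos_lower_bound[of "1/2"] ln_le_minus_one[of "1/2::real"] by (simp add: ln_div)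
    then have "l * (1/2) \<le> l * ln 2" using l1 by (intro mult_left_mono) auto
    also have "\<dots> = ln (1 / \<epsilon>)" by (simp add: l_def log_def)
    finally have "l \<le> 2 * ln (1 / \<epsilon>)" by simp
    then have "l\<^sup>2 \<le> (2 * ln (1 / \<epsilon>))\<^sup>2" using l1 by (intro power_mono) auto
    then show ?thesis by (simp add: power_mult_distrib)
  qed
  \<comment> \<open>Since pi < 4, (4 pi + 4) 2 pi is at most 160, so \<epsilon> 2^n \<ge> 320 is
    required; 9 extra halvings give 2^9 = 512.\<close>
  define n where "n = nat \<lceil>l + 9\<rceil>"
  have n: "l + 9 \<le> real n" "real n \<le> l + 10" using l1 unfolding n_def by linarith+
  have ll: "1 \<le> l\<^sup>2" "l \<le> l\<^sup>2"
    using mult_mono[OF l1 l1] mult_mono[OF l1 order_refl[of l]] l1 by (simp_all add: power2_eq_square)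
  show thesis
  proof (rule that[of n])
    have "512 / \<epsilon> = 2 powr (l + 9)"
    proof -
      have "2 powr l = 1 / \<epsilon>" unfolding l_def using assms by (intro powr_log_cancel) auto
      then show ?thesis by (simp add: powr_add)
    qed
    also have "\<dots> \<le> 2 powr real n" using n by simp
    also have "\<dots> = 2 ^ n" by (simp add: powr_realpow)
    finally have "512 \<le> \<epsilon> * 2 ^ n" using assms by (simp add: field_simps)
    moreover have "(4 * pi + 4) * (2 * pi) \<le> (4 * 4 + 4) * (2 * 4)"
      using pi_less_4 by (intro mult_mono) auto
    ultimately show "(4 * pi + 4) * (2 * pi / 2 ^ n) \<le> \<epsilon> / 2" by (simp add: field_simps)
    have "real (2 * n + 2) \<le> 2 * (l + 10) + 2" using n by simp
    also have "\<dots> \<le> 25 * (4 * (ln (1 / \<epsilon>))\<^sup>2)"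
    proof -
      have "2 * (l + 10) + 2 \<le> 25 * Y" if "1 \<le> X" "l \<le> X" "X \<le> Y" for X Y
        using that by simp
      from this[OF ll l2] show ?thesis .
    qed
    also have "\<dots> = 100 * (ln (1 / \<epsilon>))\<^sup>2" by simp
    finally show "real (2 * n + 2) \<le> 100 * (ln (1 / \<epsilon>))\<^sup>2" .
    show "1 \<le> 4 * (ln (1 / \<epsilon>))\<^sup>2" using ll l2 by linarith
  qed
qed

theorem theorem3p5:
  fixes T :: real
  assumes "T > pi"
  shows "\<exists>C>0. \<forall>\<epsilon>::real. 0 < \<epsilon> \<and> \<epsilon> \<le> 1/2 \<longrightarrow>
    (\<exists>xs p br tr sc sh.
       length xs = 3 \<and> is_sdon xs p br tr sc sh \<and>
       real p \<le> C \<and>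
       real (sdon_width br tr sc sh) \<le> C \<and>
       real (sdon_depth br tr sc sh) \<le> C * (ln (1 / \<epsilon>))\<^sup>2 \<and>
       real (sdon_size xs p br tr sc sh) \<le> C * (ln (1 / \<epsilon>))\<^sup>2 \<and>
       (\<forall>U. (\<forall>\<xi>\<in>{0..2*pi}. entropy_solution (\<lambda>x. - sin (x - \<xi>)) (U \<xi>)) \<longrightarrow>
          (\<integral>\<^sup>+ \<xi>. (\<integral>\<^sup>+ x\<in>{0..2*pi}.
               ennreal \<bar>U \<xi> x T - sdon_eval xs p br tr sc sh (\<lambda>x. - sin (x - \<xi>)) x\<bar> \<partial>lborel)
             \<partial>(uniform_measure lborel {0..2*pi})) \<le> ennreal \<epsilon>))"
\<comment> \<open>With L = ln (1 / \<epsilon>)^2, width at most 22 and depth at most 100 L, the size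
  is at most 4 * 22 + 484 * 100 L; as 1 \<le> 4 L, this is at most (352 + 48400) L.\<close>
proof (intro exI[of _ 50000] conjI allI impI, goal_cases)
  case (2 \<epsilon>)
  note \<epsilon> = this
  define L where "L = (ln (1 / \<epsilon>))\<^sup>2"
  obtain n where n: "(4 * pi + 4) * (2 * pi / 2 ^ n) \<le> \<epsilon> / 2" "real (2 * n + 2) \<le> 100 * L" "1 \<le> 4 * L"
    using search_depth[of \<epsilon>] \<epsilon> unfolding L_def by blast
  \<comment> \<open>n is fixed first, spending half of \<epsilon> on the search. Then \<eta>, which
    affects the weights but neither width nor depth, is chosen for the other half.\<close>
  have "\<epsilon> / 2 > 0" using \<epsilon> by simp
  from soft_sdon_close[OF this, where T = T and n = n] obtain \<eta> where \<eta>: "\<eta> > 0"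
    "(\<integral>\<^sup>+ \<xi>\<in>{0..2*pi}. (\<integral>\<^sup>+ x\<in>{0..2*pi}. ennreal \<bar>hard_sdon T n \<xi> x - soft_sdon T \<eta> n \<xi> x\<bar> \<partial>lborel) \<partial>lborel) < ennreal (\<epsilon> / 2)"
    by blast
  obtain xs br tr sc sh where net: "length xs = 3" "is_sdon xs 1 br tr sc sh"
    "sdon_width br tr sc sh \<le> 22" "sdon_depth br tr sc sh = 2 * n + 2"
    "\<And>\<xi> x. sdon_eval xs 1 br tr sc sh (\<lambda>x. - sin (x - \<xi>)) x = soft_sdon T \<eta> n \<xi> x"
    using sdon_exists[OF \<eta>(1), where T = T and n = n] unfolding soft_sdon_def by blast
  have size: "real (sdon_size xs 1 br tr sc sh) \<le> 50000 * L"
  proof -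
    have "sdon_size xs 1 br tr sc sh \<le> 4 * 22 + 22\<^sup>2 * (2 * n + 2)"
      unfolding sdon_size_def net(1,4) by (intro add_mono mult_mono power_mono net(3)) auto
    then have "real (sdon_size xs 1 br tr sc sh) \<le> real (4 * 22 + 22\<^sup>2 * (2 * n + 2))" by (rule of_nat_mono)
    also have "\<dots> = 88 + 484 * real (2 * n + 2)" by simp
    also have "\<dots> \<le> 352 * L + 484 * (100 * L)" using n(2,3) by (intro add_mono mult_left_mono) simp_all
    also have "\<dots> \<le> 50000 * L" using n(3) by simp
    finally show ?thesis .
  qed
  have err: "(\<integral>\<^sup>+ \<xi>. (\<integral>\<^sup>+ x\<in>{0..2*pi}.
               ennreal \<bar>U \<xi> x T - sdon_eval xs 1 br tr sc sh (\<lambda>x. - sin (x - \<xi>)) x\<bar> \<partial>lborel)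
             \<partial>(uniform_measure lborel {0..2*pi})) \<le> ennreal \<epsilon>"
    if U: "\<forall>\<xi>\<in>{0..2*pi}. entropy_solution (\<lambda>x. - sin (x - \<xi>)) (U \<xi>)" for U
    unfolding net(5)
  proof (rule order_trans[OF expectation_error[OF assms \<eta>(1) less_imp_le[OF \<eta>(2)] \<open>\<epsilon> / 2 > 0\<close> U]])
    show "ennreal ((4 * pi + 4) * (2 * pi / 2 ^ n) + \<epsilon> / 2) \<le> ennreal \<epsilon>"
      by (rule ennreal_leI) (use n(1) in linarith)
  qed
  have width: "real (sdon_width br tr sc sh) \<le> 50000" using net(3) by simp
  have depth: "real (sdon_depth br tr sc sh) \<le> 50000 * L" unfolding net(4) using n by linarith
  show ?case
    using net(1,2) width depth size err unfolding L_def[symmetric]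
    by (intro exI[of _ xs] exI[of _ "1::nat"] exI[of _ br] exI[of _ tr] exI[of _ sc] exI[of _ sh]) simp
qed simp

end
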